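(* Let $n\ge1$ and $\lambda\ge2$ be integers and let $\Gamma:=\frac{2\pi}{\lambda}\cdot\{0,1,\dots,\lambda-1\}^n$. Let $S$ be a nonzero rational trigonometric polynomial on $\mathbb{T}^n$ that is nonnegative on $\mathbb{T}^n$, and let $\tau$ be a rational trigonometric polynomial on $\mathbb{T}^n$ satisfying $\tau(0)=1$. Suppose the following conditions hold: (i) (oblique sub-QMF condition) $$f_{\tau,S}(\xi):=\frac{1}{S(\lambda\xi)}-\sum_{\gamma\in\Gamma}\frac{|\tau(\xi+\gamma)|^2}{S(\xi+\gamma)}\ge0$$ for all $\xi\in\mathbb{T}^n$ at which the rational trigonometric polynomial $f_{\tau,S}$ is defined; (ii) $S$ is continuous at $0$ with $S(0)=1$, and $1/S\in L^\infty(\mathbb{R}^n)$. Then $\phi_\tau$, defined by specifying its Fourier transform as $\widehat{\phi_\tau}(\xi):=\prod_{j=1}^\infty\tau(\lambda^{-j}\xi)$, is a refinable function in $L^2(\mathbb{R}^n)$ (with refinement mask $\tau$), i.e. $\phi_\tau\in L^2(\mathbb{R}^n)$ and $\widehat{\phi_\tau}(\lambda\xi)=\tau(\xi)\widehat{\phi_\tau}(\xi)$.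
   Context: A trigonometric polynomial on $\mathbb{T}^n=\mathbb{R}^n/(2\pi\mathbb{Z})^n$ is a finite sum $\sum_{k\in\mathbb{Z}^n}h(k)e^{-ik\cdot\xi}$ with complex coefficients. A rational trigonometric polynomial is a quotient $\tau_1/\tau_2$ of trigonometric polynomials with $\tau_2\not\equiv0$ and with the greatest common divisor of $\tau_1$ and $\tau_2$ constant; prescribing its value at a point includes that it is defined there. Functions on $\mathbb{T}^n$ are identified with functions on $\mathbb{R}^n$ that are $2\pi$-periodic in each variable. The Fourier transform is normalized by $\widehat f(\xi)=\int_{\mathbb{R}^n}f(x)e^{-ix\cdot\xi}\,dx$ for $f\in L^1(\mathbb{R}^n)\cap L^2(\mathbb{R}^n)$. A function $\phi\in L^2(\mathbb{R}^n)$ is refinable if $\widehat\phi(\lambda\cdot)=\tau(\cdot)\widehat\phi(\cdot)$ (almost everywhere) for a $2\pi$-periodic function $\tau$, called the associated refinement mask. *)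

theory Defs
  imports "HOL-Analysis.Analysis"
begin

section \<open>Trigonometric polynomials\<close>

definition trig_poly :: "(real^'n \<Rightarrow> complex) \<Rightarrow> bool" where
  "trig_poly p \<longleftrightarrow> (\<exists>(K :: (int^'n) set) h. finite K \<and>
     p = (\<lambda>\<xi>. \<Sum>k\<in>K. h k * exp (- \<i> * of_real ((\<chi> i. real_of_int (k $ i)) \<bullet> \<xi>))))"

text \<open>Divisibility and greatest common divisors in the ring of trigonometric polynomials.\<close>

definition tp_dvd :: "(real^'n \<Rightarrow> complex) \<Rightarrow> (real^'n \<Rightarrow> complex) \<Rightarrow> bool" where
  "tp_dvd d p \<longleftrightarrow> trig_poly d \<and> (\<exists>r. trig_poly r \<and> p = (\<lambda>\<xi>. d \<xi> * r \<xi>))"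

definition tp_is_gcd ::
    "(real^'n \<Rightarrow> complex) \<Rightarrow> (real^'n \<Rightarrow> complex) \<Rightarrow> (real^'n \<Rightarrow> complex) \<Rightarrow> bool" where
  "tp_is_gcd d p q \<longleftrightarrow> tp_dvd d p \<and> tp_dvd d q \<and> (\<forall>e. tp_dvd e p \<longrightarrow> tp_dvd e q \<longrightarrow> tp_dvd e d)"

text \<open>
  A greatest common divisor is determined up to units, here the monomials
  \<open>c * exp (- \<i> k\<bullet>\<xi>)\<close> with \<open>c \<noteq> 0\<close>; ``the gcd is constant'' therefore means that the constant
  \<open>1\<close> is a gcd.  A rational trigonometric polynomial is a partial function: it is defined exactly
  where the denominator of the reduced fraction does not vanish.
\<close>

definition rational_trig_poly :: "(real^'n \<rightharpoonup> complex) \<Rightarrow> bool" where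
  "rational_trig_poly R \<longleftrightarrow> (\<exists>p q. trig_poly p \<and> trig_poly q \<and> (\<exists>\<xi>. q \<xi> \<noteq> 0) \<and>
     tp_is_gcd (\<lambda>_. 1) p q \<and>
     R = (\<lambda>\<xi>. if q \<xi> = 0 then None else Some (p \<xi> / q \<xi>)))"

text \<open>Extension to a total function by \<open>0\<close> on the null set where it is undefined.\<close>

definition total_ext :: "(real^'n \<rightharpoonup> complex) \<Rightarrow> real^'n \<Rightarrow> complex" where
  "total_ext R \<xi> = (case R \<xi> of None \<Rightarrow> 0 | Some z \<Rightarrow> z)"

section \<open>The oblique sub-QMF condition\<close>

definition shifts :: "nat \<Rightarrow> (real^'n) set" where
  "shifts lam = {\<gamma>. \<forall>i. \<exists>m<lam. \<gamma> $ i = 2 * pi / real lam * real m}"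

definition qmf_terms_defined ::
    "nat \<Rightarrow> (real^'n \<rightharpoonup> complex) \<Rightarrow> (real^'n \<rightharpoonup> complex) \<Rightarrow> real^'n \<Rightarrow> bool" where
  "qmf_terms_defined lam \<tau> S \<xi> \<longleftrightarrow>
     S (real lam *\<^sub>R \<xi>) \<notin> {None, Some 0} \<and>
     (\<forall>\<gamma>\<in>shifts lam. \<tau> (\<xi> + \<gamma>) \<noteq> None \<and> S (\<xi> + \<gamma>) \<notin> {None, Some 0})"

text \<open>
  \<open>F\<close> is the rational trigonometric polynomial \<open>f\<^bsub>\<tau>,S\<^esub>\<close>.  As the points at which some term of the
  formula is undefined lie in the zero set of a nonzero trigonometric polynomial, the formula
  determines \<open>F\<close>; but \<open>F\<close>, being a reduced fraction, may be defined at some of these points too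
  (for instance where \<open>S\<close> has a pole, so that \<open>1/S\<close> vanishes).
\<close>

definition is_qmf_fun ::
    "nat \<Rightarrow> (real^'n \<rightharpoonup> complex) \<Rightarrow> (real^'n \<rightharpoonup> complex) \<Rightarrow> (real^'n \<rightharpoonup> complex) \<Rightarrow> bool" where
  "is_qmf_fun lam \<tau> S F \<longleftrightarrow> rational_trig_poly F \<and>
     (\<forall>\<xi>\<in>dom F. qmf_terms_defined lam \<tau> S \<xi> \<longrightarrow>
        F \<xi> = Some (1 / total_ext S (real lam *\<^sub>R \<xi>)
          - (\<Sum>\<gamma>\<in>shifts lam. of_real ((cmod (total_ext \<tau> (\<xi> + \<gamma>)))\<^sup>2) / total_ext S (\<xi> + \<gamma>))))"

section \<open>Function spaces and the Fourier transform\<close>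

definition ess_bounded :: "(real^'n \<Rightarrow> complex) \<Rightarrow> bool" where
  "ess_bounded f \<longleftrightarrow> f \<in> borel_measurable lborel \<and> (\<exists>C. AE \<xi> in lborel. cmod (f \<xi>) \<le> C)"

definition in_L2 :: "(real^'n \<Rightarrow> complex) \<Rightarrow> bool" where
  "in_L2 f \<longleftrightarrow> f \<in> borel_measurable lborel \<and> integrable lborel (\<lambda>x. (cmod (f x))\<^sup>2)"

definition L2_tendsto :: "(nat \<Rightarrow> real^'n \<Rightarrow> complex) \<Rightarrow> (real^'n \<Rightarrow> complex) \<Rightarrow> bool" where
  "L2_tendsto u f \<longleftrightarrow>
     (\<lambda>k. \<integral>\<^sup>+x. ennreal ((cmod (u k x - f x))\<^sup>2) \<partial>lborel) \<longlonglongrightarrow> 0"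

definition fourier_L1 :: "(real^'n \<Rightarrow> complex) \<Rightarrow> real^'n \<Rightarrow> complex" where
  "fourier_L1 f \<xi> = (LINT x|lborel. f x * exp (- \<i> * of_real (x \<bullet> \<xi>)))"

text \<open>
  The Fourier transform on \<open>L\<^sup>2\<close> is the continuous extension of the one on \<open>L\<^sup>1 \<inter> L\<^sup>2\<close>.  It is
  determined up to null sets only, so it is rendered as the relation
  ``\<open>g\<close> represents the Fourier transform of \<open>f\<close>''.
\<close>

definition fourier_L2 :: "(real^'n \<Rightarrow> complex) \<Rightarrow> (real^'n \<Rightarrow> complex) \<Rightarrow> bool" where
  "fourier_L2 f g \<longleftrightarrow> in_L2 f \<and> in_L2 g \<and>
     (\<exists>u. (\<forall>k. integrable lborel (u k) \<and> in_L2 (u k)) \<and>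
          L2_tendsto u f \<and> L2_tendsto (\<lambda>k. fourier_L1 (u k)) g)"

section \<open>Refinable functions\<close>

definition periodic_2pi :: "(real^'n \<Rightarrow> complex) \<Rightarrow> bool" where
  "periodic_2pi m \<longleftrightarrow> (\<forall>\<xi> i. m (\<xi> + axis i (2 * pi)) = m \<xi>)"

definition refinable_with_mask ::
    "nat \<Rightarrow> (real^'n \<Rightarrow> complex) \<Rightarrow> (real^'n \<Rightarrow> complex) \<Rightarrow> bool" where
  "refinable_with_mask lam m \<phi> \<longleftrightarrow> in_L2 \<phi> \<and> periodic_2pi m \<and>
     (\<exists>g. fourier_L2 \<phi> g \<and> (AE \<xi> in lborel. g (real lam *\<^sub>R \<xi>) = m \<xi> * g \<xi>))"

text \<open>The library's infinite products are indexed from \<open>0\<close>.\<close>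

definition mask_product :: "nat \<Rightarrow> (real^'n \<rightharpoonup> complex) \<Rightarrow> real^'n \<Rightarrow> complex" where
  "mask_product lam \<tau> \<xi> = (\<Prod>j. total_ext \<tau> ((1 / real lam ^ Suc j) *\<^sub>R \<xi>))"

end

theory Submission
  imports Defs "HOL-Complex_Analysis.Conformal_Mappings" "HOL-Probability.Probability"
begin

text \<open>
  Put \<open>\<sigma> = 1/S\<close> and \<open>J\<^sub>k = \<integral> \<sigma>(\<xi>) \<Prod>\<^bsub>j<k\<^esub> |\<tau>(\<lambda>\<^sup>j \<xi>)|\<^sup>2 d\<xi>\<close> over a period cube.  Cutting the cube into the translates by
  \<open>\<Gamma>\<close> of the cube of side \<open>2\<pi>/\<lambda>\<close>, the factors with \<open>j \<ge> 1\<close> do not see the translation, so the sub-QMF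
  inequality and the substitution \<open>\<lambda>\<xi> \<mapsto> \<xi>\<close> give \<open>\<lambda>\<^sup>n J\<^sub>k\<^sub>+\<^sub>1 \<le> J\<^sub>k\<close>.  Hence the integrals
  \<open>\<lambda>\<^bsup>nk\<^esup> J\<^sub>k\<close> of the rescaled integrands, which converge pointwise to the square of the infinite product because \<open>S\<close> is continuous
  at \<open>0\<close> with value \<open>1\<close>, are bounded by \<open>J\<^sub>0\<close>, and Fatou's lemma applies.  The
  cube is centred at \<open>0\<close> and of side \<open>4\<pi>\<close> there, so that its dilates exhaust the space.

  The sub-QMF inequality is assumed only for a reduced fraction, so one has to know that every
  quotient of trigonometric polynomials can be reduced.  Widths of supports in the coordinate
  directions add up under multiplication, so a quotient whose denominator has least total width is
  reduced.

  That every \<open>g\<close> in \<open>L\<^sup>2\<close> is a Fourier transform is shown for bounded integrable \<open>g\<close> first: damping the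
  inverse transform of \<open>g\<close> by a Gaussian gives an integrable function whose transform is a Gaussian
  average of \<open>g\<close>, and these averages tend to \<open>g\<close>.
\<close>

section \<open>Trigonometric polynomials\<close>

text \<open>The assumption \<open>sub_QMF\<close> speaks of all \<open>F\<close> with
  \<open>is_qmf_fun lam \<tau> S F\<close>, so it says nothing until such an \<open>F\<close> is
  produced; this is what the algebra is for. The nonzero trigonometric polynomials of width zero are
  the monomials, which are the units, so that cancelling a common factor other than a unit lowers
  the width of the denominator. The inequality is then available off the zero sets of finitely many
  trigonometric polynomials. That these are null sets, shown by restricting to lines, also makes the
  ring an integral domain.

  The infinite product is controlled at every point: near 0 the mask differs from 1 by at most a
  constant times the norm, and a pole counts as a factor 0.

  On the Fourier side an inverse transform is bounded but need not be integrable, which is why it is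
  damped. Boundedness of \<open>g\<close> turns L1 convergence of its Gaussian averages into L2
  convergence. A general \<open>g\<close> is then reached through truncations with geometrically
  decreasing errors, so that their inverse transforms converge almost everywhere along the sequence
  itself.\<close>

lemma exponential_sum_countable_zeros:
  fixes c :: "'a \<Rightarrow> complex" and a :: "'a \<Rightarrow> real"
  assumes K: "finite K" "K \<noteq> {}" and inj: "inj_on a K" and c: "\<And>k. k \<in> K \<Longrightarrow> c k \<noteq> 0"
  shows "countable {t::real. (\<Sum>k\<in>K. c k * exp (- \<i> * of_real (t * a k))) = 0}"
proof -
  \<comment> \<open>The sum is the restriction to the real line of an entire function, which has
    countably many zeros unless it is constant. It is nontrivial because on the imaginary axis the
    terms become real exponentials, where the largest frequency dominates; injectivity of
    \<open>a\<close> makes that frequency occur once.\<close>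
  define f where "f z = (\<Sum>k\<in>K. c k * exp (- \<i> * (z * of_real (a k))))" for z
  have hol: "f holomorphic_on UNIV"
    unfolding f_def by (intro holomorphic_intros)
  have "Max (a ` K) \<in> a ` K" using K by simp
  then obtain m where "m \<in> K" "a m = Max (a ` K)" by auto
  then have m: "m \<in> K" "\<And>k. k \<in> K \<Longrightarrow> a k \<le> a m" using K by auto
  have lim: "((\<lambda>y. \<Sum>k\<in>K. c k * of_real (exp (y * (a k - a m))))
      \<longlongrightarrow> (\<Sum>k\<in>K. if k = m then c m else 0)) at_top"
  proof (intro tendsto_sum)
    fix k assume k: "k \<in> K"
    show "((\<lambda>y. c k * of_real (exp (y * (a k - a m)))) \<longlongrightarrow> (if k = m then c m else 0)) at_top"
    proof (cases "k = m")
      case False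
      define d where "d = a k - a m"
      have "a k \<noteq> a m" using False m(1) k inj by (auto dest: inj_onD)
      then have "d < 0" using m(2)[OF k] by (simp add: d_def)
      then have "((\<lambda>y. exp (y * d)) \<longlongrightarrow> 0) at_top"
        by real_asymp
      then have "((\<lambda>y. c k * of_real (exp (y * (a k - a m)))) \<longlongrightarrow> c k * of_real 0) at_top"
        unfolding d_def by (intro tendsto_intros)
      then show ?thesis using False by simp
    qed simp
  qed
  have "\<exists>z. f z \<noteq> 0"
  proof (rule ccontr)
    assume "\<not> ?thesis"
    then have z: "f (\<i> * of_real y) = 0" for y by auto
    have "(\<Sum>k\<in>K. c k * of_real (exp (y * (a k - a m)))) = f (\<i> * of_real y) * exp (- of_real (y * a m))" for y
      unfolding f_def sum_distrib_right
    proof (intro sum.cong refl)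
      fix k
      have "- \<i> * (\<i> * of_real y * of_real (a k)) = - (\<i> * \<i>) * of_real (y * a k)"
        by (simp only: of_real_mult mult.assoc mult_minus_left)
      then have "exp (- \<i> * (\<i> * of_real y * of_real (a k))) = of_real (exp (y * a k))"
        unfolding exp_of_real[symmetric] by simp
      moreover have "exp (- of_real (y * a m)) = complex_of_real (exp (- (y * a m)))"
        by (simp add: exp_of_real[symmetric])
      moreover have "exp (y * (a k - a m)) = exp (y * a k) * exp (- (y * a m))"
        by (simp add: exp_add[symmetric] algebra_simps)
      ultimately show "c k * of_real (exp (y * (a k - a m)))
          = c k * exp (- \<i> * (\<i> * of_real y * of_real (a k))) * exp (- of_real (y * a m))"
        by simp
    qed
    then have "((\<lambda>y. 0) \<longlongrightarrow> (\<Sum>k\<in>K. if k = m then c m else 0)) (at_top::real filter)"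
      using lim z by simp
    then have "(\<Sum>k\<in>K. if k = m then c m else 0) = 0"
      by (intro tendsto_unique[OF trivial_limit_at_top_linorder _ tendsto_const]) simp
    then show False using m c K by simp
  qed
  then have "countable {z. f z = 0}"
  proof (cases "f constant_on UNIV")
    case True
    with \<open>\<exists>z. f z \<noteq> 0\<close> have "{z. f z = 0} = {}" by (auto simp: constant_on_def)
    then show ?thesis by simp
  next
    case False
    then show ?thesis using holomorphic_countable_zeros[OF hol _ _ _ False] by (simp add: connected_UNIV)
  qed
  then have "countable (complex_of_real ` {t. f (of_real t) = 0})"
    by (rule countable_subset[rotated]) auto
  then have "countable {t. f (of_real t) = 0}"
    by (rule countable_image_inj_on) (simp add: inj_on_def)
  then show ?thesis
    by (simp add: f_def)
qed

section \<open>Characters of the torus and null zero sets\<close>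

definition int_vec :: "int^'n \<Rightarrow> real^'n" where
  "int_vec k = (\<chi> i. real_of_int (k $ i))"

lemma int_vec_nth [simp]: "int_vec k $ i = real_of_int (k $ i)"
  by (simp add: int_vec_def)

lemma int_vec_add: "int_vec (k + l) = int_vec k + int_vec l"
  and int_vec_minus: "int_vec (- k) = - int_vec k"
  and int_vec_0 [simp]: "int_vec 0 = 0"
  by (simp_all add: vec_eq_iff)

lemma int_vec_eq_iff [simp]: "int_vec k = int_vec l \<longleftrightarrow> k = l"
  by (simp add: vec_eq_iff)

definition trig_char :: "int^'n \<Rightarrow> real^'n \<Rightarrow> complex" where
  "trig_char k \<xi> = exp (- \<i> * of_real (int_vec k \<bullet> \<xi>))"

lemma trig_char_add: "trig_char (k + l) \<xi> = trig_char k \<xi> * trig_char l \<xi>"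
  by (simp add: trig_char_def int_vec_add inner_add_left exp_add[symmetric] algebra_simps)

lemma trig_char_shift: "trig_char k (\<xi> + \<eta>) = trig_char k \<xi> * trig_char k \<eta>"
  by (simp add: trig_char_def inner_add_right exp_add[symmetric] algebra_simps)

lemma trig_char_0 [simp]: "trig_char 0 \<xi> = 1" "trig_char k 0 = 1"
  by (simp_all add: trig_char_def)

lemma continuous_trig_char: "continuous_on UNIV (trig_char k)"
  unfolding trig_char_def by (intro continuous_intros)

text \<open>Along a line with direction \<open>v\<close> a trigonometric sum becomes an exponential
  sum in one variable. Its frequencies stay distinct as soon as \<open>v\<close> avoids finitely
  many hyperplanes, and these do not cover the space.\<close>

lemma generic_direction:
  fixes K :: "(int^'n) set"
  assumes "finite K"
  obtains v where "inj_on (\<lambda>k. int_vec k \<bullet> v) K"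
proof -
  define H where "H x = {v. (int_vec (fst x) - int_vec (snd x)) \<bullet> v = 0}" for x :: "(int^'n) \<times> (int^'n)"
  define D where "D = {x \<in> K \<times> K. fst x \<noteq> snd x}"
  have "finite D" unfolding D_def using assms by (intro finite_Collect_conjI) auto
  moreover have "negligible (H x)" if "x \<in> D" for x
    unfolding H_def using that by (intro negligible_hyperplane) (simp add: D_def)
  ultimately have "negligible (\<Union>(H ` D))" by (intro negligible_Union) auto
  then have "\<Union>(H ` D) \<noteq> UNIV" by (metis non_negligible_UNIV)
  then obtain v where v: "\<And>x. x \<in> D \<Longrightarrow> v \<notin> H x" by blast
  have "inj_on (\<lambda>k. int_vec k \<bullet> v) K"
  proof (rule inj_onI, rule ccontr)
    fix k l assume "k \<in> K" "l \<in> K" "int_vec k \<bullet> v = int_vec l \<bullet> v" "k \<noteq> l"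
    then have "(k, l) \<in> D" "v \<in> H (k, l)" by (auto simp: D_def H_def inner_diff_left)
    then show False using v by blast
  qed
  then show ?thesis by (rule that)
qed

text \<open>The whole space is not a null set. This extracts points from statements that hold almost
  everywhere, and a contradiction from \<open>AE x. False\<close>.\<close>

lemma AE_lborel_witness:
  assumes "AE x in (lborel :: 'a::euclidean_space measure). P x"
  obtains x where "P x"
proof (rule ccontr)
  assume "\<not> thesis"
  with that have "\<not> P x" for x by blast
  with assms have "AE x in (lborel :: 'a measure). x \<notin> UNIV" by simp
  then have "(UNIV :: 'a set) \<in> null_sets lborel"
    by (subst (asm) AE_iff_null_sets[symmetric]) auto
  then show False by (simp add: null_sets_def)
qed

text \<open>
  Integrate the indicator of \<open>Z\<close> at \<open>\<xi> + t v\<close> over all \<open>\<xi>\<close> and \<open>0 \<le> t \<le> 1\<close>: by translation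
  invariance the result is the measure of \<open>Z\<close>, and no coordinates adapted to \<open>v\<close> are needed.
\<close>

lemma null_set_by_lines:
  fixes Z :: "'a::euclidean_space set"
  assumes [measurable]: "Z \<in> sets borel" and "\<And>\<xi>. countable {t::real. \<xi> + t *\<^sub>R v \<in> Z}"
  shows "Z \<in> null_sets lborel"
proof -
  have "(\<integral>\<^sup>+\<xi>. \<integral>\<^sup>+t. indicator Z (\<xi> + t *\<^sub>R v) * indicator {0..1::real} t \<partial>lborel \<partial>lborel) = 0"
  proof -
    have "(\<integral>\<^sup>+t. indicator Z (\<xi> + t *\<^sub>R v) * indicator {0..1::real} t \<partial>lborel) = 0" for \<xi>
    proof -
      have "AE t in lborel. t \<notin> {t. \<xi> + t *\<^sub>R v \<in> Z}"
        by (rule AE_not_in[OF countable_imp_null_set_lborel[OF assms(2)]])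
      then have "AE t in lborel. indicator Z (\<xi> + t *\<^sub>R v) * indicator {0..1::real} t = (0::ennreal)"
        by eventually_elim auto
      then show ?thesis by (subst nn_integral_0_iff_AE) auto
    qed
    then show ?thesis by simp
  qed
  also have "(\<integral>\<^sup>+\<xi>. \<integral>\<^sup>+t. indicator Z (\<xi> + t *\<^sub>R v) * indicator {0..1::real} t \<partial>lborel \<partial>lborel)
     = (\<integral>\<^sup>+t. \<integral>\<^sup>+\<xi>. indicator Z (\<xi> + t *\<^sub>R v) * indicator {0..1::real} t \<partial>lborel \<partial>lborel)"
    by (rule lborel_pair.Fubini') measurable
  also have "\<dots> = (\<integral>\<^sup>+t. emeasure lborel Z * indicator {0..1::real} t \<partial>lborel)"
  proof (rule nn_integral_cong)
    fix t :: real
    have "(\<integral>\<^sup>+\<xi>. indicator Z (\<xi> + t *\<^sub>R v) * indicator {0..1::real} t \<partial>lborel)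
      = (\<integral>\<^sup>+\<xi>. indicator Z (t *\<^sub>R v + \<xi>) \<partial>lborel) * indicator {0..1} t"
      by (subst nn_integral_multc) (auto simp: add.commute)
    also have "(\<integral>\<^sup>+\<xi>. indicator Z (t *\<^sub>R v + \<xi>) \<partial>lborel) = (\<integral>\<^sup>+\<xi>. indicator Z \<xi> \<partial>distr lborel borel ((+) (t *\<^sub>R v)))"
      by (subst nn_integral_distr) auto
    finally show "(\<integral>\<^sup>+\<xi>. indicator Z (\<xi> + t *\<^sub>R v) * indicator {0..1::real} t \<partial>lborel)
      = emeasure lborel Z * indicator {0..1} t" by (simp add: lborel_distr_plus)
  qed
  also have "\<dots> = emeasure lborel Z"
    by (simp add: nn_integral_cmult)
  finally show ?thesis by (auto simp: null_sets_def)
qed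

text \<open>On every line in a generic direction the sum is an exponential sum in the line
  parameter; its coefficients are \<open>h k\<close> times the value of the character at the base
  point, hence still nonzero, and the zeros on the line are countable.\<close>

lemma trig_sum_nonzero_AE:
  fixes K :: "(int^'n) set"
  assumes K: "finite K" "K \<noteq> {}" and h: "\<And>k. k \<in> K \<Longrightarrow> h k \<noteq> 0"
  shows "AE \<xi> in lborel. (\<Sum>k\<in>K. h k * trig_char k \<xi>) \<noteq> 0"
proof -
  obtain v where v: "inj_on (\<lambda>k. int_vec k \<bullet> v) K" using generic_direction[OF K(1)] .
  let ?Z = "{\<xi>. (\<Sum>k\<in>K. h k * trig_char k \<xi>) = 0}"
  have "closed ?Z"
    by (intro closed_Collect_eq continuous_intros continuous_trig_char)
  moreover have "countable {t::real. \<xi> + t *\<^sub>R v \<in> ?Z}" for \<xi>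
    using exponential_sum_countable_zeros[OF K v, of "\<lambda>k. h k * trig_char k \<xi>"] h
    by (simp add: trig_char_shift mult.assoc trig_char_def[of _ "_ *\<^sub>R v"]) (simp add: trig_char_def)
  ultimately have "?Z \<in> null_sets lborel"
    by (intro null_set_by_lines) auto
  then have "AE \<xi> in lborel. \<xi> \<notin> ?Z" by (rule AE_not_in)
  then show ?thesis by simp
qed

text \<open>The terms with nonzero coefficient, if there were any, would have a sum that is nonzero
  almost everywhere. This is the linear independence of the characters.\<close>

lemma trig_sum_coeffs_zero:
  fixes K :: "(int^'n) set"
  assumes "finite K" "\<And>\<xi>. (\<Sum>k\<in>K. h k * trig_char k \<xi>) = 0" "k \<in> K"
  shows "h k = 0"
proof (rule ccontr)
  assume "h k \<noteq> 0"
  let ?K = "{k\<in>K. h k \<noteq> 0}"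
  have "AE \<xi> in (lborel :: (real^'n) measure). (\<Sum>k\<in>?K. h k * trig_char k \<xi>) \<noteq> 0"
    using assms \<open>h k \<noteq> 0\<close> by (intro trig_sum_nonzero_AE) auto
  moreover have "(\<Sum>k\<in>?K. h k * trig_char k \<xi>) = (\<Sum>k\<in>K. h k * trig_char k \<xi>)" for \<xi>
    using assms(1) by (intro sum.mono_neutral_left) auto
  ultimately have "AE \<xi> in (lborel :: (real^'n) measure). False" using assms(2) by simp
  then show False by (rule AE_lborel_witness)
qed

text \<open>\<open>A\<close> is only an upper bound for the frequencies of some representation.
  Closure under sums and products is therefore immediate, whatever cancels.\<close>

definition tp_on :: "(int^'n) set \<Rightarrow> (real^'n \<Rightarrow> complex) \<Rightarrow> bool" where
  "tp_on A p \<longleftrightarrow> (\<exists>K h. finite K \<and> K \<subseteq> A \<and> p = (\<lambda>\<xi>. \<Sum>k\<in>K. h k * trig_char k \<xi>))"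

lemma trig_poly_iff_tp_on: "trig_poly p \<longleftrightarrow> tp_on UNIV p"
  by (simp add: trig_poly_def tp_on_def trig_char_def int_vec_def)

lemma tp_on_mono: "tp_on A p \<Longrightarrow> A \<subseteq> B \<Longrightarrow> tp_on B p"
  unfolding tp_on_def by blast

lemma tp_on_sum_char:
  assumes "finite K" "K \<subseteq> A"
  shows "tp_on A (\<lambda>\<xi>. \<Sum>k\<in>K. h k * trig_char k \<xi>)"
  using assms unfolding tp_on_def by blast

lemma tp_on_char: "k \<in> A \<Longrightarrow> tp_on A (\<lambda>\<xi>. c * trig_char k \<xi>)"
  using tp_on_sum_char[of "{k}" A "\<lambda>_. c"] by simp

lemma tp_on_0 [simp]: "tp_on A (\<lambda>\<xi>. 0)"
  using tp_on_sum_char[of "{}" A] by simp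

lemma tp_on_add:
  assumes "tp_on A p" "tp_on A q"
  shows "tp_on A (\<lambda>\<xi>. p \<xi> + q \<xi>)"
proof -
  obtain K h where K: "finite K" "K \<subseteq> A" "p = (\<lambda>\<xi>. \<Sum>k\<in>K. h k * trig_char k \<xi>)"
    using assms(1) unfolding tp_on_def by blast
  obtain L g where L: "finite L" "L \<subseteq> A" "q = (\<lambda>\<xi>. \<Sum>k\<in>L. g k * trig_char k \<xi>)"
    using assms(2) unfolding tp_on_def by blast
  have p: "p \<xi> = (\<Sum>k\<in>K \<union> L. (if k \<in> K then h k else 0) * trig_char k \<xi>)" for \<xi>
    unfolding K(3) using K(1) L(1) by (intro sum.mono_neutral_cong_left) auto
  have q: "q \<xi> = (\<Sum>k\<in>K \<union> L. (if k \<in> L then g k else 0) * trig_char k \<xi>)" for \<xi>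
    unfolding L(3) using K(1) L(1) by (intro sum.mono_neutral_cong_left) auto
  show ?thesis
    unfolding p q sum.distrib[symmetric] distrib_right[symmetric]
    by (rule tp_on_sum_char) (use K L in auto)
qed

lemma tp_on_sum:
  assumes "\<And>i. i \<in> I \<Longrightarrow> tp_on A (p i)"
  shows "tp_on A (\<lambda>\<xi>. \<Sum>i\<in>I. p i \<xi>)"
  using assms by (induction I rule: infinite_finite_induct) (auto intro: tp_on_add)

lemma tp_on_mult:
  assumes "tp_on A p" "tp_on B q" and AB: "\<And>k l. k \<in> A \<Longrightarrow> l \<in> B \<Longrightarrow> k + l \<in> C"
  shows "tp_on C (\<lambda>\<xi>. p \<xi> * q \<xi>)"
proof -
  obtain K h where K: "finite K" "K \<subseteq> A" "p = (\<lambda>\<xi>. \<Sum>k\<in>K. h k * trig_char k \<xi>)"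
    using assms(1) unfolding tp_on_def by blast
  obtain L g where L: "finite L" "L \<subseteq> B" "q = (\<lambda>\<xi>. \<Sum>k\<in>L. g k * trig_char k \<xi>)"
    using assms(2) unfolding tp_on_def by blast
  have "p \<xi> * q \<xi> = (\<Sum>k\<in>K. \<Sum>l\<in>L. (h k * g l) * trig_char (k + l) \<xi>)" for \<xi>
    unfolding K(3) L(3) sum_product by (simp add: trig_char_add mult_ac)
  moreover have "tp_on C (\<lambda>\<xi>. \<Sum>k\<in>K. \<Sum>l\<in>L. (h k * g l) * trig_char (k + l) \<xi>)"
    using K(2) L(2) by (intro tp_on_sum tp_on_char AB) blast+
  ultimately show ?thesis by simp
qed

lemma tp_on_uminus: "tp_on A p \<Longrightarrow> tp_on A (\<lambda>\<xi>. - p \<xi>)"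
  using tp_on_mult[OF tp_on_char[of 0 "{0}" "-1"], of A p A] by simp

lemma tp_on_diff: "tp_on A p \<Longrightarrow> tp_on A q \<Longrightarrow> tp_on A (\<lambda>\<xi>. p \<xi> - q \<xi>)"
  using tp_on_add[OF _ tp_on_uminus, of A p q] by simp

section \<open>Closure properties and periodicity of trigonometric polynomials\<close>

lemma trig_poly_char: "trig_poly (\<lambda>\<xi>. c * trig_char k \<xi>)"
  by (simp add: trig_poly_iff_tp_on tp_on_char)

lemma trig_poly_const: "trig_poly (\<lambda>\<xi>. c)"
  using trig_poly_char[of c 0] by simp

lemma trig_poly_sum: "(\<And>i. i \<in> I \<Longrightarrow> trig_poly (p i)) \<Longrightarrow> trig_poly (\<lambda>\<xi>. \<Sum>i\<in>I. p i \<xi>)"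
  unfolding trig_poly_iff_tp_on by (rule tp_on_sum)

lemma trig_poly_add: "trig_poly p \<Longrightarrow> trig_poly q \<Longrightarrow> trig_poly (\<lambda>\<xi>. p \<xi> + q \<xi>)"
  unfolding trig_poly_iff_tp_on by (rule tp_on_add)

lemma trig_poly_diff: "trig_poly p \<Longrightarrow> trig_poly q \<Longrightarrow> trig_poly (\<lambda>\<xi>. p \<xi> - q \<xi>)"
  unfolding trig_poly_iff_tp_on by (rule tp_on_diff)

lemma trig_poly_mult: "trig_poly p \<Longrightarrow> trig_poly q \<Longrightarrow> trig_poly (\<lambda>\<xi>. p \<xi> * q \<xi>)"
  unfolding trig_poly_iff_tp_on by (rule tp_on_mult) auto

lemma trig_poly_obtain:
  assumes "trig_poly p"
  obtains K h where "finite K" "p = (\<lambda>\<xi>. \<Sum>k\<in>K. h k * trig_char k \<xi>)"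
  using assms unfolding trig_poly_iff_tp_on tp_on_def by blast

lemma trig_poly_shift:
  assumes "trig_poly p" shows "trig_poly (\<lambda>\<xi>. p (\<xi> + \<eta>))"
proof -
  obtain K h where K: "finite K" "p = (\<lambda>\<xi>. \<Sum>k\<in>K. h k * trig_char k \<xi>)" using trig_poly_obtain[OF assms] .
  have "(\<lambda>\<xi>. p (\<xi> + \<eta>)) = (\<lambda>\<xi>. \<Sum>k\<in>K. (h k * trig_char k \<eta>) * trig_char k \<xi>)"
    by (simp add: K trig_char_shift mult_ac)
  then show ?thesis by (auto intro!: trig_poly_sum trig_poly_char)
qed

lemma trig_poly_scale:
  assumes "trig_poly p" shows "trig_poly (\<lambda>\<xi>. p (real m *\<^sub>R \<xi>))"
proof -
  obtain K h where K: "finite K" "p = (\<lambda>\<xi>. \<Sum>k\<in>K. h k * trig_char k \<xi>)" using trig_poly_obtain[OF assms] .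
  have "int_vec (\<chi> i. int m * k $ i) = real m *\<^sub>R int_vec k" for k
    by (simp add: vec_eq_iff)
  then have "trig_char (\<chi> i. int m * k $ i) \<xi> = trig_char k (real m *\<^sub>R \<xi>)" for k and \<xi> :: "real^'n"
    unfolding trig_char_def by (metis inner_scaleR_left inner_scaleR_right)
  then have [simp]: "trig_char k (real m *\<^sub>R \<xi>) = trig_char (\<chi> i. int m * k $ i) \<xi>" for k and \<xi> :: "real^'n"
    by metis
  then show ?thesis unfolding K by (auto intro!: trig_poly_sum trig_poly_char)
qed

text \<open>Conjugation negates the frequencies. It is applied to numerator and denominator of the
  mask, because |\<tau>|^2 becomes a fraction of trigonometric polynomials as \<tau> times its
  conjugate.\<close>

lemma trig_poly_cnj:
  assumes "trig_poly p" shows "trig_poly (\<lambda>\<xi>. cnj (p \<xi>))"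
proof -
  obtain K h where K: "finite K" "p = (\<lambda>\<xi>. \<Sum>k\<in>K. h k * trig_char k \<xi>)" using trig_poly_obtain[OF assms] .
  have [simp]: "cnj (trig_char k \<xi>) = trig_char (- k) \<xi>" for k and \<xi> :: "real^'n"
    by (simp add: trig_char_def int_vec_minus exp_cnj)
  then show ?thesis unfolding K cnj_sum complex_cnj_mult by (auto intro!: trig_poly_sum trig_poly_char)
qed

lemma trig_poly_continuous: "trig_poly p \<Longrightarrow> continuous_on UNIV p"
  by (erule trig_poly_obtain) (auto intro!: continuous_intros continuous_trig_char)

lemma trig_poly_measurable: "trig_poly p \<Longrightarrow> p \<in> borel_measurable borel"
  by (intro borel_measurable_continuous_onI trig_poly_continuous)

lemma trig_char_2pi:
  assumes "\<And>i. \<exists>m::int. z $ i = 2 * pi * of_int m"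
  shows "trig_char k z = 1"
proof -
  obtain m where m: "\<And>i. z $ i = 2 * pi * of_int (m i)" using assms by metis
  have "int_vec k \<bullet> z = 2 * pi * of_int (\<Sum>i\<in>UNIV. k $ i * m i)"
    by (simp add: inner_vec_def m sum_distrib_left mult_ac)
  then have "trig_char k z = exp (of_real (2 * of_int (- (\<Sum>i\<in>UNIV. k $ i * m i)) * pi) * \<i>)"
    by (simp add: trig_char_def mult_ac)
  also have "\<dots> = 1" by (intro exp_integer_2pi Ints_of_int)
  finally show ?thesis .
qed

lemma trig_poly_periodic:
  assumes "trig_poly p" "\<And>i. \<exists>m::int. z $ i = 2 * pi * of_int m"
  shows "p (\<xi> + z) = p \<xi>"
proof -
  obtain K h where K: "finite K" "p = (\<lambda>\<xi>. \<Sum>k\<in>K. h k * trig_char k \<xi>)" using trig_poly_obtain[OF assms(1)] .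
  show ?thesis by (simp add: K trig_char_shift trig_char_2pi[OF assms(2)])
qed

section \<open>Exact supports, absence of zero divisors and extremal frequencies\<close>

lemma trig_poly_exact_support:
  assumes "trig_poly p"
  obtains K h where "finite K" "\<And>k. k \<in> K \<Longrightarrow> h k \<noteq> 0" "p = (\<lambda>\<xi>. \<Sum>k\<in>K. h k * trig_char k \<xi>)"
proof -
  obtain K h where K: "finite K" "p = (\<lambda>\<xi>. \<Sum>k\<in>K. h k * trig_char k \<xi>)" using trig_poly_obtain[OF assms] .
  have "p = (\<lambda>\<xi>. \<Sum>k\<in>{k\<in>K. h k \<noteq> 0}. h k * trig_char k \<xi>)"
    unfolding K(2) using K(1) by (intro ext sum.mono_neutral_right) auto
  then show ?thesis by (rule that[rotated 2]) (use K(1) in auto)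
qed

lemma trig_poly_nonzero_AE:
  assumes "trig_poly p" "p \<xi>\<^sub>0 \<noteq> 0"
  shows "AE \<xi> in lborel. p \<xi> \<noteq> 0"
proof -
  obtain K h where K: "finite K" "\<And>k. k \<in> K \<Longrightarrow> h k \<noteq> 0" "p = (\<lambda>\<xi>. \<Sum>k\<in>K. h k * trig_char k \<xi>)"
    by (rule trig_poly_exact_support[OF assms(1)]) blast
  moreover have "K \<noteq> {}" using K(3) assms(2) by auto
  ultimately show ?thesis using trig_sum_nonzero_AE[of K h] by simp
qed

text \<open>Two null zero sets cannot cover the space, so the ring is an integral domain.\<close>

lemma trig_poly_mult_nonzero:
  fixes p q :: "real^'n \<Rightarrow> complex"
  assumes "trig_poly p" "trig_poly q" "p \<noteq> (\<lambda>_. 0)" "q \<noteq> (\<lambda>_. 0)"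
  shows "(\<lambda>\<xi>. p \<xi> * q \<xi>) \<noteq> (\<lambda>_. 0)"
proof
  assume eq: "(\<lambda>\<xi>. p \<xi> * q \<xi>) = (\<lambda>_. 0)"
  obtain a b where "p a \<noteq> 0" "q b \<noteq> 0" using assms by (auto simp: fun_eq_iff)
  with assms have "AE \<xi> in lborel. p \<xi> \<noteq> 0" "AE \<xi> in lborel. q \<xi> \<noteq> 0"
    using trig_poly_nonzero_AE by blast+
  then have "AE \<xi> in lborel. p \<xi> * q \<xi> \<noteq> 0" by eventually_elim simp
  then show False using eq by (elim AE_lborel_witness) (simp add: fun_eq_iff)
qed

lemma trig_poly_eqI_mult:
  assumes "trig_poly e" "e \<noteq> (\<lambda>_. 0)" "trig_poly p" "trig_poly q"
    "\<And>\<xi>. e \<xi> * p \<xi> = e \<xi> * q \<xi>"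
  shows "p = q"
proof (rule ccontr)
  assume "p \<noteq> q"
  then have "(\<lambda>\<xi>. p \<xi> - q \<xi>) \<noteq> (\<lambda>_. 0)" by (auto simp: fun_eq_iff)
  from trig_poly_mult_nonzero[OF assms(1) trig_poly_diff[OF assms(3,4)] assms(2) this]
  show False by (simp add: right_diff_distrib assms(5))
qed

text \<open>The choice is harmless for a trigonometric polynomial: linear independence of the
  characters leaves one such set. On other functions the value is unspecified.\<close>

definition tp_supp :: "(real^'n \<Rightarrow> complex) \<Rightarrow> (int^'n) set" where
  "tp_supp p = (SOME K. finite K \<and> (\<exists>h. (\<forall>k\<in>K. h k \<noteq> 0) \<and> p = (\<lambda>\<xi>. \<Sum>k\<in>K. h k * trig_char k \<xi>)))"

lemma tp_supp_obtain:
  assumes "trig_poly p"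
  obtains h where "finite (tp_supp p)" "\<And>k. k \<in> tp_supp p \<Longrightarrow> h k \<noteq> 0"
    "p = (\<lambda>\<xi>. \<Sum>k\<in>tp_supp p. h k * trig_char k \<xi>)"
proof -
  have "\<exists>K. finite K \<and> (\<exists>h. (\<forall>k\<in>K. h k \<noteq> 0) \<and> p = (\<lambda>\<xi>. \<Sum>k\<in>K. h k * trig_char k \<xi>))"
    by (rule trig_poly_exact_support[OF assms]) blast
  from someI_ex[OF this] show ?thesis unfolding tp_supp_def[symmetric] using that by blast
qed

text \<open>Two representations are compared on the union of their frequency sets. Their
  coefficients agree there, so a frequency with nonzero coefficient in one cannot be absent from the
  other.\<close>

lemma tp_supp_subset:
  assumes "tp_on A p" shows "tp_supp p \<subseteq> A"
proof
  fix k assume k: "k \<in> tp_supp p"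
  obtain K h where K: "finite K" "K \<subseteq> A" "p = (\<lambda>\<xi>. \<Sum>k\<in>K. h k * trig_char k \<xi>)"
    using assms unfolding tp_on_def by blast
  have "trig_poly p" using assms unfolding trig_poly_iff_tp_on by (rule tp_on_mono) simp
  then obtain g where g: "finite (tp_supp p)" "\<And>k. k \<in> tp_supp p \<Longrightarrow> g k \<noteq> 0"
    "p = (\<lambda>\<xi>. \<Sum>k\<in>tp_supp p. g k * trig_char k \<xi>)" by (rule tp_supp_obtain) blast
  let ?U = "K \<union> tp_supp p"
  have 1: "p \<xi> = (\<Sum>k\<in>?U. (if k \<in> K then h k else 0) * trig_char k \<xi>)" for \<xi>
    by (subst K(3)) (use K(1) g(1) in \<open>auto intro!: sum.mono_neutral_cong_left\<close>)
  have 2: "p \<xi> = (\<Sum>k\<in>?U. (if k \<in> tp_supp p then g k else 0) * trig_char k \<xi>)" for \<xi>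
    by (subst g(3)) (use K(1) g(1) in \<open>auto intro!: sum.mono_neutral_cong_left\<close>)
  have "(\<Sum>k\<in>?U. ((if k \<in> K then h k else 0) - (if k \<in> tp_supp p then g k else 0)) * trig_char k \<xi>) = 0" for \<xi>
    unfolding left_diff_distrib sum_subtractf 1[symmetric] 2[symmetric] by simp
  from trig_sum_coeffs_zero[OF _ this, of k] K(1) g(1) k
  have "(if k \<in> K then h k else 0) = g k" by simp
  then have "k \<in> K" using g(2)[OF k] by (auto split: if_splits)
  then show "k \<in> A" using K(2) by blast
qed

lemma tp_on_supp: "trig_poly p \<Longrightarrow> tp_on (tp_supp p) p"
  unfolding tp_on_def by (erule tp_supp_obtain) blast

lemma finite_tp_supp: "trig_poly p \<Longrightarrow> finite (tp_supp p)"
  by (erule tp_supp_obtain)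

lemma tp_supp_empty:
  assumes "trig_poly p" "tp_supp p = {}" shows "p = (\<lambda>_. 0)"
proof -
  obtain h where "p = (\<lambda>\<xi>. \<Sum>k\<in>tp_supp p. h k * trig_char k \<xi>)"
    using assms(1) by (rule tp_supp_obtain)
  then show ?thesis unfolding assms(2) by simp
qed

lemma tp_supp_witness:
  assumes "trig_poly p" "p \<noteq> (\<lambda>_. 0)"
  obtains k where "k \<in> tp_supp p"
proof -
  have "tp_supp p \<noteq> {}" using tp_supp_empty[OF assms(1)] assms(2) by auto
  then show ?thesis using that by auto
qed

lemma tp_on_disjoint:
  assumes "tp_on A p" "tp_on B p" "A \<inter> B = {}" shows "p = (\<lambda>_. 0)"
proof -
  have "tp_supp p = {}" using assms tp_supp_subset by blast
  moreover have "trig_poly p" using assms(1) unfolding trig_poly_iff_tp_on by (rule tp_on_mono) simp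
  ultimately show ?thesis by (intro tp_supp_empty)
qed

text \<open>The leading form \<open>t\<close> for the weight \<open>L\<close>, together with the
  terms of smaller weight. It cannot vanish, since it keeps nonzero coefficients at distinct
  frequencies.\<close>

lemma tp_top_part:
  fixes L :: "int^'n \<Rightarrow> int"
  assumes p: "trig_poly p" "p \<noteq> (\<lambda>_. 0)"
  defines "a \<equiv> Max (L ` tp_supp p)"
  obtains t l where "p = (\<lambda>\<xi>. t \<xi> + l \<xi>)" "t \<noteq> (\<lambda>_. 0)" "tp_on {k. L k = a} t" "tp_on {k. L k < a} l"
proof -
  obtain h where h: "finite (tp_supp p)" "\<And>k. k \<in> tp_supp p \<Longrightarrow> h k \<noteq> 0"
    "p = (\<lambda>\<xi>. \<Sum>k\<in>tp_supp p. h k * trig_char k \<xi>)" using p(1) by (rule tp_supp_obtain) blast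
  define T where "T = {k\<in>tp_supp p. L k = a}"
  define t where "t = (\<lambda>\<xi>. \<Sum>k\<in>T. h k * trig_char k \<xi>)"
  define l where "l = (\<lambda>\<xi>. \<Sum>k\<in>tp_supp p - T. h k * trig_char k \<xi>)"
  have T: "finite T" "T \<subseteq> tp_supp p" using h(1) by (auto simp: T_def)
  have "tp_supp p \<noteq> {}" using tp_supp_empty p by blast
  then have "a \<in> L ` tp_supp p" unfolding a_def using h(1) by (intro Max_in) auto
  then obtain k where k: "k \<in> T" unfolding T_def by auto
  have "p = (\<lambda>\<xi>. t \<xi> + l \<xi>)"
    by (subst h(3)) (simp add: t_def l_def sum.subset_diff[OF T(2) h(1)] add.commute)
  moreover have "t \<noteq> (\<lambda>_. 0)"
  proof
    assume "t = (\<lambda>_. 0)"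
    then have "h k = 0" using trig_sum_coeffs_zero[OF T(1) _ k, of h] by (simp add: t_def fun_eq_iff)
    then show False using h(2) k T(2) by blast
  qed
  moreover have "tp_on {k. L k = a} t"
    unfolding t_def by (intro tp_on_sum_char T(1)) (auto simp: T_def)
  moreover have "tp_on {k. L k < a} l"
    unfolding l_def
  proof (intro tp_on_sum_char)
    have "L k \<le> a" if "k \<in> tp_supp p" for k
      unfolding a_def using that h(1) by simp
    then show "tp_supp p - T \<subseteq> {k. L k < a}" by (auto simp: T_def order_less_le)
  qed (use h(1) in simp)
  ultimately show ?thesis by (rule that)
qed

lemma tp_supp_le_Max:
  fixes L :: "int^'n \<Rightarrow> int"
  assumes "trig_poly p" shows "tp_on {k. L k \<le> Max (L ` tp_supp p)} p"
proof (rule tp_on_mono[OF tp_on_supp[OF assms]], intro subsetI CollectI)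
  fix k assume "k \<in> tp_supp p"
  then show "L k \<le> Max (L ` tp_supp p)" by (intro Max_ge finite_imageI finite_tp_supp assms imageI)
qed

text \<open>The product of the top parts cannot cancel, because the zero set of each of them is null.\<close>

lemma tp_supp_Max_mult:
  fixes L :: "int^'n \<Rightarrow> int"
  assumes L: "\<And>k l. L (k + l) = L k + L l"
    and p: "trig_poly p" "p \<noteq> (\<lambda>_. 0)" and q: "trig_poly q" "q \<noteq> (\<lambda>_. 0)"
  shows "Max (L ` tp_supp p) + Max (L ` tp_supp q) \<le> Max (L ` tp_supp (\<lambda>\<xi>. p \<xi> * q \<xi>))"
    (is "?a + ?b \<le> ?c")
proof (rule ccontr)
  assume less: "\<not> ?a + ?b \<le> ?c"
  obtain t l where t: "p = (\<lambda>\<xi>. t \<xi> + l \<xi>)" "t \<noteq> (\<lambda>_. 0)" "tp_on {k. L k = ?a} t" "tp_on {k. L k < ?a} l"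
    by (rule tp_top_part[OF p, of L])
  obtain u m where u: "q = (\<lambda>\<xi>. u \<xi> + m \<xi>)" "u \<noteq> (\<lambda>_. 0)" "tp_on {k. L k = ?b} u" "tp_on {k. L k < ?b} m"
    by (rule tp_top_part[OF q, of L])
  define a b where ab: "a = ?a" "b = ?b"
  note t = t[folded ab] and u = u[folded ab]
  have q_le: "tp_on {k. L k \<le> b} q" unfolding ab by (rule tp_supp_le_Max[OF q(1)])
  let ?A = "{k. L k < a + b}"
  have "tp_on {k. L k \<le> ?c} (\<lambda>\<xi>. p \<xi> * q \<xi>)" by (intro tp_supp_le_Max trig_poly_mult p q)
  then have "tp_on ?A (\<lambda>\<xi>. p \<xi> * q \<xi>)" by (rule tp_on_mono) (use less[folded ab] in auto)
  moreover have "tp_on ?A (\<lambda>\<xi>. t \<xi> * m \<xi>)" by (rule tp_on_mult[OF t(3) u(4)]) (simp add: L)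
  moreover have "tp_on ?A (\<lambda>\<xi>. l \<xi> * q \<xi>)" by (rule tp_on_mult[OF t(4) q_le]) (simp add: L)
  ultimately have "tp_on ?A (\<lambda>\<xi>. p \<xi> * q \<xi> - t \<xi> * m \<xi> - l \<xi> * q \<xi>)" by (intro tp_on_diff)
  moreover have "p \<xi> * q \<xi> - t \<xi> * m \<xi> - l \<xi> * q \<xi> = t \<xi> * u \<xi>" for \<xi>
    by (subst t(1), subst (1 2) u(1)) (simp add: algebra_simps)
  ultimately have "tp_on ?A (\<lambda>\<xi>. t \<xi> * u \<xi>)" by simp
  moreover have "tp_on {k. L k = a + b} (\<lambda>\<xi>. t \<xi> * u \<xi>)" by (rule tp_on_mult[OF t(3) u(3)]) (simp add: L)
  ultimately have "(\<lambda>\<xi>. t \<xi> * u \<xi>) = (\<lambda>_. 0)" by (rule tp_on_disjoint) auto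
  moreover have "trig_poly t" "trig_poly u"
    using t(3) u(3) unfolding trig_poly_iff_tp_on by (auto elim: tp_on_mono)
  ultimately show False using trig_poly_mult_nonzero t(2) u(2) by blast
qed

section \<open>Reduction of fractions\<close>

text \<open>Summed side lengths of the bounding box of the support. The minimum of a coordinate is
  written as minus the maximum of its negative, so that \<open>tp_supp_Max_mult\<close> serves for
  both ends. Being invariant under translation of the support, the width does not change under
  multiplication by a unit.\<close>

definition tp_width :: "(real^'n \<Rightarrow> complex) \<Rightarrow> nat" where
  "tp_width p = (\<Sum>i\<in>UNIV. nat (Max ((\<lambda>k. k $ i) ` tp_supp p) + Max ((\<lambda>k. - (k $ i)) ` tp_supp p)))"

lemma coord_le_Max:
  assumes p: "trig_poly p" and k: "k \<in> tp_supp p" and l: "l \<in> tp_supp p"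
  shows "k $ i - l $ i \<le> Max ((\<lambda>k. k $ i) ` tp_supp p) + Max ((\<lambda>k. - (k $ i)) ` tp_supp p)"
proof -
  have "k $ i \<le> Max ((\<lambda>k. k $ i) ` tp_supp p)"
    by (rule Max_ge[OF finite_imageI[OF finite_tp_supp[OF p]]]) (rule imageI[OF k])
  moreover have "- (l $ i) \<le> Max ((\<lambda>k. - (k $ i)) ` tp_supp p)"
    by (rule Max_ge[OF finite_imageI[OF finite_tp_supp[OF p]]]) (rule imageI[OF l])
  ultimately show ?thesis by linarith
qed

lemma tp_width_mult:
  fixes p q :: "real^'n \<Rightarrow> complex"
  assumes p: "trig_poly p" "p \<noteq> (\<lambda>_. 0)" and q: "trig_poly q" "q \<noteq> (\<lambda>_. 0)"
  shows "tp_width p + tp_width q \<le> tp_width (\<lambda>\<xi>. p \<xi> * q \<xi>)"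
proof -
  define u where "u i r = Max ((\<lambda>k. k $ i) ` tp_supp r)" for i and r :: "real^'n \<Rightarrow> complex"
  define v where "v i r = Max ((\<lambda>k. - (k $ i)) ` tp_supp r)" for i and r :: "real^'n \<Rightarrow> complex"
  \<comment> \<open>\<open>nat\<close> cuts off at 0, so it distributes over the sum only once the
    side lengths are known to be nonnegative.\<close>
  have nn: "0 \<le> u i r + v i r"
    if r: "trig_poly r" "r \<noteq> (\<lambda>_. 0)" for r :: "real^'n \<Rightarrow> complex" and i
  proof -
    obtain k where "k \<in> tp_supp r" by (rule tp_supp_witness[OF r])
    from coord_le_Max[OF r(1) this this, of i] show ?thesis by (simp only: u_def v_def diff_self)
  qed
  have "u i p + u i q \<le> u i (\<lambda>\<xi>. p \<xi> * q \<xi>)" "v i p + v i q \<le> v i (\<lambda>\<xi>. p \<xi> * q \<xi>)" for i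
    unfolding u_def v_def by (intro tp_supp_Max_mult p q; simp)+
  then have "nat (u i p + v i p) + nat (u i q + v i q) \<le> nat (u i (\<lambda>\<xi>. p \<xi> * q \<xi>) + v i (\<lambda>\<xi>. p \<xi> * q \<xi>))" for i
    using nn[OF p, of i] nn[OF q, of i] by (smt (verit) nat_add_distrib nat_mono)
  then show ?thesis
    unfolding tp_width_def sum.distrib[symmetric] u_def[symmetric] v_def[symmetric]
    by (intro sum_mono)
qed

text \<open>A bounding box with all sides of length 0 is a single lattice point.\<close>

lemma tp_width_0_monomial:
  assumes "trig_poly p" "p \<noteq> (\<lambda>_. 0)" "tp_width p = 0"
  obtains c k where "c \<noteq> 0" "p = (\<lambda>\<xi>. c * trig_char k \<xi>)"
proof -
  obtain h where h: "finite (tp_supp p)" "\<And>k. k \<in> tp_supp p \<Longrightarrow> h k \<noteq> 0"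
    "p = (\<lambda>\<xi>. \<Sum>k\<in>tp_supp p. h k * trig_char k \<xi>)" using assms(1) by (rule tp_supp_obtain) blast
  obtain k where k: "k \<in> tp_supp p" by (rule tp_supp_witness[OF assms(1,2)])
  have le: "a $ i \<le> b $ i" if "a \<in> tp_supp p" "b \<in> tp_supp p" for a b i
  proof -
    have "nat (Max ((\<lambda>k. k $ i) ` tp_supp p) + Max ((\<lambda>k. - (k $ i)) ` tp_supp p)) = 0"
      using assms(3) unfolding tp_width_def by (subst (asm) sum_eq_0_iff) simp_all
    then show ?thesis using coord_le_Max[OF assms(1) that, of i] by linarith
  qed
  have "l = k" if "l \<in> tp_supp p" for l
    using le[OF that k] le[OF k that] by (simp add: vec_eq_iff order_antisym)
  then have "tp_supp p = {k}" using k by blast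
  then have "p = (\<lambda>\<xi>. h k * trig_char k \<xi>)" by (subst h(3)) simp
  then show ?thesis by (rule that[OF h(2)[OF k]])
qed

text \<open>Minimality is taken over all pairs that represent the fraction P/Q. Cancelling a common
  divisor \<open>e\<close> of numerator and denominator gives another such pair, whose denominator
  is narrower by at least the width of \<open>e\<close>. So that width is 0, and \<open>e\<close> is
  an invertible monomial, which divides 1.\<close>

lemma reduced_fraction_exists:
  assumes P: "trig_poly P" and Q: "trig_poly Q" "Q \<noteq> (\<lambda>_. 0)"
  obtains p q where "trig_poly p" "trig_poly q" "q \<noteq> (\<lambda>_. 0)" "tp_is_gcd (\<lambda>_. 1) p q"
    "\<And>\<xi>. P \<xi> * q \<xi> = Q \<xi> * p \<xi>"
proof -
  define R where "R x \<longleftrightarrow> trig_poly (fst x) \<and> trig_poly (snd x) \<and> snd x \<noteq> (\<lambda>_. 0) \<and>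
    (\<forall>\<xi>. P \<xi> * snd x \<xi> = Q \<xi> * fst x \<xi>)" for x
  have "R (P, Q)" using P Q by (simp add: R_def)
  then obtain x where x: "R x" and min: "\<And>y. R y \<Longrightarrow> tp_width (snd x) \<le> tp_width (snd y)"
    using ex_has_least_nat[of R "(P, Q)" "\<lambda>x. tp_width (snd x)"] by blast
  obtain p q where pq: "x = (p, q)" by (cases x)
  have *: "trig_poly p" "trig_poly q" "q \<noteq> (\<lambda>_. 0)" "\<And>\<xi>. P \<xi> * q \<xi> = Q \<xi> * p \<xi>"
    using x by (simp_all add: R_def pq)
  have "tp_dvd e (\<lambda>_. 1)" if "tp_dvd e p" "tp_dvd e q" for e
  proof -
    obtain r where e: "trig_poly e" and r: "trig_poly r" "p = (\<lambda>\<xi>. e \<xi> * r \<xi>)"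
      using \<open>tp_dvd e p\<close> by (auto simp: tp_dvd_def)
    obtain s where s: "trig_poly s" "q = (\<lambda>\<xi>. e \<xi> * s \<xi>)"
      using \<open>tp_dvd e q\<close> by (auto simp: tp_dvd_def)
    have e0: "e \<noteq> (\<lambda>_. 0)" and s0: "s \<noteq> (\<lambda>_. 0)" using *(3) s(2) by auto
    have "(\<lambda>\<xi>. P \<xi> * s \<xi>) = (\<lambda>\<xi>. Q \<xi> * r \<xi>)"
      using *(4) by (intro trig_poly_eqI_mult[OF e e0] trig_poly_mult P Q r s) (simp add: r(2) s(2) mult_ac)
    then have "R (r, s)" using r(1) s(1) s0 by (auto simp: R_def dest: fun_cong)
    from min[OF this] have "tp_width q \<le> tp_width s" by (simp add: pq)
    with tp_width_mult[OF e e0 s(1) s0] have "tp_width e = 0" unfolding s(2) by simp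
    then obtain c k where c: "c \<noteq> 0" "e = (\<lambda>\<xi>. c * trig_char k \<xi>)"
      by (rule tp_width_0_monomial[OF e e0])
    have "(\<lambda>_. 1) = (\<lambda>\<xi>. e \<xi> * (1 / c * trig_char (- k) \<xi>))"
      using c(1) by (simp add: c(2) trig_char_add[symmetric])
    then show ?thesis unfolding tp_dvd_def using e trig_poly_char by blast
  qed
  moreover have "tp_dvd (\<lambda>_. 1) p" "tp_dvd (\<lambda>_. 1) q"
    unfolding tp_dvd_def using *(1,2) trig_poly_const by auto
  ultimately have "tp_is_gcd (\<lambda>_. 1) p q" by (simp add: tp_is_gcd_def)
  with * show ?thesis using that by blast
qed

section \<open>Gaussians\<close>

lemma nn_integral_lborel_affine:
  fixes f :: "'a::euclidean_space \<Rightarrow> ennreal"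
  assumes [measurable]: "f \<in> borel_measurable borel" and "c \<noteq> 0"
  shows "(\<integral>\<^sup>+x. f x \<partial>lborel) = ennreal (\<bar>c\<bar> ^ DIM('a)) * (\<integral>\<^sup>+x. f (t + c *\<^sub>R x) \<partial>lborel)"
  by (subst lborel_affine[OF \<open>c \<noteq> 0\<close>, of t])
     (simp add: nn_integral_density nn_integral_distr nn_integral_cmult)

lemma lborel_integral_affine:
  fixes f :: "'a::euclidean_space \<Rightarrow> 'b::{banach, second_countable_topology}"
  assumes [measurable]: "f \<in> borel_measurable borel" and "c \<noteq> 0"
  shows "(\<integral>x. f x \<partial>lborel) = \<bar>c\<bar> ^ DIM('a) *\<^sub>R (\<integral>x. f (t + c *\<^sub>R x) \<partial>lborel)"
  by (subst lborel_affine[OF \<open>c \<noteq> 0\<close>, of t])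
     (simp add: integral_density integral_distr)

lemma integrable_lborel_affine:
  fixes f :: "'a::euclidean_space \<Rightarrow> 'b::{banach, second_countable_topology}"
  assumes f: "integrable lborel f" and c: "c \<noteq> 0"
  shows "integrable lborel (\<lambda>x. f (t + c *\<^sub>R x))"
proof -
  have [measurable]: "f \<in> borel_measurable borel" using f by auto
  have "(\<integral>\<^sup>+x. ennreal (norm (f x)) \<partial>lborel)
      = ennreal (\<bar>c\<bar> ^ DIM('a)) * (\<integral>\<^sup>+x. ennreal (norm (f (t + c *\<^sub>R x))) \<partial>lborel)"
    by (rule nn_integral_lborel_affine[OF _ c]) measurable
  moreover have "(\<integral>\<^sup>+x. ennreal (norm (f x)) \<partial>lborel) < \<infinity>" using f by (simp add: integrable_iff_bounded)
  ultimately have "(\<integral>\<^sup>+x. ennreal (norm (f (t + c *\<^sub>R x))) \<partial>lborel) < \<infinity>"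
    using c by (auto simp: ennreal_mult_less_top)
  then show ?thesis by (intro integrableI_bounded) auto
qed

text \<open>Lebesgue measure is the image of a product of copies of the one-dimensional one, indexed
  by \<open>Basis\<close>. This reduces the Gaussian integrals to dimension one.\<close>

lemma
  fixes f :: "'a::euclidean_space \<Rightarrow> real \<Rightarrow> 'b::{real_normed_field, banach, second_countable_topology}"
  assumes f: "\<And>b. b \<in> Basis \<Longrightarrow> integrable lborel (f b)"
  shows integrable_lborel_prod: "integrable lborel (\<lambda>x. \<Prod>b\<in>Basis. f b (x \<bullet> b))"
    and integral_lborel_prod:
      "(\<integral>x. (\<Prod>b\<in>Basis. f b (x \<bullet> b)) \<partial>lborel) = (\<Prod>b\<in>Basis. \<integral>x. f b x \<partial>lborel)"
proof -
  interpret product_sigma_finite "\<lambda>b::'a. lborel :: real measure" ..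
  let ?T = "\<lambda>x::'a \<Rightarrow> real. \<Sum>b\<in>Basis. x b *\<^sub>R b"
  have [measurable]: "f b \<in> borel_measurable borel" if "b \<in> Basis" for b using f[OF that] by auto
  have F[measurable]: "(\<lambda>x. \<Prod>b\<in>Basis. f b (x \<bullet> b)) \<in> borel_measurable borel"
    by measurable
  have T[measurable]: "?T \<in> (\<Pi>\<^sub>M b\<in>Basis. lborel) \<rightarrow>\<^sub>M borel" by measurable
  have eq: "(\<Prod>b\<in>Basis. f b (?T x \<bullet> b)) = (\<Prod>b\<in>Basis. f b (x b))" for x
    by (intro prod.cong refl) (simp add: inner_sum_left inner_Basis if_distrib cong: if_cong)
  show "integrable lborel (\<lambda>x. \<Prod>b\<in>Basis. f b (x \<bullet> b))"
    unfolding lborel_eq[where 'a='a] using product_integrable_prod[OF finite_Basis f]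
    by (subst integrable_distr_eq[OF T F]) (simp add: eq)
  show "(\<integral>x. (\<Prod>b\<in>Basis. f b (x \<bullet> b)) \<partial>lborel) = (\<Prod>b\<in>Basis. \<integral>x. f b x \<partial>lborel)"
    unfolding lborel_eq[where 'a='a] 
    by (subst integral_distr[OF T F]) (simp add: eq product_integral_prod[OF finite_Basis f])
qed

text \<open>With variance 1 it is an eigenfunction of the Fourier transform in the present
  normalization; the eigenvalue is its total mass \<open>gauss_mass\<close>.\<close>

definition gauss :: "'a::euclidean_space \<Rightarrow> real" where
  "gauss x = exp (- (norm x)\<^sup>2 / 2)"

definition gauss_mass :: "'a::euclidean_space itself \<Rightarrow> real" where
  "gauss_mass _ = sqrt (2 * pi) ^ DIM('a)"

lemma gauss_pos: "0 < gauss x" and gauss_le_1: "gauss x \<le> 1" and gauss_0 [simp]: "gauss 0 = 1"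
  by (simp_all add: gauss_def)

lemma continuous_gauss: "continuous_on UNIV gauss"
  unfolding gauss_def by (intro continuous_intros) auto

lemma gauss_measurable [measurable]: "gauss \<in> borel_measurable borel"
  by (intro borel_measurable_continuous_onI continuous_gauss)

lemma gauss_mass_pos: "0 < gauss_mass TYPE('a::euclidean_space)"
  by (simp add: gauss_mass_def)

lemma gauss_eq_prod: "gauss x = (\<Prod>b\<in>Basis. exp (- (x \<bullet> b)\<^sup>2 / 2))"
proof -
  have "(norm x)\<^sup>2 = (\<Sum>b\<in>Basis. (x \<bullet> b)\<^sup>2)"
    unfolding power2_norm_eq_inner power2_eq_square[of "inner _ _"] by (rule euclidean_inner)
  then have "- (norm x)\<^sup>2 / 2 = (\<Sum>b\<in>Basis. - (x \<bullet> b)\<^sup>2 / 2)"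
    by (simp add: sum_negf sum_divide_distrib)
  then show ?thesis
    unfolding gauss_def by (simp only: exp_sum[OF finite_Basis])
qed

text \<open>Up to the factor sqrt (2 pi) this is the characteristic function of the standard normal
  distribution.\<close>

lemma fourier_gauss_1dim:
  fixes s :: real
  shows "integrable lborel (\<lambda>t::real. complex_of_real (exp (- t\<^sup>2 / 2)) * exp (- \<i> * of_real (t * s)))"
    and "(\<integral>t. complex_of_real (exp (- t\<^sup>2 / 2)) * exp (- \<i> * of_real (t * s)) \<partial>lborel)
       = of_real (sqrt (2 * pi) * exp (- s\<^sup>2 / 2))"
proof -
  have eq: "complex_of_real (exp (- t\<^sup>2 / 2)) * exp (- \<i> * of_real (t * s))
      = of_real (sqrt (2 * pi)) * (std_normal_density t *\<^sub>R iexp (- s * t))" for t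
    by (simp add: std_normal_density_def scaleR_conv_of_real mult_ac del: of_real_exp)
  have "integrable lborel (\<lambda>t. std_normal_density t *\<^sub>R iexp (- s * t))"
    by (rule Bochner_Integration.integrable_bound[OF integrable_normal_density[of 1 0]]) (auto simp: abs_mult)
  then show "integrable lborel (\<lambda>t::real. complex_of_real (exp (- t\<^sup>2 / 2)) * exp (- \<i> * of_real (t * s)))"
    unfolding eq by (rule integrable_mult_right)
  have "(\<integral>t. std_normal_density t *\<^sub>R iexp (- s * t) \<partial>lborel) = char std_normal_distribution (- s)"
    unfolding char_def by (subst integral_density) auto
  also have "\<dots> = of_real (exp (- s\<^sup>2 / 2))"
    by (simp add: char_std_normal_distribution)
  finally show "(\<integral>t. complex_of_real (exp (- t\<^sup>2 / 2)) * exp (- \<i> * of_real (t * s)) \<partial>lborel)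
       = of_real (sqrt (2 * pi) * exp (- s\<^sup>2 / 2))"
    unfolding eq integral_mult_right_zero by simp
qed

lemma
  fixes \<xi> :: "'a::euclidean_space"
  shows integrable_gauss_exp: "integrable lborel (\<lambda>x. of_real (gauss x) * exp (- \<i> * of_real (x \<bullet> \<xi>)))"
    and fourier_gauss: "(\<integral>x. of_real (gauss x) * exp (- \<i> * of_real (x \<bullet> \<xi>)) \<partial>lborel)
       = of_real (gauss_mass TYPE('a) * gauss \<xi>)"
proof -
  have eq: "of_real (gauss x) * exp (- \<i> * of_real (x \<bullet> \<xi>))
     = (\<Prod>b\<in>Basis. of_real (exp (- (x \<bullet> b)\<^sup>2 / 2)) * exp (- \<i> * of_real ((x \<bullet> b) * (\<xi> \<bullet> b))))" for x :: 'a
  proof -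
    have "- \<i> * of_real (x \<bullet> \<xi>) = (\<Sum>b\<in>Basis. - \<i> * of_real ((x \<bullet> b) * (\<xi> \<bullet> b)))"
      unfolding euclidean_inner[of x \<xi>] of_real_sum sum_distrib_left ..
    then show ?thesis by (simp only: gauss_eq_prod prod.distrib exp_sum[OF finite_Basis] of_real_prod)
  qed
  show "integrable lborel (\<lambda>x. of_real (gauss x) * exp (- \<i> * of_real (x \<bullet> \<xi>)))"
    unfolding eq by (intro integrable_lborel_prod fourier_gauss_1dim(1))
  show "(\<integral>x. of_real (gauss x) * exp (- \<i> * of_real (x \<bullet> \<xi>)) \<partial>lborel)
       = of_real (gauss_mass TYPE('a) * gauss \<xi>)"
    unfolding eq integral_lborel_prod[OF fourier_gauss_1dim(1)] fourier_gauss_1dim(2)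
    by (simp only: gauss_eq_prod gauss_mass_def of_real_mult of_real_prod prod.distrib prod_constant of_real_power)
qed

lemma integrable_gauss: "integrable lborel (gauss :: 'a::euclidean_space \<Rightarrow> real)"
  using integrable_norm[OF integrable_gauss_exp[of "0::'a"]]
  by (simp add: abs_of_pos gauss_pos)

lemma integral_gauss: "(\<integral>x. gauss (x :: 'a::euclidean_space) \<partial>lborel) = gauss_mass TYPE('a)"
  using fourier_gauss[of "0::'a"] by (simp only: inner_zero_right of_real_0 mult_zero_right exp_zero
    mult_1_right gauss_0 integral_complex_of_real of_real_eq_iff)

lemma nn_integral_gauss: "(\<integral>\<^sup>+x. ennreal (gauss (x :: 'a::euclidean_space)) \<partial>lborel) = ennreal (gauss_mass TYPE('a))"
  by (subst nn_integral_eq_integral[OF integrable_gauss]) (auto simp: integral_gauss gauss_pos[THEN less_imp_le])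

lemma fourier_gauss_scaled:
  fixes \<zeta> :: "'a::euclidean_space"
  assumes "\<epsilon> > 0"
  shows "(\<integral>x. of_real (gauss (\<epsilon> *\<^sub>R x)) * exp (- \<i> * of_real (x \<bullet> \<zeta>)) \<partial>lborel)
    = of_real (gauss_mass TYPE('a) * gauss (\<zeta> /\<^sub>R \<epsilon>) / \<epsilon> ^ DIM('a))"
proof -
  have "of_real (gauss_mass TYPE('a) * gauss (\<zeta> /\<^sub>R \<epsilon>))
      = (\<integral>x. of_real (gauss (x::'a)) * exp (- \<i> * of_real (x \<bullet> (\<zeta> /\<^sub>R \<epsilon>))) \<partial>lborel)"
    by (rule fourier_gauss[symmetric])
  also have "\<dots> = \<epsilon> ^ DIM('a) *\<^sub>R (\<integral>x. of_real (gauss (\<epsilon> *\<^sub>R (x::'a))) * exp (- \<i> * of_real (x \<bullet> \<zeta>)) \<partial>lborel)"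
    using assms by (subst lborel_integral_affine[of _ \<epsilon> 0]) (auto simp flip: mult.assoc)
  finally show ?thesis using assms by (simp add: scaleR_conv_of_real field_simps)
qed

section \<open>Continuity of translations\<close>

lemma ennreal_tendsto_0I:
  fixes f :: "'a \<Rightarrow> ennreal"
  assumes "\<And>e::real. 0 < e \<Longrightarrow> eventually (\<lambda>x. f x \<le> ennreal e) F"
  shows "(f \<longlongrightarrow> 0) F"
proof (rule order_tendstoI)
  fix a :: ennreal assume "0 < a"
  then obtain y where y: "0 < y" "y < a" using dense by blast
  then obtain e where e: "y = ennreal e" "0 \<le> e" by (cases y) auto
  then have "0 < e" using y(1) by (simp add: ennreal_less_zero_iff)
  from assms[OF this] show "eventually (\<lambda>x. f x < a) F"
    by (rule eventually_mono) (use y e in auto)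
qed simp

lemma ennreal_tendsto_0D:
  fixes f :: "'a \<Rightarrow> ennreal"
  assumes "(f \<longlongrightarrow> 0) F" "0 < (e::real)"
  shows "eventually (\<lambda>x. f x \<le> ennreal e) F"
  using order_tendstoD(2)[OF assms(1), of "ennreal e"] assms(2)
  by (auto elim: eventually_mono)

text \<open>Continuity at 0 of the map sending \<open>h\<close> to the translate of \<open>f\<close>
  by \<open>h\<close>, measured in L1. It is put in terms of sequences because it is fed into
  dominated convergence.\<close>

definition L1_shift_cont :: "('a::euclidean_space \<Rightarrow> 'b::{banach, second_countable_topology}) \<Rightarrow> bool" where
  "L1_shift_cont f \<longleftrightarrow> (\<forall>h. h \<longlonglongrightarrow> 0 \<longrightarrow>
     (\<lambda>n. \<integral>\<^sup>+x. ennreal (norm (f (x - h n) - f x)) \<partial>lborel) \<longlonglongrightarrow> 0)"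

lemma nn_integral_lborel_shift:
  fixes f :: "'a::euclidean_space \<Rightarrow> ennreal"
  assumes "f \<in> borel_measurable borel"
  shows "(\<integral>\<^sup>+x. f (x - h) \<partial>lborel) = (\<integral>\<^sup>+x. f x \<partial>lborel)"
  using nn_integral_lborel_affine[OF assms, of 1 "- h"] by simp

text \<open>The usual three-term estimate: translation preserves the L1 distance, so replacing
  \<open>f\<close> by \<open>g\<close> costs the same before and after the shift.\<close>

lemma L1_shift_cont_approx:
  fixes f :: "'a::euclidean_space \<Rightarrow> 'b::{banach, second_countable_topology}"
  assumes [measurable]: "f \<in> borel_measurable borel"
    and approx: "\<And>e::real. 0 < e \<Longrightarrow> \<exists>g. g \<in> borel_measurable borel \<and> L1_shift_cont g \<and>
      (\<integral>\<^sup>+x. ennreal (norm (f x - g x)) \<partial>lborel) \<le> ennreal e"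
  shows "L1_shift_cont f"
  unfolding L1_shift_cont_def
proof (intro allI impI ennreal_tendsto_0I)
  fix h :: "nat \<Rightarrow> 'a" and e :: real
  assume h: "h \<longlonglongrightarrow> 0" and e: "0 < e"
  then obtain g where [measurable]: "g \<in> borel_measurable borel" and g: "L1_shift_cont g"
    and fg: "(\<integral>\<^sup>+x. ennreal (norm (f x - g x)) \<partial>lborel) \<le> ennreal (e / 3)"
    using approx[of "e / 3"] by auto
  have "eventually (\<lambda>n. (\<integral>\<^sup>+x. ennreal (norm (g (x - h n) - g x)) \<partial>lborel) \<le> ennreal (e / 3)) sequentially"
    using g h e by (intro ennreal_tendsto_0D) (auto simp: L1_shift_cont_def)
  then show "eventually (\<lambda>n. (\<integral>\<^sup>+x. ennreal (norm (f (x - h n) - f x)) \<partial>lborel) \<le> ennreal e) sequentially"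
  proof (rule eventually_mono)
    fix n assume gn: "(\<integral>\<^sup>+x. ennreal (norm (g (x - h n) - g x)) \<partial>lborel) \<le> ennreal (e / 3)"
    have "(\<integral>\<^sup>+x. ennreal (norm (f (x - h n) - f x)) \<partial>lborel)
       \<le> (\<integral>\<^sup>+x. ennreal (norm (f (x - h n) - g (x - h n))) + ennreal (norm (g (x - h n) - g x)) + ennreal (norm (f x - g x)) \<partial>lborel)"
    proof (rule nn_integral_mono)
      fix x
      have "norm (f (x - h n) - f x) \<le> norm (f (x - h n) - g (x - h n)) + norm (g (x - h n) - g x) + norm (f x - g x)"
        by norm
      then show "ennreal (norm (f (x - h n) - f x)) \<le> ennreal (norm (f (x - h n) - g (x - h n))) + ennreal (norm (g (x - h n) - g x)) + ennreal (norm (f x - g x))"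
        by (simp flip: ennreal_plus)
    qed
    also have "\<dots> = (\<integral>\<^sup>+x. ennreal (norm (f (x - h n) - g (x - h n))) \<partial>lborel)
        + (\<integral>\<^sup>+x. ennreal (norm (g (x - h n) - g x)) \<partial>lborel) + (\<integral>\<^sup>+x. ennreal (norm (f x - g x)) \<partial>lborel)"
      by (simp add: nn_integral_add)
    also have "(\<integral>\<^sup>+x. ennreal (norm (f (x - h n) - g (x - h n))) \<partial>lborel) = (\<integral>\<^sup>+x. ennreal (norm (f x - g x)) \<partial>lborel)"
      by (rule nn_integral_lborel_shift) measurable
    also have "\<dots> + (\<integral>\<^sup>+x. ennreal (norm (g (x - h n) - g x)) \<partial>lborel) + (\<integral>\<^sup>+x. ennreal (norm (f x - g x)) \<partial>lborel)
       \<le> ennreal (e / 3) + ennreal (e / 3) + ennreal (e / 3)"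
      by (intro add_mono fg gn)
    also have "\<dots> = ennreal e" using e by (simp flip: ennreal_plus)
    finally show "(\<integral>\<^sup>+x. ennreal (norm (f (x - h n) - f x)) \<partial>lborel) \<le> ennreal e" .
  qed
qed

text \<open>A point of an open set stays in it under small shifts, so the indicator of the points
  that leave \<open>U\<close> tends to 0 everywhere, dominated by the indicator of
  \<open>U\<close>.\<close>

lemma L1_shift_cont_open:
  fixes U :: "'a::euclidean_space set" and c :: "'b::{banach, second_countable_topology}"
  assumes U: "open U" and fin: "emeasure lborel U < \<infinity>"
  shows "L1_shift_cont (\<lambda>x. indicator U x *\<^sub>R c)"
  unfolding L1_shift_cont_def
proof (intro allI impI)
  fix h :: "nat \<Rightarrow> 'a" assume h: "h \<longlonglongrightarrow> 0"
  have [measurable]: "U \<in> sets borel" using U by simp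
  \<comment> \<open>Marks the points of \<open>U\<close> that the shift by \<open>v\<close> moves
    out of \<open>U\<close>.\<close>
  define d where "d v x = (indicator U x * indicator (- U) (x + v) :: ennreal)" for v x
  have [measurable]: "d v \<in> borel_measurable borel" for v
    unfolding d_def by measurable
  have lim: "(\<lambda>n. \<integral>\<^sup>+x. d (v n) x \<partial>lborel) \<longlonglongrightarrow> 0" if v: "v \<longlonglongrightarrow> 0" for v
  proof -
    have "(\<lambda>n. \<integral>\<^sup>+x. d (v n) x \<partial>lborel) \<longlonglongrightarrow> (\<integral>\<^sup>+(x::'a). 0 \<partial>lborel)"
    proof (rule nn_integral_dominated_convergence[where w = "indicator U"])
      show "AE x in lborel. (\<lambda>n. d (v n) x) \<longlonglongrightarrow> 0"
      proof (rule AE_I2)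
        fix x show "(\<lambda>n. d (v n) x) \<longlonglongrightarrow> 0"
        proof (cases "x \<in> U")
          case True
          have "(\<lambda>n. x + v n) \<longlonglongrightarrow> x + 0" by (intro tendsto_intros v)
          then have "eventually (\<lambda>n. x + v n \<in> U) sequentially"
            using topological_tendstoD[OF _ U] True by simp
          then have "eventually (\<lambda>n. d (v n) x = 0) sequentially"
            by (rule eventually_mono) (simp add: d_def)
          then show ?thesis by (rule tendsto_eventually)
        qed (simp add: d_def)
      qed
    qed (use fin in \<open>auto simp: d_def split: split_indicator\<close>)
    then show ?thesis by simp
  qed
  \<comment> \<open>The points that enter are the translated points that leave, so the symmetric
    difference of \<open>U\<close> and its shift is described by \<open>d v\<close> and
    \<open>d (- v)\<close> alone, and both tend to 0 by openness of \<open>U\<close>.\<close>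
  have eq: "(\<integral>\<^sup>+x. ennreal (norm (indicator U (x - v) *\<^sub>R c - indicator U x *\<^sub>R c)) \<partial>lborel)
     = ennreal (norm c) * ((\<integral>\<^sup>+x. d v x \<partial>lborel) + (\<integral>\<^sup>+x. d (- v) x \<partial>lborel))" for v :: 'a
  proof -
    have "ennreal (norm (indicator U (x - v) *\<^sub>R c - indicator U x *\<^sub>R c)) = ennreal (norm c) * (d v (x - v) + d (- v) x)" for x
      by (auto simp: d_def indicator_def)
    then have "(\<integral>\<^sup>+x. ennreal (norm (indicator U (x - v) *\<^sub>R c - indicator U x *\<^sub>R c)) \<partial>lborel)
      = ennreal (norm c) * ((\<integral>\<^sup>+x. d v (x - v) \<partial>lborel) + (\<integral>\<^sup>+x. d (- v) x \<partial>lborel))"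
      by (simp add: nn_integral_cmult nn_integral_add)
    then show ?thesis by (simp add: nn_integral_lborel_shift)
  qed
  have "(\<lambda>n. ennreal (norm c) * ((\<integral>\<^sup>+x. d (h n) x \<partial>lborel) + (\<integral>\<^sup>+x. d (- h n) x \<partial>lborel))) \<longlonglongrightarrow> ennreal (norm c) * (0 + 0)"
    using tendsto_minus[OF h] by (intro ennreal_tendsto_cmult tendsto_add lim h) auto
  then show "(\<lambda>n. \<integral>\<^sup>+x. ennreal (norm (indicator U (x - h n) *\<^sub>R c - indicator U x *\<^sub>R c)) \<partial>lborel) \<longlonglongrightarrow> 0"
    by (simp add: eq)
qed

text \<open>Outer regularity passes from open sets to measurable sets of finite measure; sums and
  dominated limits then give all integrable functions.\<close>

lemma integrable_imp_L1_shift_cont: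
  fixes f :: "'a::euclidean_space \<Rightarrow> 'b::{banach, second_countable_topology}"
  assumes "integrable lborel f"
  shows "L1_shift_cont f"
  using assms
proof (induction rule: integrable_induct)
  case (base A c)
  then have [measurable]: "A \<in> sets borel" by simp
  show ?case
  proof (rule L1_shift_cont_approx)
    fix e :: real assume e: "0 < e"
    \<comment> \<open>The summand 1 keeps the denominator positive when \<open>c\<close> is
      0.\<close>
    define e' where "e' = e / (norm c + 1)"
    have nc: "0 < norm c + 1" by (smt (verit) norm_ge_zero)
    then have "0 < e'" using e by (simp add: e'_def)
    then obtain U where U: "open U" "A \<subseteq> U" "emeasure lborel (U - A) < ennreal e'"
      using outer_regular_lborel[of A e'] by auto
    have [measurable]: "U \<in> sets borel" using U by simp
    have "emeasure lborel U = emeasure lborel A + emeasure lborel (U - A)"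
      using U(2) by (subst plus_emeasure) (auto simp: Un_absorb1)
    also have "\<dots> < \<infinity>" using base(2) U(3) by (simp add: less_top[symmetric] top.extremum_strict) (auto simp: top_unique)
    finally have "L1_shift_cont (\<lambda>x. indicator U x *\<^sub>R c)" by (rule L1_shift_cont_open[OF U(1)])
    moreover have "(\<integral>\<^sup>+x. ennreal (norm (indicator A x *\<^sub>R c - indicator U x *\<^sub>R c)) \<partial>lborel) \<le> ennreal e"
    proof -
      have "ennreal (norm (indicator A x *\<^sub>R c - indicator U x *\<^sub>R c)) = ennreal (norm c) * indicator (U - A) x" for x
        using U(2) by (auto simp: indicator_def)
      then have "(\<integral>\<^sup>+x. ennreal (norm (indicator A x *\<^sub>R c - indicator U x *\<^sub>R c)) \<partial>lborel) = ennreal (norm c) * emeasure lborel (U - A)"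
        by (simp add: nn_integral_cmult)
      also have "\<dots> \<le> ennreal (norm c) * ennreal e'" using U(3) by (intro mult_left_mono) auto
      also have "\<dots> = ennreal (norm c * e')" using \<open>0 < e'\<close> by (simp add: ennreal_mult)
      also have "norm c * e' \<le> e" using nc e by (simp add: e'_def field_simps)
      finally show ?thesis by (simp add: ennreal_leI)
    qed
    ultimately show "\<exists>g. g \<in> borel_measurable borel \<and> L1_shift_cont g \<and>
        (\<integral>\<^sup>+x. ennreal (norm (indicator A x *\<^sub>R c - g x)) \<partial>lborel) \<le> ennreal e"
      by (intro exI[of _ "\<lambda>x. indicator U x *\<^sub>R c"]) auto
  qed simp
next
  case (add f g)
  have [measurable]: "f \<in> borel_measurable borel" "g \<in> borel_measurable borel" using add(1,2) by auto
  show ?case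
    unfolding L1_shift_cont_def
  proof (intro allI impI)
    fix h :: "nat \<Rightarrow> 'a" assume h: "h \<longlonglongrightarrow> 0"
    have "(\<lambda>n. (\<integral>\<^sup>+x. ennreal (norm (f (x - h n) - f x)) \<partial>lborel) + (\<integral>\<^sup>+x. ennreal (norm (g (x - h n) - g x)) \<partial>lborel)) \<longlonglongrightarrow> 0 + 0"
      using add h by (intro tendsto_add) (auto simp: L1_shift_cont_def)
    then have *: "(\<lambda>n. (\<integral>\<^sup>+x. ennreal (norm (f (x - h n) - f x)) \<partial>lborel) + (\<integral>\<^sup>+x. ennreal (norm (g (x - h n) - g x)) \<partial>lborel)) \<longlonglongrightarrow> 0"
      by simp
    have le: "(\<integral>\<^sup>+x. ennreal (norm (f (x - h n) + g (x - h n) - (f x + g x))) \<partial>lborel)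
       \<le> (\<integral>\<^sup>+x. ennreal (norm (f (x - h n) - f x)) \<partial>lborel) + (\<integral>\<^sup>+x. ennreal (norm (g (x - h n) - g x)) \<partial>lborel)" for n
    proof -
      have "norm (f (x - h n) + g (x - h n) - (f x + g x)) \<le> norm (f (x - h n) - f x) + norm (g (x - h n) - g x)" for x
        by norm
      then show ?thesis
        by (subst nn_integral_add[symmetric]) (auto intro!: nn_integral_mono simp flip: ennreal_plus)
    qed
    show "(\<lambda>n. \<integral>\<^sup>+x. ennreal (norm (f (x - h n) + g (x - h n) - (f x + g x))) \<partial>lborel) \<longlonglongrightarrow> 0"
      by (rule tendsto_sandwich[OF _ _ tendsto_const *]) (auto simp: le)
  qed
next
  case (lim f s)
  have f[measurable]: "f \<in> borel_measurable borel" and [measurable]: "\<And>i. s i \<in> borel_measurable borel" 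
    using lim(1,4) by auto
  have "(\<lambda>i. \<integral>\<^sup>+x. ennreal (norm (f x - s i x)) \<partial>lborel) \<longlonglongrightarrow> (\<integral>\<^sup>+(x::'a). 0 \<partial>lborel)"
  \<comment> \<open>The factor 3 is 1 + 2: the induction rule supplies approximants of norm at most
    twice that of \<open>f\<close>.\<close>
  proof (rule nn_integral_dominated_convergence[where w = "\<lambda>x. ennreal 3 * ennreal (norm (f x))"])
    show "AE x in lborel. ennreal (norm (f x - s j x)) \<le> ennreal 3 * ennreal (norm (f x))" for j
    proof (rule AE_I2)
      fix x
      have "norm (f x - s j x) \<le> norm (f x) + norm (s j x)" by (rule norm_triangle_ineq4)
      also have "norm (s j x) \<le> 2 * norm (f x)" using lim(3) by simp
      finally show "ennreal (norm (f x - s j x)) \<le> ennreal 3 * ennreal (norm (f x))"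
        by (subst ennreal_mult[symmetric]) (auto intro!: ennreal_leI)
    qed
    show "(\<integral>\<^sup>+x. ennreal 3 * ennreal (norm (f x)) \<partial>lborel) < \<infinity>"
      using lim(4) by (subst nn_integral_cmult) (auto simp: integrable_iff_bounded ennreal_mult_less_top)
    show "AE x in lborel. (\<lambda>i. ennreal (norm (f x - s i x))) \<longlonglongrightarrow> 0"
    proof (rule AE_I2)
      fix x
      have "(\<lambda>i. norm (f x - s i x)) \<longlonglongrightarrow> norm (f x - f x)" using lim(2) by (intro tendsto_intros) simp
      then have "(\<lambda>i. ennreal (norm (f x - s i x))) \<longlonglongrightarrow> ennreal (norm (f x - f x))" by (rule tendsto_ennrealI)
      then show "(\<lambda>i. ennreal (norm (f x - s i x))) \<longlonglongrightarrow> 0" by simp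
    qed
  qed measurable
  then have l: "(\<lambda>i. \<integral>\<^sup>+x. ennreal (norm (f x - s i x)) \<partial>lborel) \<longlonglongrightarrow> 0" by simp
  show ?case
  proof (rule L1_shift_cont_approx[OF f])
    fix e :: real assume "0 < e"
    from ennreal_tendsto_0D[OF l this] obtain i where "(\<integral>\<^sup>+x. ennreal (norm (f x - s i x)) \<partial>lborel) \<le> ennreal e"
      by (auto simp: eventually_sequentially)
    then show "\<exists>g. g \<in> borel_measurable borel \<and> L1_shift_cont g \<and>
        (\<integral>\<^sup>+x. ennreal (norm (f x - g x)) \<partial>lborel) \<le> ennreal e"
      using lim(5) by (intro exI[of _ "s i"]) auto
  qed
qed

text \<open>After exchanging the integrals the inner one is the L1 distance between \<open>g\<close>
  and its translate by \<open>e n *\<^sub>R y\<close>. It tends to 0 for each \<open>y\<close> and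
  is at most twice the L1 norm of \<open>g\<close>, so dominated convergence applies to the Gaussian
  weight.\<close>

lemma gauss_average_L1_tendsto:
  fixes g :: "'a::euclidean_space \<Rightarrow> 'b::{banach, second_countable_topology}"
  assumes g: "integrable lborel g" and e: "e \<longlonglongrightarrow> 0"
  shows "(\<lambda>n. \<integral>\<^sup>+\<xi>. \<integral>\<^sup>+y. ennreal (gauss y) * ennreal (norm (g (\<xi> - e n *\<^sub>R y) - g \<xi>)) \<partial>lborel \<partial>lborel) \<longlonglongrightarrow> 0"
proof -
  have [measurable]: "g \<in> borel_measurable borel" using g by auto
  define w where "w v = (\<integral>\<^sup>+\<xi>. ennreal (norm (g (\<xi> - v) - g \<xi>)) \<partial>lborel)" for v
  have [measurable]: "w \<in> borel_measurable borel" unfolding w_def by measurable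
  have w_le: "w v \<le> 2 * (\<integral>\<^sup>+\<xi>. ennreal (norm (g \<xi>)) \<partial>lborel)" for v
  proof -
    have "w v \<le> (\<integral>\<^sup>+\<xi>. ennreal (norm (g (\<xi> - v))) + ennreal (norm (g \<xi>)) \<partial>lborel)"
      unfolding w_def by (intro nn_integral_mono) (auto simp flip: ennreal_plus intro: norm_triangle_ineq4)
    also have "\<dots> = (\<integral>\<^sup>+\<xi>. ennreal (norm (g (\<xi> - v))) \<partial>lborel) + (\<integral>\<^sup>+\<xi>. ennreal (norm (g \<xi>)) \<partial>lborel)"
      by (simp add: nn_integral_add)
    also have "(\<integral>\<^sup>+\<xi>. ennreal (norm (g (\<xi> - v))) \<partial>lborel) = (\<integral>\<^sup>+\<xi>. ennreal (norm (g \<xi>)) \<partial>lborel)"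
      by (rule nn_integral_lborel_shift) measurable
    finally show ?thesis by (simp add: mult_2)
  qed
  have fin: "(\<integral>\<^sup>+\<xi>. ennreal (norm (g \<xi>)) \<partial>lborel) < \<infinity>" using g by (simp add: integrable_iff_bounded)
  have "(\<lambda>n. \<integral>\<^sup>+y. ennreal (gauss y) * w (e n *\<^sub>R y) \<partial>lborel) \<longlonglongrightarrow> (\<integral>\<^sup>+(y::'a). 0 \<partial>lborel)"
  proof (rule nn_integral_dominated_convergence[where w = "\<lambda>y. ennreal (gauss y) * (2 * (\<integral>\<^sup>+\<xi>. ennreal (norm (g \<xi>)) \<partial>lborel))"])
    show "AE y in lborel. (\<lambda>n. ennreal (gauss y) * w (e n *\<^sub>R y)) \<longlonglongrightarrow> 0"
    proof (rule AE_I2)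
      fix y :: 'a
      have "(\<lambda>n. e n *\<^sub>R y) \<longlonglongrightarrow> 0 *\<^sub>R y" by (intro tendsto_intros e)
      then have "(\<lambda>n. w (e n *\<^sub>R y)) \<longlonglongrightarrow> 0"
        using integrable_imp_L1_shift_cont[OF g] by (simp add: L1_shift_cont_def w_def)
      then have "(\<lambda>n. ennreal (gauss y) * w (e n *\<^sub>R y)) \<longlonglongrightarrow> ennreal (gauss y) * 0"
        by (intro ennreal_tendsto_cmult) auto
      then show "(\<lambda>n. ennreal (gauss y) * w (e n *\<^sub>R y)) \<longlonglongrightarrow> 0" by simp
    qed
    show "AE y in lborel. ennreal (gauss y) * w (e n *\<^sub>R y) \<le> ennreal (gauss y) * (2 * (\<integral>\<^sup>+\<xi>. ennreal (norm (g \<xi>)) \<partial>lborel))" for n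
      by (intro AE_I2 mult_left_mono w_le) auto
    show "(\<integral>\<^sup>+y. ennreal (gauss (y::'a)) * (2 * (\<integral>\<^sup>+\<xi>. ennreal (norm (g \<xi>)) \<partial>lborel)) \<partial>lborel) < \<infinity>"
      using fin by (subst nn_integral_multc) (auto simp: nn_integral_gauss ennreal_mult_less_top)
  qed measurable
  moreover have "(\<integral>\<^sup>+\<xi>. \<integral>\<^sup>+y. ennreal (gauss y) * ennreal (norm (g (\<xi> - e n *\<^sub>R y) - g \<xi>)) \<partial>lborel \<partial>lborel)
     = (\<integral>\<^sup>+y. ennreal (gauss y) * w (e n *\<^sub>R y) \<partial>lborel)" for n
  proof -
    have "(\<integral>\<^sup>+\<xi>. \<integral>\<^sup>+y. ennreal (gauss y) * ennreal (norm (g (\<xi> - e n *\<^sub>R y) - g \<xi>)) \<partial>lborel \<partial>lborel)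
      = (\<integral>\<^sup>+y. \<integral>\<^sup>+\<xi>. ennreal (gauss y) * ennreal (norm (g (\<xi> - e n *\<^sub>R y) - g \<xi>)) \<partial>lborel \<partial>lborel)"
      by (rule lborel_pair.Fubini') measurable
    then show ?thesis by (simp add: w_def nn_integral_cmult)
  qed
  ultimately show ?thesis by simp
qed

section \<open>The Fourier transform on square-integrable functions\<close>

text \<open>The squared L2 norm, possibly infinite. Without the square root the triangle inequality
  takes the form \<open>L2_sq_add_le\<close>, whose factors 2 account for the constants in the
  estimates below.\<close>

definition L2_sq :: "('a::euclidean_space \<Rightarrow> complex) \<Rightarrow> ennreal" where
  "L2_sq f = (\<integral>\<^sup>+x. ennreal ((cmod (f x))\<^sup>2) \<partial>lborel)"

lemma in_L2_iff: "in_L2 f \<longleftrightarrow> f \<in> borel_measurable borel \<and> L2_sq f < \<infinity>"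
  by (auto simp: in_L2_def L2_sq_def integrable_iff_bounded)

lemma L2_tendsto_iff: "L2_tendsto u f \<longleftrightarrow> (\<lambda>k. L2_sq (\<lambda>x. u k x - f x)) \<longlonglongrightarrow> 0"
  by (simp add: L2_tendsto_def L2_sq_def)

section \<open>Squared L2 distances and completeness\<close>

lemma power2_norm_add_le: "(norm (a + b :: 'a::real_normed_vector))\<^sup>2 \<le> 2 * (norm a)\<^sup>2 + 2 * (norm b)\<^sup>2"
proof -
  have "(norm (a + b))\<^sup>2 \<le> (norm a + norm b)\<^sup>2" by (intro power_mono norm_triangle_ineq) simp
  also have "\<dots> \<le> 2 * (norm a)\<^sup>2 + 2 * (norm b)\<^sup>2"
    using zero_le_power2[of "norm a - norm b"] by (simp add: power2_sum power2_diff)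
  finally show ?thesis .
qed

lemma L2_sq_add_le:
  assumes [measurable]: "f \<in> borel_measurable borel" "g \<in> borel_measurable borel"
  shows "L2_sq (\<lambda>x. f x + g x) \<le> 2 * L2_sq f + 2 * L2_sq g"
proof -
  have "L2_sq (\<lambda>x. f x + g x) \<le> (\<integral>\<^sup>+x. 2 * ennreal ((cmod (f x))\<^sup>2) + 2 * ennreal ((cmod (g x))\<^sup>2) \<partial>lborel)"
    unfolding L2_sq_def
  proof (rule nn_integral_mono)
    fix x
    have "ennreal ((cmod (f x + g x))\<^sup>2) \<le> ennreal (2 * (cmod (f x))\<^sup>2 + 2 * (cmod (g x))\<^sup>2)"
      by (intro ennreal_leI power2_norm_add_le)
    then show "ennreal ((cmod (f x + g x))\<^sup>2) \<le> 2 * ennreal ((cmod (f x))\<^sup>2) + 2 * ennreal ((cmod (g x))\<^sup>2)"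
      by (simp add: ennreal_mult)
  qed
  also have "\<dots> = 2 * L2_sq f + 2 * L2_sq g"
    by (simp add: L2_sq_def nn_integral_add nn_integral_cmult)
  finally show ?thesis .
qed

lemma L2_sq_diff_le:
  assumes [measurable]: "f \<in> borel_measurable borel" "g \<in> borel_measurable borel" "h \<in> borel_measurable borel"
  shows "L2_sq (\<lambda>x. f x - h x) \<le> 2 * L2_sq (\<lambda>x. f x - g x) + 2 * L2_sq (\<lambda>x. g x - h x)"
  using L2_sq_add_le[of "\<lambda>x. f x - g x" "\<lambda>x. g x - h x"] by simp

lemma L2_sq_minus_commute: "L2_sq (\<lambda>x. f x - g x) = L2_sq (\<lambda>x. g x - f x)"
  by (simp add: L2_sq_def norm_minus_commute)

lemma suminf_bounded_terms:
  fixes f :: "nat \<Rightarrow> real"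
  assumes "(\<Sum>m. ennreal (f m)) \<noteq> \<infinity>" "\<And>m. 0 \<le> f m"
  obtains B where "\<And>m. f m \<le> B" "0 \<le> B"
proof -
  obtain B where B: "(\<Sum>m. ennreal (f m)) = ennreal B" "0 \<le> B"
    using assms(1) by (cases "\<Sum>m. ennreal (f m)") auto
  have "ennreal (f m) \<le> ennreal B" for m
  proof -
    have "(\<Sum>i\<in>{m}. ennreal (f i)) \<le> (\<Sum>m. ennreal (f m))" by (rule sum_le_suminf) auto
    then show ?thesis by (simp add: B(1))
  qed
  then have "f m \<le> B" for m using B(2) by (simp add: ennreal_le_iff)
  then show ?thesis using B(2) by (rule that)
qed

text \<open>The geometric weights allow to sum squares of \<open>L\<^sup>2\<close> distances, which makes Minkowski's inequality unnecessary.\<close>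

lemma summable_of_weighted_squares:
  fixes d :: "nat \<Rightarrow> complex"
  assumes "(\<Sum>m. ennreal (2 ^ m * (cmod (d m))\<^sup>2)) \<noteq> \<infinity>"
  shows "summable d"
proof -
  obtain B where B: "\<And>m. 2 ^ m * (cmod (d m))\<^sup>2 \<le> B" "0 \<le> B"
    using assms by (rule suminf_bounded_terms) auto
  have "cmod (d m) \<le> sqrt B * (1 / sqrt 2) ^ m" for m
  proof -
    have "(cmod (d m))\<^sup>2 \<le> B / 2 ^ m" using B(1)[of m] by (simp add: field_simps)
    then have "cmod (d m) \<le> sqrt (B / 2 ^ m)" by (rule real_le_rsqrt)
    also have "\<dots> = sqrt B * (1 / sqrt 2) ^ m" by (simp add: real_sqrt_divide real_sqrt_power power_divide)
    finally show ?thesis .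
  qed
  moreover have "summable (\<lambda>m. sqrt B * (1 / sqrt 2) ^ m)"
    by (intro summable_mult summable_geometric) simp
  ultimately show ?thesis by (intro summable_comparison_test[of d "\<lambda>m. sqrt B * (1 / sqrt 2) ^ m"]) auto
qed

text \<open>The rate 1/4 leaves room for the weights 2^m: the weighted squared increments have
  integrals bounded by D/2^m, so their sum is finite almost everywhere and the sequence converges
  there. Fatou's lemma, with \<open>m\<close> fixed and \<open>l\<close> growing, carries the Cauchy
  bound over to the limit.\<close>

lemma L2_fast_Cauchy_limit:
  fixes v :: "nat \<Rightarrow> 'a::euclidean_space \<Rightarrow> complex"
  assumes v[measurable]: "\<And>m. v m \<in> borel_measurable borel"
    and D: "0 \<le> D"
    and Cauchy: "\<And>m l. m \<le> l \<Longrightarrow> L2_sq (\<lambda>x. v l x - v m x) \<le> ennreal (D * (1/4) ^ m)"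
  obtains \<phi> where "\<phi> \<in> borel_measurable borel" "(\<lambda>m. L2_sq (\<lambda>x. v m x - \<phi> x)) \<longlonglongrightarrow> 0"
proof -
  define d where "d m x = v (Suc m) x - v m x" for m x
  have [measurable]: "d m \<in> borel_measurable borel" for m unfolding d_def by measurable
  define \<phi> where "\<phi> x = lim (\<lambda>m. v m x)" for x
  have \<phi>[measurable]: "\<phi> \<in> borel_measurable borel" unfolding \<phi>_def by measurable
  have "(\<integral>\<^sup>+x. (\<Sum>m. ennreal (2 ^ m * (cmod (d m x))\<^sup>2)) \<partial>lborel) = (\<Sum>m. \<integral>\<^sup>+x. ennreal (2 ^ m * (cmod (d m x))\<^sup>2) \<partial>lborel)"
    by (rule nn_integral_suminf) measurable
  also have "\<dots> \<le> (\<Sum>m. ennreal (D * (1/2) ^ m))"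
  proof (rule suminf_le)
    fix m
    have "(\<integral>\<^sup>+x. ennreal (2 ^ m * (cmod (d m x))\<^sup>2) \<partial>lborel) = ennreal (2 ^ m) * L2_sq (d m)"
      by (simp add: ennreal_mult L2_sq_def nn_integral_cmult)
    also have "\<dots> \<le> ennreal (2 ^ m) * ennreal (D * (1/4) ^ m)"
      unfolding d_def by (intro mult_left_mono Cauchy) auto
    also have "\<dots> = ennreal (2 ^ m * (D * (1/4) ^ m))" using D by (simp add: ennreal_mult)
    also have "2 ^ m * (D * (1/4) ^ m) = D * (1/2) ^ m"
      by (simp add: power_mult_distrib[symmetric] mult.left_commute)
    finally show "(\<integral>\<^sup>+x. ennreal (2 ^ m * (cmod (d m x))\<^sup>2) \<partial>lborel) \<le> ennreal (D * (1/2) ^ m)" .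
  qed auto
  also have "\<dots> < \<infinity>"
    using D by (subst suminf_ennreal2) (auto intro!: summable_mult)
  finally have "AE x in lborel. (\<Sum>m. ennreal (2 ^ m * (cmod (d m x))\<^sup>2)) \<noteq> \<infinity>"
    by (intro nn_integral_PInf_AE) auto
  then have conv: "AE x in lborel. (\<lambda>m. v m x) \<longlonglongrightarrow> \<phi> x"
  proof eventually_elim
    case (elim x)
    then have "summable (\<lambda>m. d m x)" by (rule summable_of_weighted_squares)
    then have "convergent (\<lambda>n. \<Sum>m<n. d m x)" by (simp add: summable_iff_convergent)
    moreover have "(\<Sum>m<n. d m x) = v n x - v 0 x" for n
      unfolding d_def by (rule sum_lessThan_telescope)
    ultimately have "convergent (\<lambda>n. v n x - v 0 x)" by simp
    then have "convergent (\<lambda>n. v n x)" by (simp add: convergent_diff_const_right_iff)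
    then show ?case by (simp add: \<phi>_def convergent_LIMSEQ_iff)
  qed
  have le: "L2_sq (\<lambda>x. v m x - \<phi> x) \<le> ennreal (D * (1/4) ^ m)" for m
  proof -
    have "L2_sq (\<lambda>x. v m x - \<phi> x) = (\<integral>\<^sup>+x. liminf (\<lambda>l. ennreal ((cmod (v l x - v m x))\<^sup>2)) \<partial>lborel)"
      unfolding L2_sq_def
    proof (rule nn_integral_cong_AE)
      show "AE x in lborel. ennreal ((cmod (v m x - \<phi> x))\<^sup>2) = liminf (\<lambda>l. ennreal ((cmod (v l x - v m x))\<^sup>2))"
        using conv
      proof eventually_elim
        case (elim x)
        have "(\<lambda>l. ennreal ((cmod (v l x - v m x))\<^sup>2)) \<longlonglongrightarrow> ennreal ((cmod (\<phi> x - v m x))\<^sup>2)"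
          by (intro tendsto_ennrealI tendsto_intros elim)
        from lim_imp_Liminf[OF _ this] show ?case by (simp add: norm_minus_commute)
      qed
    qed
    also have "\<dots> \<le> liminf (\<lambda>l. \<integral>\<^sup>+x. ennreal ((cmod (v l x - v m x))\<^sup>2) \<partial>lborel)"
      by (rule nn_integral_liminf) measurable
    also have "\<dots> \<le> ennreal (D * (1/4) ^ m)"
    proof (rule Liminf_le)
      show "\<forall>\<^sub>F l in sequentially. (\<integral>\<^sup>+x. ennreal ((cmod (v l x - v m x))\<^sup>2) \<partial>lborel) \<le> ennreal (D * (1/4) ^ m)"
        using eventually_ge_at_top[of m] by (rule eventually_mono) (use Cauchy in \<open>simp add: L2_sq_def\<close>)
    qed simp
    finally show ?thesis .
  qed
  have "(\<lambda>m. D * (1/4) ^ m) \<longlonglongrightarrow> D * 0"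
    by (intro tendsto_mult tendsto_const LIMSEQ_realpow_zero) auto
  from tendsto_ennrealI[OF this] have lim: "(\<lambda>m. ennreal (D * (1/4) ^ m)) \<longlonglongrightarrow> 0"
    by (simp only: mult_zero_right ennreal_0)
  have "(\<lambda>m. L2_sq (\<lambda>x. v m x - \<phi> x)) \<longlonglongrightarrow> 0"
    by (rule tendsto_sandwich[OF _ _ tendsto_const lim]) (auto simp: le)
  with \<phi> show ?thesis by (rule that)
qed

section \<open>Damped inverse transforms, Gaussian averages and the Plancherel bound\<close>

lemma ennreal_norm_integral_le:
  fixes f :: "'a \<Rightarrow> 'b::{banach, second_countable_topology}"
  shows "ennreal (norm (\<integral>x. f x \<partial>M)) \<le> (\<integral>\<^sup>+x. ennreal (norm (f x)) \<partial>M)"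
  \<comment> \<open>A function that is not integrable has integral 0.\<close>
  by (cases "integrable M f") (auto intro: integral_norm_bound_ennreal simp: not_integrable_integral_eq)

text \<open>The multiplication formula: a kernel bounded by 1 leaves the product of
  \<open>f x\<close> and \<open>g y\<close> integrable, so Fubini applies. The kernels are
  exponentials of either sign.\<close>

lemma integral_kernel_swap:
  fixes f :: "'a::euclidean_space \<Rightarrow> complex" and g :: "'b::euclidean_space \<Rightarrow> complex"
  assumes f: "integrable lborel f" and g: "integrable lborel g"
    and k[measurable]: "(\<lambda>(x, y). k x y) \<in> borel_measurable (borel \<Otimes>\<^sub>M borel)" and k1: "\<And>x y. norm (k x y) \<le> 1"
  shows "(\<integral>x. f x * (\<integral>y. g y * k x y \<partial>lborel) \<partial>lborel) = (\<integral>y. g y * (\<integral>x. f x * k x y \<partial>lborel) \<partial>lborel)"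
proof -
  have [measurable]: "f \<in> borel_measurable borel" "g \<in> borel_measurable borel" using f g by auto
  have prod: "integrable (lborel \<Otimes>\<^sub>M lborel) (\<lambda>(x, y). f x * g y)"
    by (rule lborel_pair.Fubini_integrable) (use f g in \<open>auto simp: norm_mult\<close>)
  have "integrable (lborel \<Otimes>\<^sub>M lborel) (\<lambda>(x, y). f x * g y * k x y)"
  proof (rule Bochner_Integration.integrable_bound[OF prod])
    show "AE z in lborel \<Otimes>\<^sub>M lborel. norm (case z of (x, y) \<Rightarrow> f x * g y * k x y) \<le> norm (case z of (x, y) \<Rightarrow> f x * g y)"
      by (rule AE_I2) (auto simp: norm_mult intro!: mult_left_le k1)
  qed measurable
  from lborel_pair.Fubini_integral[OF this]
  have "(\<integral>y. \<integral>x. f x * g y * k x y \<partial>lborel \<partial>lborel) = (\<integral>x. \<integral>y. f x * g y * k x y \<partial>lborel \<partial>lborel)" .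
  moreover have "(\<integral>x. f x * g y * k x y \<partial>lborel) = g y * (\<integral>x. f x * k x y \<partial>lborel)" for y
    by (subst integral_mult_right_zero[symmetric]) (simp add: mult_ac)
  moreover have "(\<integral>y. f x * g y * k x y \<partial>lborel) = f x * (\<integral>y. g y * k x y \<partial>lborel)" for x
    by (subst integral_mult_right_zero[symmetric]) (simp add: mult_ac)
  ultimately show ?thesis by simp
qed

text \<open>\<open>gauss_mass\<^sup>2\<close> is the constant \<open>(2\<pi>)\<^sup>n\<close> of the inversion formula.\<close>

definition inv_fourier :: "('a::euclidean_space \<Rightarrow> complex) \<Rightarrow> 'a \<Rightarrow> complex" where
  "inv_fourier g x = (\<integral>\<eta>. g \<eta> * exp (\<i> * of_real (x \<bullet> \<eta>)) \<partial>lborel) / of_real ((gauss_mass TYPE('a))\<^sup>2)"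

text \<open>Convolution with the Gaussian probability density of width \<epsilon>, written after
  substitution so that the weight does not depend on \<epsilon>.\<close>

definition gauss_average :: "real \<Rightarrow> ('a::euclidean_space \<Rightarrow> complex) \<Rightarrow> 'a \<Rightarrow> complex" where
  "gauss_average \<epsilon> g \<xi> = (\<integral>y. of_real (gauss y) * g (\<xi> - \<epsilon> *\<^sub>R y) \<partial>lborel) / of_real (gauss_mass TYPE('a))"

text \<open>\<open>inv_fourier g\<close> is bounded but need not be integrable; the Gaussian factor
  makes it a legitimate argument of \<open>fourier_L1\<close>. Damping in \<open>x\<close> amounts
  to mollifying on the Fourier side.\<close>

definition mollified :: "real \<Rightarrow> ('a::euclidean_space \<Rightarrow> complex) \<Rightarrow> 'a \<Rightarrow> complex" where
  "mollified \<epsilon> g x = of_real (gauss (\<epsilon> *\<^sub>R x)) * inv_fourier g x"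

lemma inv_fourier_measurable [measurable]:
  assumes [measurable]: "g \<in> borel_measurable borel"
  shows "inv_fourier g \<in> borel_measurable borel"
  unfolding inv_fourier_def by measurable

lemma gauss_average_measurable [measurable]:
  assumes [measurable]: "g \<in> borel_measurable borel"
  shows "gauss_average \<epsilon> g \<in> borel_measurable borel"
  unfolding gauss_average_def by measurable

lemma mollified_measurable [measurable]:
  assumes [measurable]: "g \<in> borel_measurable borel"
  shows "mollified \<epsilon> g \<in> borel_measurable borel"
  unfolding mollified_def by measurable

lemma integrable_gauss_scaled:
  assumes "\<epsilon> > 0"
  shows "integrable lborel (\<lambda>x::'a::euclidean_space. gauss (\<epsilon> *\<^sub>R x))"
  using integrable_lborel_affine[OF integrable_gauss, of \<epsilon> "0::'a"] assms by simp

lemma integrable_mult_exp: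
  fixes g :: "'a::euclidean_space \<Rightarrow> complex"
  assumes "integrable lborel g"
  shows "integrable lborel (\<lambda>\<eta>. g \<eta> * exp (\<i> * of_real (x \<bullet> \<eta>)))"
proof -
  have [measurable]: "g \<in> borel_measurable borel" using assms by auto
  show ?thesis
    by (rule Bochner_Integration.integrable_bound[OF assms]) (auto simp: norm_mult)
qed

lemma inv_fourier_diff:
  assumes "integrable lborel g" "integrable lborel h"
  shows "inv_fourier (\<lambda>\<xi>. g \<xi> - h \<xi>) x = inv_fourier g x - inv_fourier h x"
  by (simp add: inv_fourier_def left_diff_distrib diff_divide_distrib
      Bochner_Integration.integral_diff[OF integrable_mult_exp integrable_mult_exp, OF assms])

lemma inv_fourier_bound:
  fixes g :: "'a::euclidean_space \<Rightarrow> complex"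
  assumes "integrable lborel g"
  shows "cmod (inv_fourier g x) \<le> (\<integral>\<eta>. cmod (g \<eta>) \<partial>lborel) / (gauss_mass TYPE('a))\<^sup>2"
proof -
  have "cmod (\<integral>\<eta>. g \<eta> * exp (\<i> * of_real (x \<bullet> \<eta>)) \<partial>lborel) \<le> (\<integral>\<eta>. cmod (g \<eta>) \<partial>lborel)"
    using integral_norm_bound[of lborel "\<lambda>\<eta>. g \<eta> * exp (\<i> * of_real (x \<bullet> \<eta>))"] by (simp add: norm_mult)
  then show ?thesis
    unfolding inv_fourier_def by (simp add: norm_divide divide_right_mono norm_power)
qed

lemma integrable_mollified:
  fixes g :: "'a::euclidean_space \<Rightarrow> complex"
  assumes g: "integrable lborel g" and e: "\<epsilon> > 0"
  shows "integrable lborel (mollified \<epsilon> g)"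
proof -
  have [measurable]: "g \<in> borel_measurable borel" using g by auto
  let ?B = "(\<integral>\<eta>. cmod (g \<eta>) \<partial>lborel) / (gauss_mass TYPE('a))\<^sup>2"
  show ?thesis
  proof (rule Bochner_Integration.integrable_bound[of _ "\<lambda>x. gauss (\<epsilon> *\<^sub>R x) * ?B"])
    show "integrable lborel (\<lambda>x. gauss (\<epsilon> *\<^sub>R (x::'a)) * ?B)"
      by (intro integrable_mult_left integrable_gauss_scaled e)
    show "AE x in lborel. norm (mollified \<epsilon> g x) \<le> norm (gauss (\<epsilon> *\<^sub>R x) * ?B)"
    proof (rule AE_I2)
      fix x
      have "norm (mollified \<epsilon> g x) = gauss (\<epsilon> *\<^sub>R x) * cmod (inv_fourier g x)"
        using gauss_pos[of "\<epsilon> *\<^sub>R x"] by (simp add: mollified_def norm_mult)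
      also have "\<dots> \<le> gauss (\<epsilon> *\<^sub>R x) * ?B"
        by (intro mult_left_mono inv_fourier_bound g less_imp_le[OF gauss_pos])
      finally show "norm (mollified \<epsilon> g x) \<le> norm (gauss (\<epsilon> *\<^sub>R x) * ?B)" by (simp del: times_divide_eq_right)
    qed
  qed measurable
qed

text \<open>The exchange of integrals leaves the transform of a wide Gaussian, which is a narrow
  Gaussian centred at \<xi>; the substitution \<eta> = \<xi> - \<epsilon> y makes it a weight
  independent of \<epsilon>. The powers of \<epsilon> cancel, and of the two factors
  \<open>gauss_mass\<close> in the inversion constant one survives to normalize the weight.\<close>

lemma fourier_mollified:
  fixes g :: "'a::euclidean_space \<Rightarrow> complex"
  assumes g: "integrable lborel g" and e: "\<epsilon> > 0"
  shows "(\<integral>x. mollified \<epsilon> g x * exp (- \<i> * of_real (x \<bullet> \<xi>)) \<partial>lborel) = gauss_average \<epsilon> g \<xi>"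
proof -
  have [measurable]: "g \<in> borel_measurable borel" using g by auto
  define C where "C = gauss_mass TYPE('a)"
  have C: "C > 0" by (simp add: C_def gauss_mass_pos)
  let ?f = "\<lambda>x. of_real (gauss (\<epsilon> *\<^sub>R x)) * exp (- \<i> * of_real (x \<bullet> \<xi>))"
  have f: "integrable lborel ?f"
    by (rule Bochner_Integration.integrable_bound[OF integrable_gauss_scaled[OF e]]) (auto simp: norm_mult)
  have "(\<integral>x. mollified \<epsilon> g x * exp (- \<i> * of_real (x \<bullet> \<xi>)) \<partial>lborel)
     = (\<integral>x. ?f x * (\<integral>\<eta>. g \<eta> * exp (\<i> * of_real (x \<bullet> \<eta>)) \<partial>lborel) / of_real (C\<^sup>2) \<partial>lborel)"
    by (intro Bochner_Integration.integral_cong refl) (simp add: mollified_def inv_fourier_def C_def mult_ac)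
  also have "\<dots> = (\<integral>x. ?f x * (\<integral>\<eta>. g \<eta> * exp (\<i> * of_real (x \<bullet> \<eta>)) \<partial>lborel) \<partial>lborel) / of_real (C\<^sup>2)"
    by (rule integral_divide_zero)
  also have "(\<integral>x. ?f x * (\<integral>\<eta>. g \<eta> * exp (\<i> * of_real (x \<bullet> \<eta>)) \<partial>lborel) \<partial>lborel)
      = (\<integral>\<eta>. g \<eta> * (\<integral>x. ?f x * exp (\<i> * of_real (x \<bullet> \<eta>)) \<partial>lborel) \<partial>lborel)"
    by (rule integral_kernel_swap[OF f g]; measurable?; simp)
  also have "\<dots> = (\<integral>\<eta>. g \<eta> * of_real (C * gauss ((\<xi> - \<eta>) /\<^sub>R \<epsilon>) / \<epsilon> ^ DIM('a)) \<partial>lborel)"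
  proof (intro Bochner_Integration.integral_cong refl arg_cong2[where f = "(*)"])
    fix \<eta> :: 'a
    have "?f x * exp (\<i> * of_real (x \<bullet> \<eta>)) = of_real (gauss (\<epsilon> *\<^sub>R x)) * exp (- \<i> * of_real (x \<bullet> (\<xi> - \<eta>)))" for x
    proof -
      have "exp (- \<i> * of_real (x \<bullet> (\<xi> - \<eta>))) = exp (- \<i> * of_real (x \<bullet> \<xi>)) * exp (\<i> * of_real (x \<bullet> \<eta>))"
        by (simp add: inner_diff_right exp_add[symmetric] algebra_simps)
      then show ?thesis by simp
    qed
    then show "(\<integral>x. ?f x * exp (\<i> * of_real (x \<bullet> \<eta>)) \<partial>lborel) = of_real (C * gauss ((\<xi> - \<eta>) /\<^sub>R \<epsilon>) / \<epsilon> ^ DIM('a))"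
      unfolding C_def fourier_gauss_scaled[OF e, symmetric] by (simp only:)
  qed
  also have "\<dots> = \<bar>- \<epsilon>\<bar> ^ DIM('a) *\<^sub>R (\<integral>y. g (\<xi> + (- \<epsilon>) *\<^sub>R y) * of_real (C * gauss ((\<xi> - (\<xi> + (- \<epsilon>) *\<^sub>R y)) /\<^sub>R \<epsilon>) / \<epsilon> ^ DIM('a)) \<partial>lborel)"
    by (rule lborel_integral_affine) (use e in auto)
  also have "\<dots> = \<bar>- \<epsilon>\<bar> ^ DIM('a) *\<^sub>R (\<integral>y. of_real (gauss y) * g (\<xi> - \<epsilon> *\<^sub>R y) * of_real (C / \<epsilon> ^ DIM('a)) \<partial>lborel)"
    using e by (intro arg_cong[where f = "\<lambda>z. _ *\<^sub>R z"] Bochner_Integration.integral_cong refl) (simp add: mult_ac)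
  also have "\<dots> = (\<integral>y. of_real (gauss y) * g (\<xi> - \<epsilon> *\<^sub>R y) \<partial>lborel) * of_real C"
    using e unfolding integral_mult_left_zero by (simp add: scaleR_conv_of_real)
  finally show ?thesis
    using C by (simp add: gauss_average_def C_def[symmetric] power2_eq_square)
qed

text \<open>The product of two values of |g| is at most half the sum of their squares, and both
  squares have the same integral by translation invariance. The Gaussian weights have total mass
  1.\<close>

lemma gauss_average_pairing_le:
  fixes g :: "'a::euclidean_space \<Rightarrow> complex"
  assumes [measurable]: "g \<in> borel_measurable borel"
  shows "(\<integral>\<^sup>+\<eta>. ennreal (cmod (g \<eta>) * cmod (gauss_average \<epsilon> g \<eta>)) \<partial>lborel) \<le> L2_sq g"
proof -
  define C where "C = gauss_mass TYPE('a)"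
  have C: "C > 0" by (simp add: C_def gauss_mass_pos)
  have "(\<integral>\<^sup>+\<eta>. ennreal (cmod (g \<eta>) * cmod (gauss_average \<epsilon> g \<eta>)) \<partial>lborel)
      \<le> (\<integral>\<^sup>+\<eta>. \<integral>\<^sup>+y. ennreal (gauss y / C) * ennreal (cmod (g \<eta>) * cmod (g (\<eta> - \<epsilon> *\<^sub>R y))) \<partial>lborel \<partial>lborel)"
  proof (rule nn_integral_mono)
    fix \<eta> :: 'a
    have "cmod (g \<eta>) * cmod (gauss_average \<epsilon> g \<eta>) = cmod (g \<eta>) / C * cmod (\<integral>y. of_real (gauss y) * g (\<eta> - \<epsilon> *\<^sub>R y) \<partial>lborel)"
      using C by (simp add: gauss_average_def C_def norm_divide)
    then have "ennreal (cmod (g \<eta>) * cmod (gauss_average \<epsilon> g \<eta>))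
        = ennreal (cmod (g \<eta>) / C) * ennreal (cmod (\<integral>y. of_real (gauss y) * g (\<eta> - \<epsilon> *\<^sub>R y) \<partial>lborel))"
      using C by (simp flip: ennreal_mult)
    also have "\<dots> \<le> ennreal (cmod (g \<eta>) / C) * (\<integral>\<^sup>+y. ennreal (cmod (of_real (gauss y) * g (\<eta> - \<epsilon> *\<^sub>R y))) \<partial>lborel)"
      by (intro mult_left_mono ennreal_norm_integral_le) simp
    also have "\<dots> = (\<integral>\<^sup>+y. ennreal (cmod (g \<eta>) / C) * ennreal (cmod (of_real (gauss y) * g (\<eta> - \<epsilon> *\<^sub>R y))) \<partial>lborel)"
      by (rule nn_integral_cmult[symmetric]) measurable
    also have "\<dots> = (\<integral>\<^sup>+y. ennreal (gauss y / C) * ennreal (cmod (g \<eta>) * cmod (g (\<eta> - \<epsilon> *\<^sub>R y))) \<partial>lborel)"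
      using C gauss_pos[where 'a='a, THEN less_imp_le]
      by (intro nn_integral_cong) (simp add: norm_mult mult_ac flip: ennreal_mult)
    finally show "ennreal (cmod (g \<eta>) * cmod (gauss_average \<epsilon> g \<eta>))
      \<le> (\<integral>\<^sup>+y. ennreal (gauss y / C) * ennreal (cmod (g \<eta>) * cmod (g (\<eta> - \<epsilon> *\<^sub>R y))) \<partial>lborel)" .
  qed
  also have "\<dots> = (\<integral>\<^sup>+y. \<integral>\<^sup>+\<eta>. ennreal (gauss y / C) * ennreal (cmod (g \<eta>) * cmod (g (\<eta> - \<epsilon> *\<^sub>R y))) \<partial>lborel \<partial>lborel)"
    by (rule lborel_pair.Fubini') measurable
  also have "\<dots> \<le> (\<integral>\<^sup>+y. ennreal (gauss (y::'a) / C) * L2_sq g \<partial>lborel)"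
  proof (rule nn_integral_mono)
    fix y :: 'a
    have le: "cmod (g \<eta>) * cmod (g (\<eta> - \<epsilon> *\<^sub>R y)) \<le> 1/2 * (cmod (g \<eta>))\<^sup>2 + 1/2 * (cmod (g (\<eta> - \<epsilon> *\<^sub>R y)))\<^sup>2" for \<eta>
      using zero_le_power2[of "cmod (g \<eta>) - cmod (g (\<eta> - \<epsilon> *\<^sub>R y))"] by (simp add: power2_diff)
    have "(\<integral>\<^sup>+\<eta>. ennreal (cmod (g \<eta>) * cmod (g (\<eta> - \<epsilon> *\<^sub>R y))) \<partial>lborel)
       \<le> (\<integral>\<^sup>+\<eta>. ennreal (1/2) * ennreal ((cmod (g \<eta>))\<^sup>2) + ennreal (1/2) * ennreal ((cmod (g (\<eta> - \<epsilon> *\<^sub>R y)))\<^sup>2) \<partial>lborel)"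
    proof (rule nn_integral_mono)
      fix \<eta>
      have "ennreal (1/2 * (cmod (g \<eta>))\<^sup>2 + 1/2 * (cmod (g (\<eta> - \<epsilon> *\<^sub>R y)))\<^sup>2)
         = ennreal (1/2) * ennreal ((cmod (g \<eta>))\<^sup>2) + ennreal (1/2) * ennreal ((cmod (g (\<eta> - \<epsilon> *\<^sub>R y)))\<^sup>2)"
        by (simp only: ennreal_plus[OF mult_nonneg_nonneg mult_nonneg_nonneg] ennreal_mult zero_le_power2
            zero_le_divide_1_iff zero_le_numeral)
      then show "ennreal (cmod (g \<eta>) * cmod (g (\<eta> - \<epsilon> *\<^sub>R y)))
         \<le> ennreal (1/2) * ennreal ((cmod (g \<eta>))\<^sup>2) + ennreal (1/2) * ennreal ((cmod (g (\<eta> - \<epsilon> *\<^sub>R y)))\<^sup>2)"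
        using ennreal_leI[OF le[of \<eta>]] by (simp only:)
    qed
    also have "\<dots> = ennreal (1/2) * L2_sq g + ennreal (1/2) * (\<integral>\<^sup>+\<eta>. ennreal ((cmod (g (\<eta> - \<epsilon> *\<^sub>R y)))\<^sup>2) \<partial>lborel)"
      by (simp add: nn_integral_add nn_integral_cmult L2_sq_def)
    also have "(\<integral>\<^sup>+\<eta>. ennreal ((cmod (g (\<eta> - \<epsilon> *\<^sub>R y)))\<^sup>2) \<partial>lborel) = L2_sq g"
      unfolding L2_sq_def by (rule nn_integral_lborel_shift) measurable
    also have "ennreal (1/2) * L2_sq g + ennreal (1/2) * L2_sq g = L2_sq g"
    proof -
      have "ennreal (1/2) + ennreal (1/2) = ennreal (1/2 + 1/2)" by (rule ennreal_plus[symmetric]) simp_all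
      also have "\<dots> = 1" by simp
      finally show ?thesis by (simp only: distrib_right[symmetric] mult_1_left)
    qed
    finally have *: "(\<integral>\<^sup>+\<eta>. ennreal (cmod (g \<eta>) * cmod (g (\<eta> - \<epsilon> *\<^sub>R y))) \<partial>lborel) \<le> L2_sq g" .
    then show "(\<integral>\<^sup>+\<eta>. ennreal (gauss y / C) * ennreal (cmod (g \<eta>) * cmod (g (\<eta> - \<epsilon> *\<^sub>R y))) \<partial>lborel) \<le> ennreal (gauss y / C) * L2_sq g"
      by (subst nn_integral_cmult) (auto intro: mult_left_mono)
  qed
  also have "\<dots> = (\<integral>\<^sup>+y. ennreal (gauss (y::'a) / C) \<partial>lborel) * L2_sq g"
    by (rule nn_integral_multc) measurable
  also have "(\<integral>\<^sup>+y. ennreal (gauss (y::'a) / C) \<partial>lborel) = 1"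
    using C gauss_pos[where 'a='a, THEN less_imp_le]
    by (simp add: divide_ennreal[symmetric] nn_integral_divide nn_integral_gauss C_def[symmetric])
  finally show ?thesis by simp
qed

text \<open>One of the two factors \<open>inv_fourier g\<close> is conjugated and written out as an
  integral, which contributes the constant. The multiplication formula then moves this transform
  onto \<open>mollified \<epsilon> g\<close>, where it yields the Gaussian average of
  \<open>g\<close>, and the pairing with \<open>g\<close> has been bounded.\<close>

lemma mollified_L2_bound:
  fixes g :: "'a::euclidean_space \<Rightarrow> complex"
  assumes g: "integrable lborel g" and e: "\<epsilon> > 0"
  shows "(\<integral>\<^sup>+x. ennreal (gauss (\<epsilon> *\<^sub>R x) * (cmod (inv_fourier g x))\<^sup>2) \<partial>lborel)
    \<le> ennreal (1 / (gauss_mass TYPE('a))\<^sup>2) * L2_sq g"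
proof -
  have [measurable]: "g \<in> borel_measurable borel" using g by auto
  define A where "A = (gauss_mass TYPE('a))\<^sup>2"
  have A: "A > 0" using gauss_mass_pos[where 'a='a] by (simp add: A_def)
  have cg: "integrable lborel (\<lambda>\<eta>. cnj (g \<eta>))" using g by simp
  have eq: "of_real (gauss (\<epsilon> *\<^sub>R x) * (cmod (inv_fourier g x))\<^sup>2)
      = mollified \<epsilon> g x * (\<integral>\<eta>. cnj (g \<eta>) * exp (- \<i> * of_real (x \<bullet> \<eta>)) \<partial>lborel) / of_real A" for x
  proof -
    have "cnj (inv_fourier g x) = (\<integral>\<eta>. cnj (g \<eta>) * exp (- \<i> * of_real (x \<bullet> \<eta>)) \<partial>lborel) / of_real A"
      by (simp add: inv_fourier_def A_def[symmetric] Bochner_Integration.integral_cnj[symmetric] exp_cnj)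
    moreover have "of_real (gauss (\<epsilon> *\<^sub>R x) * (cmod (inv_fourier g x))\<^sup>2) = mollified \<epsilon> g x * cnj (inv_fourier g x)"
      by (simp only: mollified_def of_real_mult complex_norm_square mult.assoc)
    ultimately show ?thesis by simp
  qed
  have int: "integrable lborel (\<lambda>x. gauss (\<epsilon> *\<^sub>R x) * (cmod (inv_fourier g x))\<^sup>2)"
  proof (rule Bochner_Integration.integrable_bound[OF integrable_mult_left[OF integrable_gauss_scaled[OF e]]])
    show "AE x in lborel. norm (gauss (\<epsilon> *\<^sub>R x) * (cmod (inv_fourier g x))\<^sup>2)
      \<le> norm (gauss (\<epsilon> *\<^sub>R x) * ((\<integral>\<eta>. cmod (g \<eta>) \<partial>lborel) / (gauss_mass TYPE('a))\<^sup>2)\<^sup>2)"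
      unfolding norm_mult by (intro AE_I2 mult_left_mono) (auto intro!: power_mono inv_fourier_bound g simp del: power_divide)
  qed measurable
  have "(\<integral>\<^sup>+x. ennreal (gauss (\<epsilon> *\<^sub>R x) * (cmod (inv_fourier g x))\<^sup>2) \<partial>lborel)
      = ennreal (\<integral>x. gauss (\<epsilon> *\<^sub>R x) * (cmod (inv_fourier g x))\<^sup>2 \<partial>lborel)"
    using gauss_pos[where 'a='a, THEN less_imp_le] by (intro nn_integral_eq_integral int) auto
  also have "\<dots> \<le> ennreal (cmod (\<integral>x. of_real (gauss (\<epsilon> *\<^sub>R x) * (cmod (inv_fourier g x))\<^sup>2) \<partial>lborel))"
    unfolding integral_complex_of_real by (intro ennreal_leI) simp
  also have "(\<integral>x. of_real (gauss (\<epsilon> *\<^sub>R x) * (cmod (inv_fourier g x))\<^sup>2) \<partial>lborel)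
      = (\<integral>x. mollified \<epsilon> g x * (\<integral>\<eta>. cnj (g \<eta>) * exp (- \<i> * of_real (x \<bullet> \<eta>)) \<partial>lborel) \<partial>lborel) / of_real A"
    unfolding eq by (rule integral_divide_zero)
  also have "(\<integral>x. mollified \<epsilon> g x * (\<integral>\<eta>. cnj (g \<eta>) * exp (- \<i> * of_real (x \<bullet> \<eta>)) \<partial>lborel) \<partial>lborel)
      = (\<integral>\<eta>. cnj (g \<eta>) * (\<integral>x. mollified \<epsilon> g x * exp (- \<i> * of_real (x \<bullet> \<eta>)) \<partial>lborel) \<partial>lborel)"
    by (rule integral_kernel_swap[OF integrable_mollified[OF g e] cg]; measurable?; simp)
  also have "\<dots> = (\<integral>\<eta>. cnj (g \<eta>) * gauss_average \<epsilon> g \<eta> \<partial>lborel)"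
    by (simp only: fourier_mollified[OF g e])
  also have "ennreal (cmod ((\<integral>\<eta>. cnj (g \<eta>) * gauss_average \<epsilon> g \<eta> \<partial>lborel) / of_real A))
      = ennreal (1 / A) * ennreal (cmod (\<integral>\<eta>. cnj (g \<eta>) * gauss_average \<epsilon> g \<eta> \<partial>lborel))"
    using A by (simp add: norm_divide flip: ennreal_mult)
  also have "\<dots> \<le> ennreal (1 / A) * (\<integral>\<^sup>+\<eta>. ennreal (cmod (cnj (g \<eta>) * gauss_average \<epsilon> g \<eta>)) \<partial>lborel)"
    by (intro mult_left_mono ennreal_norm_integral_le) simp
  also have "\<dots> \<le> ennreal (1 / A) * L2_sq g"
    using gauss_average_pairing_le[of g \<epsilon>] by (intro mult_left_mono) (auto simp: norm_mult)
  finally show ?thesis unfolding A_def .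
qed

lemma gauss_scaled_tendsto: "e \<longlonglongrightarrow> 0 \<Longrightarrow> (\<lambda>n. gauss (e n *\<^sub>R x)) \<longlonglongrightarrow> 1"
proof -
  assume "e \<longlonglongrightarrow> 0"
  then have "(\<lambda>n. e n *\<^sub>R x) \<longlonglongrightarrow> 0 *\<^sub>R x" by (intro tendsto_intros)
  moreover have "isCont gauss (0 *\<^sub>R x)"
    using continuous_on_interior[OF continuous_gauss] by (metis interior_UNIV UNIV_I)
  ultimately have "(\<lambda>n. gauss (e n *\<^sub>R x)) \<longlonglongrightarrow> gauss (0 *\<^sub>R x)" by (rule isCont_tendsto_compose[rotated])
  then show ?thesis by simp
qed

text \<open>Fatou's lemma removes the damping. This is one inequality of Plancherel's theorem, with
  its constant 1/(2 pi)^n.\<close>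

lemma inv_fourier_L2_bound:
  fixes g :: "'a::euclidean_space \<Rightarrow> complex"
  assumes g: "integrable lborel g"
  shows "L2_sq (inv_fourier g) \<le> ennreal (1 / (gauss_mass TYPE('a))\<^sup>2) * L2_sq g"
proof -
  have [measurable]: "g \<in> borel_measurable borel" using g by auto
  define e where "e n = inverse (real (Suc n))" for n
  have e0: "e \<longlonglongrightarrow> 0" unfolding e_def by (rule LIMSEQ_inverse_real_of_nat)
  have "L2_sq (inv_fourier g) = (\<integral>\<^sup>+x. liminf (\<lambda>n. ennreal (gauss (e n *\<^sub>R x) * (cmod (inv_fourier g x))\<^sup>2)) \<partial>lborel)"
    unfolding L2_sq_def
  proof (rule nn_integral_cong)
    fix x
    have "(\<lambda>n. ennreal (gauss (e n *\<^sub>R x) * (cmod (inv_fourier g x))\<^sup>2)) \<longlonglongrightarrow> ennreal (1 * (cmod (inv_fourier g x))\<^sup>2)"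
      by (intro tendsto_ennrealI tendsto_mult tendsto_const gauss_scaled_tendsto e0)
    from lim_imp_Liminf[OF _ this]
    show "ennreal ((cmod (inv_fourier g x))\<^sup>2) = liminf (\<lambda>n. ennreal (gauss (e n *\<^sub>R x) * (cmod (inv_fourier g x))\<^sup>2))"
      by simp
  qed
  also have "\<dots> \<le> liminf (\<lambda>n. \<integral>\<^sup>+x. ennreal (gauss (e n *\<^sub>R x) * (cmod (inv_fourier g x))\<^sup>2) \<partial>lborel)"
    by (rule nn_integral_liminf) measurable
  also have "\<dots> \<le> ennreal (1 / (gauss_mass TYPE('a))\<^sup>2) * L2_sq g"
    by (intro Liminf_le always_eventually allI mollified_L2_bound g) (auto simp: e_def)
  finally show ?thesis .
qed

text \<open>Both \<open>g\<close> and its average are bounded by \<open>K\<close>, so the squared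
  difference is at most 2K times the difference, and L1 convergence suffices.\<close>

lemma gauss_average_L2_tendsto:
  fixes g :: "'a::euclidean_space \<Rightarrow> complex"
  assumes g: "integrable lborel g" and K: "\<And>x. cmod (g x) \<le> K" and e: "e \<longlonglongrightarrow> 0"
  shows "(\<lambda>n. L2_sq (\<lambda>\<xi>. gauss_average (e n) g \<xi> - g \<xi>)) \<longlonglongrightarrow> 0"
proof -
  have [measurable]: "g \<in> borel_measurable borel" using g by auto
  have K0: "0 \<le> K" using K[of 0] norm_ge_zero order_trans by blast
  define C where "C = gauss_mass TYPE('a)"
  have C: "C > 0" by (simp add: C_def gauss_mass_pos)
  define I where "I n \<xi> = (\<integral>\<^sup>+y. ennreal (gauss y) * ennreal (norm (g (\<xi> - e n *\<^sub>R y) - g \<xi>)) \<partial>lborel)" for n \<xi>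
  have I[measurable]: "I n \<in> borel_measurable borel" for n unfolding I_def by measurable
  have lim: "(\<lambda>n. \<integral>\<^sup>+\<xi>. I n \<xi> \<partial>lborel) \<longlonglongrightarrow> 0"
    unfolding I_def by (rule gauss_average_L1_tendsto[OF g e])
  have sq: "ennreal ((cmod (gauss_average (e n) g \<xi> - g \<xi>))\<^sup>2) \<le> ennreal (2 * K / C) * I n \<xi>" for n \<xi>
  proof -
    have nonneg: "0 \<le> gauss y" for y :: 'a by (rule less_imp_le[OF gauss_pos])
    have int: "integrable lborel (\<lambda>y. of_real (gauss y) * g (\<xi> - e n *\<^sub>R y))"
    proof (rule Bochner_Integration.integrable_bound[OF integrable_mult_left[OF integrable_gauss]])
      show "AE y in lborel. norm (of_real (gauss y) * g (\<xi> - e n *\<^sub>R y)) \<le> norm (gauss y * K)"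
        using K K0 by (intro AE_I2) (simp add: norm_mult abs_mult mult_left_mono)
    qed measurable
    have int2: "integrable lborel (\<lambda>y::'a. of_real (gauss y) * g \<xi>)"
      using integrable_gauss by (intro integrable_mult_left integrable_of_real)
    have "(\<integral>y. of_real (gauss y) * (g (\<xi> - e n *\<^sub>R y) - g \<xi>) \<partial>lborel)
       = (\<integral>y. of_real (gauss y) * g (\<xi> - e n *\<^sub>R y) \<partial>lborel) - (\<integral>y. of_real (gauss (y::'a)) * g \<xi> \<partial>lborel)"
      by (simp only: right_diff_distrib Bochner_Integration.integral_diff[OF int int2])
    moreover have "(\<integral>y. of_real (gauss (y::'a)) * g \<xi> \<partial>lborel) = of_real C * g \<xi>"
      by (simp only: integral_mult_left_zero integral_complex_of_real integral_gauss C_def)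
    ultimately have int_diff: "(\<integral>y. of_real (gauss y) * (g (\<xi> - e n *\<^sub>R y) - g \<xi>) \<partial>lborel)
       = (\<integral>y. of_real (gauss y) * g (\<xi> - e n *\<^sub>R y) \<partial>lborel) - of_real C * g \<xi>" by (simp only:)
    have diff: "gauss_average (e n) g \<xi> - g \<xi> = (\<integral>y. of_real (gauss y) * (g (\<xi> - e n *\<^sub>R y) - g \<xi>) \<partial>lborel) / of_real C"
      unfolding int_diff gauss_average_def C_def[symmetric] using C by (simp add: diff_divide_distrib)
    have "ennreal (cmod (gauss_average (e n) g \<xi> - g \<xi>))
        = ennreal (1 / C) * ennreal (cmod (\<integral>y. of_real (gauss y) * (g (\<xi> - e n *\<^sub>R y) - g \<xi>) \<partial>lborel))"
      unfolding diff using C by (simp add: norm_divide flip: ennreal_mult)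
    also have "\<dots> \<le> ennreal (1 / C) * (\<integral>\<^sup>+y. ennreal (cmod (of_real (gauss y) * (g (\<xi> - e n *\<^sub>R y) - g \<xi>))) \<partial>lborel)"
      by (intro mult_left_mono ennreal_norm_integral_le) simp
    also have "(\<integral>\<^sup>+y. ennreal (cmod (of_real (gauss y) * (g (\<xi> - e n *\<^sub>R y) - g \<xi>))) \<partial>lborel) = I n \<xi>"
      unfolding I_def by (intro nn_integral_cong) (simp add: norm_mult nonneg ennreal_mult)
    finally have 1: "ennreal (cmod (gauss_average (e n) g \<xi> - g \<xi>)) \<le> ennreal (1 / C) * I n \<xi>" .
    have "cmod (\<integral>y. of_real (gauss y) * g (\<xi> - e n *\<^sub>R y) \<partial>lborel) \<le> (\<integral>y. gauss (y::'a) * K \<partial>lborel)"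
    proof (rule order_trans[OF integral_norm_bound])
      show "(\<integral>y. norm (of_real (gauss y) * g (\<xi> - e n *\<^sub>R y)) \<partial>lborel) \<le> (\<integral>y. gauss (y::'a) * K \<partial>lborel)"
        using K by (intro integral_mono integrable_norm[OF int] integrable_mult_left integrable_gauss)
          (auto simp: norm_mult nonneg intro!: mult_left_mono)
    qed
    then have "cmod (gauss_average (e n) g \<xi>) \<le> K"
      using C by (simp add: gauss_average_def norm_divide C_def[symmetric] integral_gauss field_simps)
    then have 2: "cmod (gauss_average (e n) g \<xi> - g \<xi>) \<le> 2 * K"
      using norm_triangle_ineq4[of "gauss_average (e n) g \<xi>" "g \<xi>"] K[of \<xi>] by linarith
    have "ennreal ((cmod (gauss_average (e n) g \<xi> - g \<xi>))\<^sup>2)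
        = ennreal (cmod (gauss_average (e n) g \<xi> - g \<xi>)) * ennreal (cmod (gauss_average (e n) g \<xi> - g \<xi>))"
      by (simp add: power2_eq_square ennreal_mult)
    also have "\<dots> \<le> ennreal (2 * K) * (ennreal (1 / C) * I n \<xi>)"
      by (intro mult_mono 1 ennreal_leI 2) auto
    also have "\<dots> = ennreal (2 * K / C) * I n \<xi>"
      using C K0 by (simp add: mult.assoc[symmetric] flip: ennreal_mult)
    finally show ?thesis .
  qed
  have le: "L2_sq (\<lambda>\<xi>. gauss_average (e n) g \<xi> - g \<xi>) \<le> ennreal (2 * K / C) * (\<integral>\<^sup>+\<xi>. I n \<xi> \<partial>lborel)" for n
    unfolding L2_sq_def by (subst nn_integral_cmult[symmetric]) (auto intro!: nn_integral_mono sq)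
  have "(\<lambda>n. ennreal (2 * K / C) * (\<integral>\<^sup>+\<xi>. I n \<xi> \<partial>lborel)) \<longlonglongrightarrow> ennreal (2 * K / C) * 0"
    by (intro ennreal_tendsto_cmult lim) simp
  then have lim2: "(\<lambda>n. ennreal (2 * K / C) * (\<integral>\<^sup>+\<xi>. I n \<xi> \<partial>lborel)) \<longlonglongrightarrow> 0" by (simp only: mult_zero_right)
  show ?thesis
    by (rule tendsto_sandwich[OF _ _ tendsto_const lim2]) (auto simp: le)
qed

text \<open>The damping changes \<open>inv_fourier g\<close> by a factor of modulus at most 1 that
  tends to 0; the Plancherel bound makes the square of \<open>inv_fourier g\<close> an integrable
  majorant.\<close>

lemma mollified_L2_tendsto:
  fixes g :: "'a::euclidean_space \<Rightarrow> complex"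
  assumes g: "integrable lborel g" and L2: "L2_sq g < \<infinity>" and e: "e \<longlonglongrightarrow> 0"
  shows "(\<lambda>n. L2_sq (\<lambda>x. mollified (e n) g x - inv_fourier g x)) \<longlonglongrightarrow> 0"
proof -
  have [measurable]: "g \<in> borel_measurable borel" using g by auto
  have "(\<lambda>n. L2_sq (\<lambda>x. mollified (e n) g x - inv_fourier g x)) \<longlonglongrightarrow> (\<integral>\<^sup>+(x::'a). 0 \<partial>lborel)"
    unfolding L2_sq_def
  proof (rule nn_integral_dominated_convergence[where w = "\<lambda>x. ennreal ((cmod (inv_fourier g x))\<^sup>2)"])
    have "L2_sq (inv_fourier g) < \<infinity>"
      by (rule order_le_less_trans[OF inv_fourier_L2_bound[OF g]]) (use L2 in \<open>simp add: ennreal_mult_less_top\<close>)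
    then show "(\<integral>\<^sup>+x. ennreal ((cmod (inv_fourier g x))\<^sup>2) \<partial>lborel) < \<infinity>" by (simp add: L2_sq_def)
    have eq: "mollified (e n) g x - inv_fourier g x = of_real (gauss (e n *\<^sub>R x) - 1) * inv_fourier g x" for n and x :: 'a
      by (simp add: mollified_def algebra_simps)
    show "AE x in lborel. ennreal ((cmod (mollified (e n) g x - inv_fourier g x))\<^sup>2) \<le> ennreal ((cmod (inv_fourier g x))\<^sup>2)" for n
    proof (intro AE_I2 ennreal_leI power_mono)
      fix x :: 'a
      have "\<bar>gauss (e n *\<^sub>R x) - 1\<bar> \<le> 1" using gauss_pos[of "e n *\<^sub>R x"] gauss_le_1[of "e n *\<^sub>R x"] by linarith
      then show "cmod (mollified (e n) g x - inv_fourier g x) \<le> cmod (inv_fourier g x)"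
        unfolding eq norm_mult norm_of_real by (intro mult_left_le_one_le) auto
    qed simp
    show "AE x in lborel. (\<lambda>n. ennreal ((cmod (mollified (e n) g x - inv_fourier g x))\<^sup>2)) \<longlonglongrightarrow> 0"
    proof (rule AE_I2)
      fix x :: 'a
      have "(\<lambda>n. (cmod (of_real (gauss (e n *\<^sub>R x) - 1) * inv_fourier g x))\<^sup>2) \<longlonglongrightarrow> (cmod (of_real (1 - 1) * inv_fourier g x))\<^sup>2"
        by (intro tendsto_intros gauss_scaled_tendsto e)
      from tendsto_ennrealI[OF this]
      show "(\<lambda>n. ennreal ((cmod (mollified (e n) g x - inv_fourier g x))\<^sup>2)) \<longlonglongrightarrow> 0"
        unfolding eq by simp
    qed
  qed measurable
  then show ?thesis by simp
qed

text \<open>Cutting off far points together with large values makes the function bounded and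
  integrable at once; the error is dominated by |g|^2.\<close>

lemma L2_truncation:
  fixes g :: "'a::euclidean_space \<Rightarrow> complex"
  assumes g[measurable]: "g \<in> borel_measurable borel" and L2: "L2_sq g < \<infinity>" and e: "(0::real) < e"
  obtains h K where "integrable lborel h" "\<And>x. cmod (h x) \<le> K" "L2_sq h < \<infinity>" "L2_sq (\<lambda>x. h x - g x) \<le> ennreal e"
proof -
  define T where "T n = {x. norm x \<le> real n \<and> cmod (g x) \<le> real n}" for n
  have T[measurable]: "T n \<in> sets borel" for n unfolding T_def by measurable
  define h where "h n x = (if x \<in> T n then g x else 0)" for n x
  have [measurable]: "h n \<in> borel_measurable borel" for n unfolding h_def by measurable
  have "(\<lambda>n. L2_sq (\<lambda>x. h n x - g x)) \<longlonglongrightarrow> (\<integral>\<^sup>+(x::'a). 0 \<partial>lborel)"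
    unfolding L2_sq_def
  proof (rule nn_integral_dominated_convergence[where w = "\<lambda>x. ennreal ((cmod (g x))\<^sup>2)"])
    show "AE x in lborel. (\<lambda>n. ennreal ((cmod (h n x - g x))\<^sup>2)) \<longlonglongrightarrow> 0"
    proof (intro AE_I2 tendsto_eventually)
      fix x
      obtain N where N: "max (norm x) (cmod (g x)) \<le> real N" using real_arch_simple by blast
      show "\<forall>\<^sub>F n in sequentially. ennreal ((cmod (h n x - g x))\<^sup>2) = 0"
        using eventually_ge_at_top[of N]
      proof eventually_elim
        case (elim n)
        then have "x \<in> T n" using N by (auto simp: T_def)
        then show ?case by (simp add: h_def)
      qed
    qed
  qed (use L2 in \<open>auto simp: h_def L2_sq_def\<close>)
  then have "(\<lambda>n. L2_sq (\<lambda>x. h n x - g x)) \<longlonglongrightarrow> 0" by simp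
  from ennreal_tendsto_0D[OF this e] obtain n where n: "L2_sq (\<lambda>x. h n x - g x) \<le> ennreal e"
    by (auto simp: eventually_sequentially)
  have bound: "cmod (h n x) \<le> real n" for x by (simp add: h_def T_def)
  have int: "integrable lborel (\<lambda>x. real n * indicator (cball (0::'a) (real n)) x)"
    using emeasure_lborel_cball_finite[of "0::'a" "real n"]
    by (intro integrable_mult_right integrable_real_indicator) simp_all
  have "integrable lborel (h n)"
    by (rule Bochner_Integration.integrable_bound[OF int]) (auto simp: h_def T_def indicator_def)
  moreover have "L2_sq (h n) \<le> L2_sq g"
    unfolding L2_sq_def by (intro nn_integral_mono) (simp add: h_def)
  then have "L2_sq (h n) < \<infinity>" using L2 by (rule order_le_less_trans)
  ultimately show ?thesis using bound n by (intro that[of "h n" "real n"])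
qed

text \<open>The truncations \<open>h m\<close> approximate \<open>g\<close>. Their inverse
  transforms \<open>v m\<close> inherit the rate of convergence through the Plancherel bound, and
  their limit is \<phi>. The \<open>v m\<close> need not be integrable, so they are replaced by
  damped versions \<open>u m\<close>, whose transforms are averages of \<open>h m\<close> and hence
  still tend to \<open>g\<close>.\<close>

theorem fourier_L2_surj:
  fixes g :: "real^'n \<Rightarrow> complex"
  assumes "in_L2 g"
  obtains \<phi> where "fourier_L2 \<phi> g"
proof -
  have g[measurable]: "g \<in> borel_measurable borel" and L2: "L2_sq g < \<infinity>"
    using assms by (auto simp: in_L2_iff)
  define A where "A = 1 / (gauss_mass TYPE(real^'n))\<^sup>2"
  have A: "0 \<le> A" by (simp add: A_def)
  \<comment> \<open>The rate 1/4 is the one that \<open>L2_fast_Cauchy_limit\<close>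
    consumes.\<close>
  have "\<exists>h K. integrable lborel h \<and> (\<forall>x. cmod (h x) \<le> K) \<and> L2_sq h < \<infinity> \<and> L2_sq (\<lambda>x. h x - g x) \<le> ennreal ((1/4) ^ m)" for m :: nat
    using L2_truncation[OF g L2, of "(1/4) ^ m"] by (metis zero_less_divide_1_iff zero_less_numeral zero_less_power)
  then obtain h K where h: "\<And>m. integrable lborel (h m)" "\<And>m x. cmod (h m x) \<le> K m" "\<And>m. L2_sq (h m) < \<infinity>"
    "\<And>m. L2_sq (\<lambda>x. h m x - g x) \<le> ennreal ((1/4) ^ m)" by metis
  have [measurable]: "h m \<in> borel_measurable borel" for m using h(1)[of m] by auto
  define v where "v m = inv_fourier (h m)" for m
  have v[measurable]: "v m \<in> borel_measurable borel" for m unfolding v_def by measurable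
  \<comment> \<open>The 4 is 2 + 2 from comparing both truncations with \<open>g\<close>;
    \<open>A\<close> is the Plancherel constant.\<close>
  have "L2_sq (\<lambda>x. v l x - v m x) \<le> ennreal (4 * A * (1/4) ^ m)" if "m \<le> l" for m l
  proof -
    have "L2_sq (\<lambda>\<xi>. h l \<xi> - h m \<xi>) \<le> 2 * L2_sq (\<lambda>\<xi>. h l \<xi> - g \<xi>) + 2 * L2_sq (\<lambda>\<xi>. g \<xi> - h m \<xi>)"
      by (rule L2_sq_diff_le) measurable
    also have "\<dots> \<le> 2 * ennreal ((1/4) ^ m) + 2 * ennreal ((1/4) ^ m)"
    proof (intro add_mono mult_left_mono)
      have "L2_sq (\<lambda>\<xi>. h l \<xi> - g \<xi>) \<le> ennreal ((1/4) ^ l)" by (rule h(4))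
      also have "\<dots> \<le> ennreal ((1/4) ^ m)" using that by (intro ennreal_leI power_decreasing) auto
      finally show "L2_sq (\<lambda>\<xi>. h l \<xi> - g \<xi>) \<le> ennreal ((1/4) ^ m)" .
      show "L2_sq (\<lambda>\<xi>. g \<xi> - h m \<xi>) \<le> ennreal ((1/4) ^ m)" using h(4) by (subst L2_sq_minus_commute)
    qed auto
    also have "\<dots> = ennreal (4 * (1/4) ^ m)"
      by (simp add: ennreal_mult distrib_right[symmetric])
    finally have h_le: "L2_sq (\<lambda>\<xi>. h l \<xi> - h m \<xi>) \<le> ennreal (4 * (1/4) ^ m)" .
    have "L2_sq (\<lambda>x. v l x - v m x) = L2_sq (inv_fourier (\<lambda>\<xi>. h l \<xi> - h m \<xi>))"
      unfolding v_def by (intro arg_cong[where f = L2_sq] ext inv_fourier_diff[symmetric] h)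
    also have "\<dots> \<le> ennreal A * L2_sq (\<lambda>\<xi>. h l \<xi> - h m \<xi>)"
      unfolding A_def by (intro inv_fourier_L2_bound Bochner_Integration.integrable_diff h)
    also have "\<dots> \<le> ennreal A * ennreal (4 * (1/4) ^ m)" by (rule mult_left_mono[OF h_le]) simp
    also have "\<dots> = ennreal (4 * A * (1/4) ^ m)" using A by (simp add: mult_ac flip: ennreal_mult)
    finally show ?thesis .
  qed
  then obtain \<phi> where \<phi>[measurable]: "\<phi> \<in> borel_measurable borel" and v\<phi>: "(\<lambda>m. L2_sq (\<lambda>x. v m x - \<phi> x)) \<longlonglongrightarrow> 0"
    by (rule L2_fast_Cauchy_limit[OF v, rotated]) (use A in auto)
  define e where "e n = inverse (real (Suc n))" for n
  have e: "e \<longlonglongrightarrow> 0" unfolding e_def by (rule LIMSEQ_inverse_real_of_nat)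
  have e_pos: "e n > 0" for n by (simp add: e_def)
  \<comment> \<open>One damping parameter has to serve on both sides, for \<open>v m\<close> and for
    its transform; both estimates hold for all large \<open>n\<close>, so a common one
    exists.\<close>
  have "\<exists>n. L2_sq (\<lambda>x. mollified (e n) (h m) x - v m x) \<le> ennreal ((1/4) ^ m) \<and>
      L2_sq (\<lambda>\<xi>. gauss_average (e n) (h m) \<xi> - h m \<xi>) \<le> ennreal ((1/4) ^ m)" for m
  proof -
    have "eventually (\<lambda>n. L2_sq (\<lambda>x. mollified (e n) (h m) x - v m x) \<le> ennreal ((1/4) ^ m)) sequentially"
      unfolding v_def by (intro ennreal_tendsto_0D mollified_L2_tendsto h e) simp
    moreover have "eventually (\<lambda>n. L2_sq (\<lambda>\<xi>. gauss_average (e n) (h m) \<xi> - h m \<xi>) \<le> ennreal ((1/4) ^ m)) sequentially"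
      by (intro ennreal_tendsto_0D gauss_average_L2_tendsto[OF h(1) h(2)] e) simp
    ultimately have "eventually (\<lambda>n. L2_sq (\<lambda>x. mollified (e n) (h m) x - v m x) \<le> ennreal ((1/4) ^ m) \<and>
      L2_sq (\<lambda>\<xi>. gauss_average (e n) (h m) \<xi> - h m \<xi>) \<le> ennreal ((1/4) ^ m)) sequentially"
      by (rule eventually_conj)
    then show ?thesis by (auto simp: eventually_sequentially)
  qed
  then obtain r where r: "\<And>m. L2_sq (\<lambda>x. mollified (e (r m)) (h m) x - v m x) \<le> ennreal ((1/4) ^ m)"
    "\<And>m. L2_sq (\<lambda>\<xi>. gauss_average (e (r m)) (h m) \<xi> - h m \<xi>) \<le> ennreal ((1/4) ^ m)" by metis
  define u where "u m = mollified (e (r m)) (h m)" for m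
  have u[measurable]: "u m \<in> borel_measurable borel" for m unfolding u_def by measurable
  have u_int: "integrable lborel (u m)" for m unfolding u_def by (intro integrable_mollified h e_pos)
  have fu: "fourier_L1 (u m) = gauss_average (e (r m)) (h m)" for m
    unfolding fourier_L1_def u_def by (intro ext fourier_mollified h e_pos)
  have quarter: "(\<lambda>m. ennreal ((1/4) ^ m)) \<longlonglongrightarrow> 0"
    using tendsto_ennrealI[OF LIMSEQ_realpow_zero[of "1/4::real"]] by simp
  have "(\<lambda>m. 2 * ennreal ((1/4) ^ m) + 2 * L2_sq (\<lambda>x. v m x - \<phi> x)) \<longlonglongrightarrow> 2 * 0 + 2 * 0"
    by (intro tendsto_add ennreal_tendsto_cmult quarter v\<phi>) auto
  then have lim1: "(\<lambda>m. 2 * ennreal ((1/4) ^ m) + 2 * L2_sq (\<lambda>x. v m x - \<phi> x)) \<longlonglongrightarrow> 0"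
    by (simp only: mult_zero_right add_0_left)
  have "L2_sq (\<lambda>x. u m x - \<phi> x) \<le> 2 * ennreal ((1/4) ^ m) + 2 * L2_sq (\<lambda>x. v m x - \<phi> x)" for m
    by (rule order_trans[OF L2_sq_diff_le[OF u[of m] v[of m] \<phi>]]) (intro add_mono mult_left_mono r[folded u_def] order_refl zero_le)
  then have u\<phi>: "(\<lambda>m. L2_sq (\<lambda>x. u m x - \<phi> x)) \<longlonglongrightarrow> 0"
    by (intro tendsto_sandwich[OF _ _ tendsto_const lim1]) auto
  have "(\<lambda>m. 2 * ennreal ((1/4) ^ m) + 2 * ennreal ((1/4) ^ m)) \<longlonglongrightarrow> 2 * 0 + 2 * 0"
    by (intro tendsto_add ennreal_tendsto_cmult quarter) auto
  then have lim2: "(\<lambda>m. 2 * ennreal ((1/4) ^ m) + 2 * ennreal ((1/4) ^ m)) \<longlonglongrightarrow> 0"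
    by (simp only: mult_zero_right add_0_left)
  have "L2_sq (\<lambda>x. fourier_L1 (u m) x - g x) \<le> 2 * ennreal ((1/4) ^ m) + 2 * ennreal ((1/4) ^ m)" for m
    unfolding fu
    by (rule order_trans[OF L2_sq_diff_le[of _ "h m"]], measurable)
      (intro add_mono mult_left_mono r h zero_le)
  then have fug: "(\<lambda>m. L2_sq (\<lambda>x. fourier_L1 (u m) x - g x)) \<longlonglongrightarrow> 0"
    by (intro tendsto_sandwich[OF _ _ tendsto_const lim2]) auto
  have v_fin: "L2_sq (v m) < \<infinity>" for m
    unfolding v_def
    by (rule order_le_less_trans[OF inv_fourier_L2_bound[OF h(1)]]) (use h(3) in \<open>simp add: ennreal_mult_less_top\<close>)
  have u_fin: "L2_sq (u m) < \<infinity>" for m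
  proof -
    have "L2_sq (u m) \<le> 2 * L2_sq (\<lambda>x. u m x - v m x) + 2 * L2_sq (v m)"
      using L2_sq_diff_le[of "u m" "v m" "\<lambda>_. 0"] by simp
    also have "\<dots> \<le> 2 * ennreal ((1/4) ^ m) + 2 * L2_sq (v m)"
      by (intro add_mono mult_left_mono r[folded u_def] order_refl zero_le)
    also have "\<dots> < \<infinity>" using v_fin by (simp add: ennreal_mult_less_top)
    finally show ?thesis .
  qed
  have "L2_sq \<phi> < \<infinity>"
  proof -
    obtain m where m: "L2_sq (\<lambda>x. u m x - \<phi> x) \<le> ennreal 1"
      using ennreal_tendsto_0D[OF u\<phi>, of 1] by (auto simp: eventually_sequentially)
    have "L2_sq \<phi> \<le> 2 * L2_sq (\<lambda>x. \<phi> x - u m x) + 2 * L2_sq (u m)"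
      using L2_sq_diff_le[of \<phi> "u m" "\<lambda>_. 0"] by simp
    also have "\<dots> < \<infinity>" using m u_fin[of m]
      by (subst L2_sq_minus_commute) (auto simp: ennreal_mult_less_top intro: order_le_less_trans)
    finally show ?thesis .
  qed
  then have "fourier_L2 \<phi> g"
    unfolding fourier_L2_def L2_tendsto_iff using assms u_int u_fin u\<phi> fug \<phi> u
    by (auto simp: in_L2_iff intro!: exI[of _ u])
  then show ?thesis by (rule that)
qed

section \<open>Tilings and the product estimate\<close>

lemma AE_lborel_affine:
  fixes t :: "'a::euclidean_space"
  assumes "AE x in lborel. P x" "c \<noteq> 0"
  shows "AE x in lborel. P (t + c *\<^sub>R x)"
proof -
  have "AE x in density (distr lborel borel (\<lambda>x. t + c *\<^sub>R x)) (\<lambda>_. \<bar>c\<bar> ^ DIM('a)). P x"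
    using assms(1) by (subst lborel_affine[OF assms(2), of t, symmetric])
  then have "AE x in distr lborel borel (\<lambda>x. t + c *\<^sub>R x). P x"
    using assms(2) by (subst (asm) AE_density) auto
  then show ?thesis by (rule AE_distrD[rotated]) measurable
qed

text \<open>Two instances occur: \<open>N = lam\<close> with spacing 2 pi/\<lambda>, which is
  \<Gamma>, and \<open>N = 2\<close> with spacing 2 pi, which doubles the period cube.\<close>

definition grid :: "nat \<Rightarrow> real \<Rightarrow> (real^'n) set" where
  "grid N L = {\<gamma>. \<forall>i. \<exists>m<N. \<gamma> $ i = L * real m}"

lemma shifts_eq_grid: "shifts lam = grid lam (2 * pi / real lam)"
  by (simp add: shifts_def grid_def)

lemma finite_grid: "finite (grid N L :: (real^'n) set)"
proof -
  let ?f = "\<lambda>m :: 'n \<Rightarrow> nat. \<chi> i. L * real (m i)"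
  have "grid N L \<subseteq> ?f ` (UNIV \<rightarrow>\<^sub>E {..<N})"
  proof
    fix \<gamma> :: "real^'n" assume "\<gamma> \<in> grid N L"
    then obtain m where m: "\<And>i. m i < N" "\<And>i. \<gamma> $ i = L * real (m i)"
      unfolding grid_def by (simp, metis)
    then have "\<gamma> = ?f m" "m \<in> UNIV \<rightarrow>\<^sub>E {..<N}" by (auto simp: vec_eq_iff PiE_iff)
    then show "\<gamma> \<in> ?f ` (UNIV \<rightarrow>\<^sub>E {..<N})" by blast
  qed
  moreover have "finite (?f ` (UNIV \<rightarrow>\<^sub>E {..<N}))" by (intro finite_imageI finite_PiE) auto
  ultimately show ?thesis by (rule finite_subset)
qed

text \<open>Half-open, so that translates tile without overlap and the tiling identity holds at
  every point.\<close>

definition cube :: "real \<Rightarrow> (real^'n) set" where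
  "cube L = {x. \<forall>i. 0 \<le> x $ i \<and> x $ i < L}"

lemma cube_measurable [measurable]: "cube L \<in> sets borel"
proof -
  have "cube L = (\<Inter>i. {x. 0 \<le> x $ i \<and> x $ i < L})" by (auto simp: cube_def)
  also have "\<dots> \<in> sets borel" by (intro sets.finite_INT) auto
  finally show ?thesis .
qed

lemma emeasure_cube_finite: "emeasure lborel (cube L :: (real^'n) set) < \<infinity>"
proof -
  have "bounded (cube L :: (real^'n) set)"
    by (rule bounded_subset[OF bounded_cbox[of 0 "\<chi> i. L"]]) (auto simp: cube_def mem_box_cart less_imp_le)
  then show ?thesis by (rule emeasure_bounded_finite)
qed

text \<open>The tile that contains \<open>x\<close> is read off from the floors of the quotients
  \<open>x $ i / L\<close>, and half-openness leaves no other candidate.\<close>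

lemma indicator_cube_eq_sum:
  fixes x :: "real^'n"
  assumes L: "L > 0"
  shows "(indicator (cube (real N * L)) x :: ennreal) = (\<Sum>\<gamma>\<in>grid N L. indicator (cube L) (x - \<gamma>))"
proof -
  have unique: "\<gamma> = (\<chi> i. L * of_int \<lfloor>x $ i / L\<rfloor>)" if "\<gamma> \<in> grid N L" "x - \<gamma> \<in> cube L" for \<gamma>
  proof -
    have "\<gamma> $ i = L * of_int \<lfloor>x $ i / L\<rfloor>" for i
    proof -
      obtain m where m: "\<gamma> $ i = L * real m" using \<open>\<gamma> \<in> grid N L\<close> by (auto simp: grid_def)
      have "0 \<le> x $ i - L * real m" "x $ i - L * real m < L"
        using \<open>x - \<gamma> \<in> cube L\<close> m by (auto simp: cube_def vector_minus_component dest!: spec[of _ i])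
      then have "\<lfloor>x $ i / L\<rfloor> = int m" using L by (intro floor_unique) (auto simp: field_simps)
      then show ?thesis by (simp add: m)
    qed
    then show ?thesis by (simp add: vec_eq_iff)
  qed
  show ?thesis
  proof (cases "x \<in> cube (real N * L)")
    case True
    define \<gamma> :: "real^'n" where "\<gamma> = (\<chi> i. L * of_int \<lfloor>x $ i / L\<rfloor>)"
    have x: "0 \<le> x $ i" "x $ i < real N * L" for i using True by (auto simp: cube_def)
    have "\<gamma> \<in> grid N L"
      unfolding grid_def
    proof (intro CollectI allI)
      fix i
      have "0 \<le> \<lfloor>x $ i / L\<rfloor>" using x[of i] L by simp
      then obtain m where m: "\<lfloor>x $ i / L\<rfloor> = int m" by (rule nonneg_int_cases)
      have "x $ i / L < real N" using x[of i] L by (simp add: field_simps)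
      then have "\<lfloor>x $ i / L\<rfloor> < int N" by (simp add: floor_less_iff)
      then show "\<exists>m<N. \<gamma> $ i = L * real m"
        by (intro exI[of _ m]) (auto simp: \<gamma>_def m)
    qed
    moreover have "x - \<gamma> \<in> cube L"
      unfolding cube_def
    proof (intro CollectI allI)
      fix i
      show "0 \<le> (x - \<gamma>) $ i \<and> (x - \<gamma>) $ i < L"
        using floor_divide_lower[OF L, of "x $ i"] floor_divide_upper[OF L, of "x $ i"]
        by (simp add: \<gamma>_def algebra_simps)
    qed
    ultimately have "(\<Sum>\<gamma>\<in>grid N L. indicator (cube L) (x - \<gamma>)) = (\<Sum>\<gamma>'\<in>{\<gamma>}. indicator (cube L) (x - \<gamma>') :: ennreal)"
    proof (intro sum.mono_neutral_right finite_grid ballI)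
      fix \<gamma>' assume "\<gamma>' \<in> grid N L - {\<gamma>}"
      then have "x - \<gamma>' \<notin> cube L" using unique[of \<gamma>'] unfolding \<gamma>_def by blast
      then show "indicator (cube L) (x - \<gamma>') = (0 :: ennreal)" by simp
    qed simp
    then show ?thesis using True \<open>x - \<gamma> \<in> cube L\<close> by simp
  next
    case False
    have "x - \<gamma> \<notin> cube L" if \<gamma>: "\<gamma> \<in> grid N L" for \<gamma>
    proof
      assume *: "x - \<gamma> \<in> cube L"
      have "0 \<le> x $ i \<and> x $ i < real N * L" for i
      proof -
        obtain m where m: "m < N" "\<gamma> $ i = L * real m" using \<gamma> by (auto simp: grid_def)
        have "0 \<le> x $ i - L * real m" "x $ i - L * real m < L"
          using * m by (auto simp: cube_def vector_minus_component dest!: spec[of _ i])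
        moreover have "L * (real m + 1) \<le> L * real N" using m(1) L by (intro mult_left_mono) auto
        moreover have "0 \<le> L * real m" using L by simp
        moreover have "L * (real m + 1) = L * real m + L" by (simp add: distrib_left)
        moreover have "L * real N = real N * L" by simp
        ultimately show ?thesis by linarith
      qed
      then show False using False by (simp add: cube_def)
    qed
    then show ?thesis using False by simp
  qed
qed

lemma nn_integral_cube_tiling:
  fixes f :: "real^'n \<Rightarrow> ennreal"
  assumes [measurable]: "f \<in> borel_measurable borel" and L: "L > 0"
  shows "(\<integral>\<^sup>+x. indicator (cube (real N * L)) x * f x \<partial>lborel)
    = (\<integral>\<^sup>+x. indicator (cube L) x * (\<Sum>\<gamma>\<in>grid N L. f (x + \<gamma>)) \<partial>lborel)"
proof -
  have "(\<integral>\<^sup>+x. indicator (cube (real N * L)) x * f x \<partial>lborel)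
    = (\<integral>\<^sup>+x. (\<Sum>\<gamma>\<in>grid N L. indicator (cube L) (x - \<gamma>) * f x) \<partial>lborel)"
    by (simp add: indicator_cube_eq_sum[OF L] sum_distrib_right)
  also have "\<dots> = (\<Sum>\<gamma>\<in>grid N L. \<integral>\<^sup>+x. indicator (cube L) (x - \<gamma>) * f x \<partial>lborel)"
    by (rule nn_integral_sum) measurable
  also have "\<dots> = (\<Sum>\<gamma>\<in>grid N L. \<integral>\<^sup>+x. indicator (cube L) x * f (x + \<gamma>) \<partial>lborel)"
  proof (rule sum.cong[OF refl])
    fix \<gamma> :: "real^'n"
    show "(\<integral>\<^sup>+x. indicator (cube L) (x - \<gamma>) * f x \<partial>lborel) = (\<integral>\<^sup>+x. indicator (cube L) x * f (x + \<gamma>) \<partial>lborel)"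
      using nn_integral_lborel_shift[of "\<lambda>x. indicator (cube L) x * f (x + \<gamma>)" \<gamma>] by simp
  qed
  also have "\<dots> = (\<integral>\<^sup>+x. (\<Sum>\<gamma>\<in>grid N L. indicator (cube L) x * f (x + \<gamma>)) \<partial>lborel)"
    by (rule nn_integral_sum[symmetric]) measurable
  finally show ?thesis by (simp add: sum_distrib_left)
qed

section \<open>The period lattice and the iterated estimate\<close>

definition lattice_2pi :: "(real^'n) set" where
  "lattice_2pi = {z. \<forall>i. \<exists>m::int. z $ i = 2 * pi * of_int m}"

lemma lattice_2pi_scale: "z \<in> lattice_2pi \<Longrightarrow> real m *\<^sub>R z \<in> lattice_2pi"
  unfolding lattice_2pi_def
proof (intro CollectI allI, drule CollectD)
  fix i assume "\<forall>i. \<exists>m::int. z $ i = 2 * pi * of_int m"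
  then obtain k :: int where "z $ i = 2 * pi * of_int k" by blast
  then show "\<exists>k::int. (real m *\<^sub>R z) $ i = 2 * pi * of_int k" by (intro exI[of _ "int m * k"]) simp
qed

lemma lam_shift_in_lattice:
  assumes "\<gamma> \<in> grid lam (2 * pi / real lam)" "lam > 0"
  shows "real lam *\<^sub>R \<gamma> \<in> lattice_2pi"
  unfolding lattice_2pi_def
proof (intro CollectI allI)
  fix i
  obtain m where "\<gamma> $ i = 2 * pi / real lam * real m" using assms by (auto simp: grid_def)
  then show "\<exists>k::int. (real lam *\<^sub>R \<gamma>) $ i = 2 * pi * of_int k" using assms(2) by (intro exI[of _ "int m"]) simp
qed

lemma grid_2pi_in_lattice:
  assumes "\<gamma> \<in> grid N (2 * pi)"
  shows "\<gamma> - (\<chi> i. 2 * pi) \<in> lattice_2pi"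
  unfolding lattice_2pi_def
proof (intro CollectI allI)
  fix i
  obtain m where "\<gamma> $ i = 2 * pi * real m" using assms by (auto simp: grid_def)
  then show "\<exists>k::int. (\<gamma> - (\<chi> i. 2 * pi)) $ i = 2 * pi * of_int k"
    by (intro exI[of _ "int m - 1"]) (simp add: algebra_simps)
qed

text \<open>The weight \<sigma> stands for 1/S. Only periodicity, sign, size, the inequality and the
  limit along dilates tending to 0 enter, so the estimate is kept apart from the arithmetic of
  fractions.\<close>

lemma refinement_product_L2:
  fixes t :: "real^'n \<Rightarrow> complex" and \<sigma> :: "real^'n \<Rightarrow> real" and lam :: nat
  assumes lam: "lam \<ge> 2"
    and [measurable]: "t \<in> borel_measurable borel" "\<sigma> \<in> borel_measurable borel"
    and t_per: "\<And>\<xi> z. z \<in> lattice_2pi \<Longrightarrow> t (\<xi> + z) = t \<xi>"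
    and \<sigma>_per: "\<And>\<xi> z. z \<in> lattice_2pi \<Longrightarrow> \<sigma> (\<xi> + z) = \<sigma> \<xi>"
    and \<sigma>_nonneg: "\<And>\<xi>. 0 \<le> \<sigma> \<xi>"
    and \<sigma>_bound: "AE \<xi> in lborel. \<sigma> \<xi> \<le> B"
    and sub_qmf: "AE \<xi> in lborel. (\<Sum>\<gamma>\<in>shifts lam. (cmod (t (\<xi> + \<gamma>)))\<^sup>2 * \<sigma> (\<xi> + \<gamma>)) \<le> \<sigma> (real lam *\<^sub>R \<xi>)"
    and g: "\<And>\<xi>. (\<lambda>k. \<Prod>j<k. t ((1 / real lam ^ Suc j) *\<^sub>R \<xi>)) \<longlonglongrightarrow> g \<xi>"
    and \<sigma>_lim: "\<And>\<xi>. (\<lambda>k. \<sigma> ((1 / real lam ^ k) *\<^sub>R \<xi>)) \<longlonglongrightarrow> 1"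
  shows "L2_sq g < \<infinity>"
proof -
  define a where "a \<xi> = ennreal ((cmod (t \<xi>))\<^sup>2)" for \<xi>
  define w where "w \<xi> = ennreal (\<sigma> \<xi>)" for \<xi>
  have [measurable]: "a \<in> borel_measurable borel" "w \<in> borel_measurable borel"
    unfolding a_def w_def by measurable
  define H where "H k \<xi> = (\<Prod>j<k. a (real (lam ^ j) *\<^sub>R \<xi>))" for k \<xi>
  have [measurable]: "H k \<in> borel_measurable borel" for k unfolding H_def by measurable
  have a_per: "a (\<xi> + z) = a \<xi>" and w_per: "w (\<xi> + z) = w \<xi>" if "z \<in> lattice_2pi" for \<xi> z
    using that by (simp_all add: a_def w_def t_per \<sigma>_per)
  have H_per: "H k (\<xi> + z) = H k \<xi>" if "z \<in> lattice_2pi" for k \<xi> z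
    unfolding H_def scaleR_add_right using that by (intro prod.cong refl a_per lattice_2pi_scale)
  have H_Suc: "H (Suc k) \<xi> = a \<xi> * H k (real lam *\<^sub>R \<xi>)" for k \<xi>
    unfolding H_def by (subst prod.lessThan_Suc_shift) (simp add: mult.commute)
  define J where "J k = (\<integral>\<^sup>+\<xi>. indicator (cube (2 * pi)) \<xi> * (H k \<xi> * w \<xi>) \<partial>lborel)" for k
  \<comment> \<open>The Jacobian of dilation by \<lambda>.\<close>
  define c where "c = ennreal (real lam ^ CARD('n))"
  have J_step: "c * J (Suc k) \<le> J k" for k
  proof -
    let ?L = "2 * pi / real lam"
    have L: "?L > 0" and lamL: "real lam * ?L = 2 * pi" using lam by auto
    have "J (Suc k) = (\<integral>\<^sup>+\<xi>. indicator (cube ?L) \<xi> * (\<Sum>\<gamma>\<in>grid lam ?L. H (Suc k) (\<xi> + \<gamma>) * w (\<xi> + \<gamma>)) \<partial>lborel)"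
      using nn_integral_cube_tiling[of "\<lambda>\<xi>. H (Suc k) \<xi> * w \<xi>" ?L lam, OF _ L] unfolding lamL J_def by simp
    also have "\<dots> \<le> (\<integral>\<^sup>+\<xi>. indicator (cube (2 * pi)) (0 + real lam *\<^sub>R \<xi>) * (H k (0 + real lam *\<^sub>R \<xi>) * w (0 + real lam *\<^sub>R \<xi>)) \<partial>lborel)"
    proof (rule nn_integral_mono_AE)
      show "AE \<xi> in lborel. indicator (cube ?L) \<xi> * (\<Sum>\<gamma>\<in>grid lam ?L. H (Suc k) (\<xi> + \<gamma>) * w (\<xi> + \<gamma>))
        \<le> indicator (cube (2 * pi)) (0 + real lam *\<^sub>R \<xi>) * (H k (0 + real lam *\<^sub>R \<xi>) * w (0 + real lam *\<^sub>R \<xi>))"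
        using sub_qmf
      proof eventually_elim
        case (elim \<xi>)
        have ind: "indicator (cube ?L) \<xi> = (indicator (cube (2 * pi)) (real lam *\<^sub>R \<xi>) :: ennreal)"
          using lam by (simp add: indicator_def cube_def field_simps zero_le_mult_iff)
        have "(\<Sum>\<gamma>\<in>grid lam ?L. H (Suc k) (\<xi> + \<gamma>) * w (\<xi> + \<gamma>))
           = (\<Sum>\<gamma>\<in>grid lam ?L. H k (real lam *\<^sub>R \<xi>) * (a (\<xi> + \<gamma>) * w (\<xi> + \<gamma>)))"
        proof (intro sum.cong refl)
          fix \<gamma> :: "real^'n" assume "\<gamma> \<in> grid lam ?L"
          then have "H k (real lam *\<^sub>R \<xi> + real lam *\<^sub>R \<gamma>) = H k (real lam *\<^sub>R \<xi>)"
            using lam by (intro H_per lam_shift_in_lattice) auto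
          then show "H (Suc k) (\<xi> + \<gamma>) * w (\<xi> + \<gamma>) = H k (real lam *\<^sub>R \<xi>) * (a (\<xi> + \<gamma>) * w (\<xi> + \<gamma>))"
            by (simp add: H_Suc scaleR_add_right mult_ac)
        qed
        also have "\<dots> = H k (real lam *\<^sub>R \<xi>) * (\<Sum>\<gamma>\<in>grid lam ?L. ennreal ((cmod (t (\<xi> + \<gamma>)))\<^sup>2 * \<sigma> (\<xi> + \<gamma>)))"
          by (simp add: sum_distrib_left a_def w_def ennreal_mult \<sigma>_nonneg)
        also have "(\<Sum>\<gamma>\<in>grid lam ?L. ennreal ((cmod (t (\<xi> + \<gamma>)))\<^sup>2 * \<sigma> (\<xi> + \<gamma>)))
            = ennreal (\<Sum>\<gamma>\<in>grid lam ?L. (cmod (t (\<xi> + \<gamma>)))\<^sup>2 * \<sigma> (\<xi> + \<gamma>))"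
          by (rule sum_ennreal) (simp add: \<sigma>_nonneg)
        also have "\<dots> \<le> w (real lam *\<^sub>R \<xi>)"
          unfolding w_def using elim by (intro ennreal_leI) (simp add: shifts_eq_grid)
        finally have "(\<Sum>\<gamma>\<in>grid lam ?L. H (Suc k) (\<xi> + \<gamma>) * w (\<xi> + \<gamma>)) \<le> H k (real lam *\<^sub>R \<xi>) * w (real lam *\<^sub>R \<xi>)"
          by (simp add: mult_left_mono)
        then show ?case unfolding ind add_0_left by (intro mult_left_mono) auto
      qed
    qed
    finally have "c * J (Suc k) \<le> c * (\<integral>\<^sup>+\<xi>. indicator (cube (2 * pi)) (0 + real lam *\<^sub>R \<xi>) * (H k (0 + real lam *\<^sub>R \<xi>) * w (0 + real lam *\<^sub>R \<xi>)) \<partial>lborel)"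
      by (intro mult_left_mono) auto
    also have "\<dots> = J k"
      unfolding J_def using lam by (subst nn_integral_lborel_affine[of _ "real lam" 0]) (auto simp: c_def)
    finally show ?thesis .
  qed
  have J_le: "c ^ k * J k \<le> J 0" for k
  proof (induction k)
    case (Suc k)
    have "c ^ Suc k * J (Suc k) = c ^ k * (c * J (Suc k))" by (simp add: mult_ac)
    also have "\<dots> \<le> c ^ k * J k" by (intro mult_left_mono J_step) simp
    also note Suc
    finally show ?case .
  qed simp
  \<comment> \<open>The essential bound on \<sigma> starts the iteration: the product over no
    factors is 1 and the cube has finite measure.\<close>
  have J0: "J 0 < \<infinity>"
  proof -
    have "J 0 \<le> (\<integral>\<^sup>+\<xi>. indicator (cube (2 * pi) :: (real^'n) set) \<xi> * ennreal B \<partial>lborel)"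
      unfolding J_def
    proof (rule nn_integral_mono_AE)
      show "AE \<xi> in lborel. indicator (cube (2 * pi)) \<xi> * (H 0 \<xi> * w \<xi>) \<le> indicator (cube (2 * pi)) \<xi> * ennreal B"
        using \<sigma>_bound by eventually_elim (auto simp: H_def w_def intro!: mult_left_mono ennreal_leI)
    qed
    also have "\<dots> = emeasure lborel (cube (2 * pi) :: (real^'n) set) * ennreal B"
      by (subst nn_integral_multc) auto
    also have "\<dots> < \<infinity>" using emeasure_cube_finite[where 'n='n] by (simp add: ennreal_mult_less_top)
    finally show ?thesis .
  qed
  \<comment> \<open>All entries of \<open>one\<close> are 2 pi, so \<open>Q\<close> is the indicator
    of the cube from -2 pi to 2 pi in each coordinate. The period cube has 0 as a corner, and its
    dilates would fill just one orthant.\<close>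
  define one :: "real^'n" where "one = (\<chi> i. 2 * pi)"
  define Q where "Q \<xi> = (indicator (cube (real 2 * (2 * pi))) (\<xi> + one) :: ennreal)" for \<xi>
  have [measurable]: "Q \<in> borel_measurable borel" unfolding Q_def by measurable
  \<comment> \<open>The cube behind \<open>Q\<close> consists of
    \<open>card (grid 2 (2 * pi))\<close> period cubes, each of which contributes the same amount by
    periodicity.\<close>
  define M where "M = of_nat (card (grid 2 (2 * pi) :: (real^'n) set)) * J 0"
  have M: "M < \<infinity>" using J0 by (simp add: M_def ennreal_mult_less_top of_nat_less_top)
  have Q_int: "(\<integral>\<^sup>+\<xi>. Q \<xi> * (H k \<xi> * w \<xi>) \<partial>lborel) = of_nat (card (grid 2 (2 * pi) :: (real^'n) set)) * J k" for k
  proof -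
    have "(\<integral>\<^sup>+\<xi>. Q \<xi> * (H k \<xi> * w \<xi>) \<partial>lborel)
       = (\<integral>\<^sup>+\<xi>. indicator (cube (real 2 * (2 * pi))) \<xi> * (H k (\<xi> - one) * w (\<xi> - one)) \<partial>lborel)"
      using nn_integral_lborel_shift[of "\<lambda>\<xi>. Q \<xi> * (H k \<xi> * w \<xi>)" one] by (simp add: Q_def)
    also have "\<dots> = (\<integral>\<^sup>+\<xi>. indicator (cube (2 * pi)) \<xi> * (\<Sum>\<gamma>\<in>grid 2 (2 * pi). H k (\<xi> + \<gamma> - one) * w (\<xi> + \<gamma> - one)) \<partial>lborel)"
      by (rule nn_integral_cube_tiling) auto
    also have "\<dots> = (\<integral>\<^sup>+\<xi>. of_nat (card (grid 2 (2 * pi) :: (real^'n) set)) * (indicator (cube (2 * pi)) \<xi> * (H k \<xi> * w \<xi>)) \<partial>lborel)"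
    proof (rule nn_integral_cong)
      fix \<xi> :: "real^'n"
      have "(\<Sum>\<gamma>\<in>grid 2 (2 * pi). H k (\<xi> + \<gamma> - one) * w (\<xi> + \<gamma> - one)) = (\<Sum>\<gamma>\<in>(grid 2 (2 * pi) :: (real^'n) set). H k \<xi> * w \<xi>)"
        unfolding add_diff_eq[symmetric]
        by (intro sum.cong refl) (simp add: H_per w_per grid_2pi_in_lattice one_def)
      then show "indicator (cube (2 * pi)) \<xi> * (\<Sum>\<gamma>\<in>grid 2 (2 * pi). H k (\<xi> + \<gamma> - one) * w (\<xi> + \<gamma> - one))
        = of_nat (card (grid 2 (2 * pi) :: (real^'n) set)) * (indicator (cube (2 * pi)) \<xi> * (H k \<xi> * w \<xi>))"
        by (simp add: mult_ac)
    qed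
    finally show ?thesis by (simp add: nn_integral_cmult J_def)
  qed
  \<comment> \<open>This is the integrand \<open>Q * (H k * w)\<close> spread out by \<lambda>^k:
    its factors are those of the infinite product, and the Jacobian is the factor
    \<open>c ^ k\<close> that the iteration compensates.\<close>
  define G where "G k \<xi> = Q ((1 / real lam ^ k) *\<^sub>R \<xi>) *
      (ennreal ((cmod (\<Prod>j<k. t ((1 / real lam ^ Suc j) *\<^sub>R \<xi>)))\<^sup>2) * w ((1 / real lam ^ k) *\<^sub>R \<xi>))" for k \<xi>
  have [measurable]: "G k \<in> borel_measurable borel" for k unfolding G_def by measurable
  have G_int: "(\<integral>\<^sup>+\<xi>. G k \<xi> \<partial>lborel) \<le> M" for k
  proof -
    have lk: "real lam ^ k \<noteq> 0" using lam by simp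
    have Gk: "G k (0 + real lam ^ k *\<^sub>R \<xi>) = Q \<xi> * (H k \<xi> * w \<xi>)" for \<xi>
    proof -
      have "ennreal ((cmod (\<Prod>j<k. t ((1 / real lam ^ Suc j) *\<^sub>R (real lam ^ k *\<^sub>R \<xi>))))\<^sup>2)
        = (\<Prod>j<k. a ((1 / real lam ^ Suc j) *\<^sub>R (real lam ^ k *\<^sub>R \<xi>)))"
        by (simp add: a_def prod_norm[symmetric] prod_power_distrib prod_ennreal)
      also have "\<dots> = (\<Prod>j<k. a (real (lam ^ (k - Suc j)) *\<^sub>R \<xi>))"
      proof (intro prod.cong refl)
        fix j assume "j \<in> {..<k}"
        then have "real lam ^ k = real lam ^ (k - Suc j) * real lam ^ Suc j"
          unfolding power_add[symmetric] by simp
        then have "1 / real lam ^ Suc j * real lam ^ k = real (lam ^ (k - Suc j))"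
          using lam by simp
        then show "a ((1 / real lam ^ Suc j) *\<^sub>R (real lam ^ k *\<^sub>R \<xi>)) = a (real (lam ^ (k - Suc j)) *\<^sub>R \<xi>)"
          by (simp only: scaleR_scaleR)
      qed
      also have "\<dots> = H k \<xi>"
        \<comment> \<open>The infinite product lists its factors from the largest argument down,
          while \<open>H k\<close> lists them from the smallest up.\<close>
        unfolding H_def by (rule prod.nat_diff_reindex[of "\<lambda>j. a (real (lam ^ j) *\<^sub>R \<xi>)" k])
      finally have prod_eq: "ennreal ((cmod (\<Prod>j<k. t ((1 / real lam ^ Suc j) *\<^sub>R (real lam ^ k *\<^sub>R \<xi>))))\<^sup>2) = H k \<xi>" .
      have scale: "(1 / real lam ^ k) *\<^sub>R (real lam ^ k *\<^sub>R \<xi>) = \<xi>"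
        by (simp only: scaleR_scaleR times_divide_eq_left mult_1_left divide_self[OF lk] scaleR_one)
      show ?thesis unfolding G_def add_0_left prod_eq scale ..
    qed
    have G_meas: "G k \<in> borel_measurable borel" by measurable
    have "(\<integral>\<^sup>+\<xi>. G k \<xi> \<partial>lborel) = ennreal (\<bar>real lam ^ k\<bar> ^ DIM(real^'n)) * (\<integral>\<^sup>+\<xi>. G k (0 + real lam ^ k *\<^sub>R \<xi>) \<partial>lborel)"
      by (rule nn_integral_lborel_affine[of "G k" "real lam ^ k" 0, OF G_meas lk])
    also have "\<dots> = ennreal (\<bar>real lam ^ k\<bar> ^ DIM(real^'n)) * (\<integral>\<^sup>+\<xi>. Q \<xi> * (H k \<xi> * w \<xi>) \<partial>lborel)"
      by (simp only: Gk)
    also have "ennreal (\<bar>real lam ^ k\<bar> ^ DIM(real^'n)) = c ^ k"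
    proof -
      have "\<bar>real lam ^ k\<bar> ^ DIM(real^'n) = (real lam ^ CARD('n)) ^ k"
        by (simp only: abs_of_nonneg zero_le_power of_nat_0_le_iff power_mult[symmetric] mult.commute[of k] DIM_cart DIM_real mult_1_right)
      then show ?thesis by (simp only: c_def ennreal_power zero_le_power of_nat_0_le_iff)
    qed
    also have "c ^ k * (\<integral>\<^sup>+\<xi>. Q \<xi> * (H k \<xi> * w \<xi>) \<partial>lborel) = of_nat (card (grid 2 (2 * pi) :: (real^'n) set)) * (c ^ k * J k)"
      unfolding Q_int by (simp add: mult_ac)
    also have "\<dots> \<le> M" unfolding M_def by (intro mult_left_mono J_le) simp
    finally show ?thesis .
  qed
  have inv0: "(\<lambda>k. 1 / real lam ^ k) \<longlonglongrightarrow> 0"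
    using lam LIMSEQ_realpow_zero[of "1 / real lam"] by (simp add: power_divide)
  have "L2_sq g = (\<integral>\<^sup>+\<xi>. liminf (\<lambda>k. G k \<xi>) \<partial>lborel)"
    unfolding L2_sq_def
  proof (rule nn_integral_cong)
    fix \<xi> :: "real^'n"
    have "(\<lambda>k. (1 / real lam ^ k) *\<^sub>R \<xi>) \<longlonglongrightarrow> 0 *\<^sub>R \<xi>" by (intro tendsto_intros inv0)
    then have to0: "(\<lambda>k. (1 / real lam ^ k) *\<^sub>R \<xi>) \<longlonglongrightarrow> 0" by simp
    have "eventually (\<lambda>k. norm ((1 / real lam ^ k) *\<^sub>R \<xi>) < 2 * pi) sequentially"
      using tendstoD[OF to0, of "2 * pi"] by (simp add: dist_norm)
    \<comment> \<open>For fixed \<xi> the rescaled point eventually lies in the centred cube, where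
      \<open>Q\<close> is 1.\<close>
    then have ev: "eventually (\<lambda>k. ennreal ((cmod (\<Prod>j<k. t ((1 / real lam ^ Suc j) *\<^sub>R \<xi>)))\<^sup>2 * \<sigma> ((1 / real lam ^ k) *\<^sub>R \<xi>)) = G k \<xi>) sequentially"
    proof (rule eventually_mono)
      fix k assume *: "norm ((1 / real lam ^ k) *\<^sub>R \<xi>) < 2 * pi"
      define x where "x = (1 / real lam ^ k) *\<^sub>R \<xi>"
      have "x + one \<in> cube (real 2 * (2 * pi))"
        unfolding cube_def
      proof (intro CollectI allI)
        fix i
        have "\<bar>x $ i\<bar> < 2 * pi"
          using component_le_norm_cart[of x i] * unfolding x_def by linarith
        moreover have "(x + one) $ i = x $ i + 2 * pi" by (simp add: one_def)
        ultimately show "0 \<le> (x + one) $ i \<and> (x + one) $ i < real 2 * (2 * pi)"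
          unfolding of_nat_numeral by linarith
      qed
      then have "Q x = 1" by (simp add: Q_def)
      then show "ennreal ((cmod (\<Prod>j<k. t ((1 / real lam ^ Suc j) *\<^sub>R \<xi>)))\<^sup>2 * \<sigma> ((1 / real lam ^ k) *\<^sub>R \<xi>)) = G k \<xi>"
        unfolding G_def w_def x_def[symmetric]
        by (simp only: ennreal_mult[OF zero_le_power2 \<sigma>_nonneg] mult_1_left)
    qed
    have "(\<lambda>k. ennreal ((cmod (\<Prod>j<k. t ((1 / real lam ^ Suc j) *\<^sub>R \<xi>)))\<^sup>2 * \<sigma> ((1 / real lam ^ k) *\<^sub>R \<xi>))) \<longlonglongrightarrow> ennreal ((cmod (g \<xi>))\<^sup>2 * 1)"
      by (rule tendsto_ennrealI, rule tendsto_mult, rule tendsto_power, rule tendsto_norm, rule g, rule \<sigma>_lim)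
    then have "(\<lambda>k. G k \<xi>) \<longlonglongrightarrow> ennreal ((cmod (g \<xi>))\<^sup>2 * 1)"
      by (rule Lim_transform_eventually[OF _ ev])
    from lim_imp_Liminf[OF _ this] show "ennreal ((cmod (g \<xi>))\<^sup>2) = liminf (\<lambda>k. G k \<xi>)" by simp
  qed
  also have "\<dots> \<le> liminf (\<lambda>k. \<integral>\<^sup>+\<xi>. G k \<xi> \<partial>lborel)"
    by (rule nn_integral_liminf) measurable
  also have "\<dots> \<le> M"
    by (rule Liminf_le) (simp_all add: G_int)
  finally show ?thesis using M by (rule order_le_less_trans)
qed

section \<open>Fractions of trigonometric polynomials\<close>

text \<open>The identity is demanded only on \<open>A\<close>, where the denominator has no zeros;
  the conventional value of division by 0 thus stays out of the rules for adding fractions.\<close>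

definition tp_frac :: "(real^'n) set \<Rightarrow> (real^'n \<Rightarrow> complex) \<Rightarrow> bool" where
  "tp_frac A f \<longleftrightarrow> (\<exists>P Q. trig_poly P \<and> trig_poly Q \<and> (\<forall>\<xi>\<in>A. Q \<xi> \<noteq> 0 \<and> f \<xi> = P \<xi> / Q \<xi>))"

lemma tp_frac_divide:
  assumes "trig_poly P" "trig_poly Q" "\<And>\<xi>. \<xi> \<in> A \<Longrightarrow> Q \<xi> \<noteq> 0"
  shows "tp_frac A (\<lambda>\<xi>. P \<xi> / Q \<xi>)"
  using assms unfolding tp_frac_def by blast

lemma tp_frac_cong:
  assumes "tp_frac A f" "\<And>\<xi>. \<xi> \<in> A \<Longrightarrow> f \<xi> = g \<xi>"
  shows "tp_frac A g"
  using assms unfolding tp_frac_def by metis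

lemma tp_frac_mult:
  assumes "tp_frac A f" "tp_frac A g"
  shows "tp_frac A (\<lambda>\<xi>. f \<xi> * g \<xi>)"
proof -
  obtain P Q where P: "trig_poly P" "trig_poly Q" "\<And>\<xi>. \<xi> \<in> A \<Longrightarrow> Q \<xi> \<noteq> 0 \<and> f \<xi> = P \<xi> / Q \<xi>"
    using assms(1) unfolding tp_frac_def by blast
  obtain R S where R: "trig_poly R" "trig_poly S" "\<And>\<xi>. \<xi> \<in> A \<Longrightarrow> S \<xi> \<noteq> 0 \<and> g \<xi> = R \<xi> / S \<xi>"
    using assms(2) unfolding tp_frac_def by blast
  have "tp_frac A (\<lambda>\<xi>. (P \<xi> * R \<xi>) / (Q \<xi> * S \<xi>))"
    using P R by (intro tp_frac_divide trig_poly_mult) auto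
  then show ?thesis by (rule tp_frac_cong) (use P(3) R(3) in simp)
qed

lemma tp_frac_add:
  assumes "tp_frac A f" "tp_frac A g"
  shows "tp_frac A (\<lambda>\<xi>. f \<xi> + g \<xi>)"
proof -
  obtain P Q where P: "trig_poly P" "trig_poly Q" "\<And>\<xi>. \<xi> \<in> A \<Longrightarrow> Q \<xi> \<noteq> 0 \<and> f \<xi> = P \<xi> / Q \<xi>"
    using assms(1) unfolding tp_frac_def by blast
  obtain R S where R: "trig_poly R" "trig_poly S" "\<And>\<xi>. \<xi> \<in> A \<Longrightarrow> S \<xi> \<noteq> 0 \<and> g \<xi> = R \<xi> / S \<xi>"
    using assms(2) unfolding tp_frac_def by blast
  have "tp_frac A (\<lambda>\<xi>. (P \<xi> * S \<xi> + R \<xi> * Q \<xi>) / (Q \<xi> * S \<xi>))"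
    using P R by (intro tp_frac_divide trig_poly_mult trig_poly_add) auto
  then show ?thesis by (rule tp_frac_cong) (use P(3) R(3) in \<open>simp add: add_frac_eq\<close>)
qed

lemma tp_frac_const: "tp_frac A (\<lambda>\<xi>. c)"
  using tp_frac_divide[OF trig_poly_const trig_poly_const, of A 1 c] by simp

lemma tp_frac_diff:
  assumes "tp_frac A f" "tp_frac A g"
  shows "tp_frac A (\<lambda>\<xi>. f \<xi> - g \<xi>)"
  using tp_frac_add[OF assms(1) tp_frac_mult[OF tp_frac_const[of A "-1"] assms(2)]] by simp

lemma tp_frac_sum:
  assumes "\<And>i. i \<in> I \<Longrightarrow> tp_frac A (f i)"
  shows "tp_frac A (\<lambda>\<xi>. \<Sum>i\<in>I. f i \<xi>)"
  using assms by (induction I rule: infinite_finite_induct) (auto intro: tp_frac_add tp_frac_const)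

text \<open>A point of \<open>A\<close> certifies that \<open>Q\<close> is not the zero polynomial,
  so the fraction can be reduced. Where both denominators are nonzero, P q = Q p forces the two
  quotients to agree.\<close>

lemma rational_extension:
  fixes f :: "real^'n \<Rightarrow> complex"
  assumes "tp_frac A f" "A \<noteq> {}"
  obtains F where "rational_trig_poly F" "\<And>\<xi>. \<xi> \<in> dom F \<Longrightarrow> \<xi> \<in> A \<Longrightarrow> F \<xi> = Some (f \<xi>)"
    "AE \<xi> in lborel. \<xi> \<in> dom F"
proof -
  obtain P Q where P: "trig_poly P" "trig_poly Q" "\<And>\<xi>. \<xi> \<in> A \<Longrightarrow> Q \<xi> \<noteq> 0 \<and> f \<xi> = P \<xi> / Q \<xi>"
    using assms(1) unfolding tp_frac_def by blast
  have "Q \<noteq> (\<lambda>_. 0)" using assms(2) P(3) by auto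
  then obtain p q where pq: "trig_poly p" "trig_poly q" "q \<noteq> (\<lambda>_. 0)" "tp_is_gcd (\<lambda>_. 1) p q"
    "\<And>\<xi>. P \<xi> * q \<xi> = Q \<xi> * p \<xi>"
    by (rule reduced_fraction_exists[OF P(1,2)]) blast
  then obtain x where x: "q x \<noteq> 0" by (auto simp: fun_eq_iff)
  define F where "F = (\<lambda>\<xi>. if q \<xi> = 0 then None else Some (p \<xi> / q \<xi>))"
  have "rational_trig_poly F"
    unfolding rational_trig_poly_def F_def using pq x by blast
  moreover have "F \<xi> = Some (f \<xi>)" if "\<xi> \<in> dom F" "\<xi> \<in> A" for \<xi>
  proof -
    have "q \<xi> \<noteq> 0" using that(1) by (auto simp: F_def split: if_splits)
    moreover have "Q \<xi> \<noteq> 0" "f \<xi> = P \<xi> / Q \<xi>" using P(3)[OF that(2)] by auto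
    moreover from calculation have "p \<xi> / q \<xi> = P \<xi> / Q \<xi>"
      using pq(5)[of \<xi>] by (simp add: frac_eq_eq mult.commute)
    ultimately show ?thesis by (simp add: F_def)
  qed
  moreover have "AE \<xi> in lborel. \<xi> \<in> dom F"
    using trig_poly_nonzero_AE[OF pq(2) x] by eventually_elim (simp add: F_def domIff)
  ultimately show ?thesis by (rule that)
qed

text \<open>Division by 0 gives 0, which is also the default of \<open>total_ext\<close>; the total
  extension is thus p/q at every point, poles included.\<close>

lemma rational_trig_poly_obtain:
  assumes "rational_trig_poly R"
  obtains p q x where "trig_poly p" "trig_poly q" "q x \<noteq> 0"
    "R = (\<lambda>\<xi>. if q \<xi> = 0 then None else Some (p \<xi> / q \<xi>))" "total_ext R = (\<lambda>\<xi>. p \<xi> / q \<xi>)"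
proof -
  obtain p q x where *: "trig_poly p" "trig_poly q" "q x \<noteq> 0"
    "R = (\<lambda>\<xi>. if q \<xi> = 0 then None else Some (p \<xi> / q \<xi>))"
    using assms unfolding rational_trig_poly_def by blast
  moreover have "total_ext R = (\<lambda>\<xi>. p \<xi> / q \<xi>)"
    unfolding total_ext_def *(4) by auto
  ultimately show ?thesis by (rule that)
qed

section \<open>Convergence of the infinite product\<close>

lemma trig_char_lipschitz: "cmod (trig_char k \<xi> - 1) \<le> norm (int_vec k) * norm \<xi>"
proof -
  have "cmod (trig_char k \<xi> - 1) \<le> \<bar>int_vec k \<bullet> \<xi>\<bar>"
    using iexp_approx1[of "- (int_vec k \<bullet> \<xi>)" 0] by (simp add: trig_char_def)
  also have "\<dots> \<le> norm (int_vec k) * norm \<xi>" by (rule Cauchy_Schwarz_ineq2)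
  finally show ?thesis .
qed

lemma trig_poly_lipschitz_at_0:
  assumes "trig_poly p"
  obtains C where "0 \<le> C" "\<And>\<xi>. cmod (p \<xi> - p 0) \<le> C * norm \<xi>"
proof -
  obtain K h where K: "finite K" "p = (\<lambda>\<xi>. \<Sum>k\<in>K. h k * trig_char k \<xi>)" using trig_poly_obtain[OF assms] .
  define C where "C = (\<Sum>k\<in>K. cmod (h k) * norm (int_vec k))"
  have "cmod (p \<xi> - p 0) \<le> C * norm \<xi>" for \<xi>
  proof -
    have "p \<xi> - p 0 = (\<Sum>k\<in>K. h k * (trig_char k \<xi> - 1))"
      by (simp add: K(2) sum_subtractf right_diff_distrib)
    also have "cmod \<dots> \<le> (\<Sum>k\<in>K. cmod (h k) * (norm (int_vec k) * norm \<xi>))"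
      by (intro sum_norm_le) (simp add: norm_mult mult_left_mono trig_char_lipschitz)
    finally show ?thesis by (simp add: C_def sum_distrib_right mult.assoc)
  qed
  moreover have "0 \<le> C" unfolding C_def by (intro sum_nonneg) simp
  ultimately show ?thesis using that by blast
qed

text \<open>The numerator of p/q - 1 is the trigonometric polynomial p - q, which vanishes at 0 and
  is bounded by a multiple of the norm; near 0 the denominator keeps at least half of its modulus at
  0.\<close>

lemma quotient_lipschitz_near_0:
  assumes p: "trig_poly p" and q: "trig_poly q" and one: "p 0 = q 0" "q 0 \<noteq> 0"
  obtains \<delta> C where "0 < \<delta>" "\<And>\<xi>. norm \<xi> < \<delta> \<Longrightarrow> cmod (p \<xi> / q \<xi> - 1) \<le> C * norm \<xi>"
proof -
  obtain C where C: "0 \<le> C" "\<And>\<xi>. cmod ((p \<xi> - q \<xi>) - (p 0 - q 0)) \<le> C * norm \<xi>"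
    using trig_poly_lipschitz_at_0[OF trig_poly_diff[OF p q]] by blast
  have "isCont q 0"
    using continuous_on_interior[OF trig_poly_continuous[OF q]] by (metis interior_UNIV UNIV_I)
  moreover have "0 < cmod (q 0) / 2" using one by simp
  ultimately obtain \<delta> where \<delta>: "0 < \<delta>" "\<And>\<xi>. dist \<xi> 0 < \<delta> \<Longrightarrow> dist (q \<xi>) (q 0) < cmod (q 0) / 2"
    unfolding continuous_at_eps_delta by blast
  have "cmod (p \<xi> / q \<xi> - 1) \<le> 2 * C / cmod (q 0) * norm \<xi>" if "norm \<xi> < \<delta>" for \<xi>
  proof -
    have "cmod (q \<xi> - q 0) < cmod (q 0) / 2" using \<delta>(2)[of \<xi>] that by (simp add: dist_norm)
    then have q2: "cmod (q 0) / 2 < cmod (q \<xi>)"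
      using norm_triangle_ineq2[of "q 0" "q \<xi>"] by (simp add: norm_minus_commute)
    then have q0: "q \<xi> \<noteq> 0" using one by auto
    then have "p \<xi> / q \<xi> - 1 = (p \<xi> - q \<xi>) / q \<xi>" by (simp add: diff_divide_distrib)
    then have "cmod (p \<xi> / q \<xi> - 1) = cmod (p \<xi> - q \<xi>) / cmod (q \<xi>)" by (simp add: norm_divide)
    also have "\<dots> \<le> (C * norm \<xi>) / (cmod (q 0) / 2)"
      using C(2)[of \<xi>] one q2 C(1) by (intro frac_le) auto
    finally show ?thesis by (simp add: field_simps)
  qed
  with \<delta>(1) show ?thesis by (rule that)
qed

text \<open>The arguments shrink geometrically, so the deviations of the factors from 1 are
  absolutely summable. Finitely many early factors may be 0, which \<open>convergent_prod\<close>
  allows.\<close>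

lemma dilated_product_convergent:
  fixes t :: "'a::euclidean_space \<Rightarrow> complex"
  assumes lam: "lam \<ge> (2::nat)" and \<delta>: "0 < \<delta>" and t: "\<And>\<xi>. norm \<xi> < \<delta> \<Longrightarrow> cmod (t \<xi> - 1) \<le> C * norm \<xi>"
  shows "convergent_prod (\<lambda>j. t ((1 / real lam ^ Suc j) *\<^sub>R \<xi>))"
proof -
  have inv0: "(\<lambda>j. norm ((1 / real lam ^ Suc j) *\<^sub>R \<xi>)) \<longlonglongrightarrow> 0"
  proof -
    have "(\<lambda>j. (1 / real lam) ^ Suc j * norm \<xi>) \<longlonglongrightarrow> 0 * norm \<xi>"
      using lam by (intro tendsto_mult tendsto_const LIMSEQ_Suc[OF LIMSEQ_realpow_zero]) auto
    then show ?thesis by (simp add: power_divide)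
  qed
  have "eventually (\<lambda>j. norm ((1 / real lam ^ Suc j) *\<^sub>R \<xi>) < \<delta>) sequentially"
    using order_tendstoD(2)[OF inv0 \<delta>] .
  then have "eventually (\<lambda>j. norm (norm (t ((1 / real lam ^ Suc j) *\<^sub>R \<xi>) - 1)) \<le> (C * norm \<xi>) * (1 / real lam) ^ Suc j) sequentially"
  proof (rule eventually_mono)
    fix j assume "norm ((1 / real lam ^ Suc j) *\<^sub>R \<xi>) < \<delta>"
    from t[OF this] show "norm (norm (t ((1 / real lam ^ Suc j) *\<^sub>R \<xi>) - 1)) \<le> (C * norm \<xi>) * (1 / real lam) ^ Suc j"
      by (simp add: power_divide)
  qed
  moreover have "summable (\<lambda>j. (C * norm \<xi>) * (1 / real lam) ^ Suc j)"
    using lam by (intro summable_mult summable_Suc_iff[THEN iffD2] summable_geometric) simp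
  ultimately have "summable (\<lambda>j. norm (t ((1 / real lam ^ Suc j) *\<^sub>R \<xi>) - 1))"
    by (rule summable_comparison_test_ev)
  then show ?thesis
    by (intro abs_convergent_prod_imp_convergent_prod) (simp add: abs_convergent_prod_conv_summable)
qed

text \<open>The sub-QMF expression is a fraction of trigonometric polynomials on the set
  \<open>A\<close> where all its terms are defined. Its reduced form is a legitimate
  \<open>F\<close> for the hypothesis and agrees with the expression almost everywhere.\<close>

lemma sub_QMF_AE:
  fixes S \<tau> :: "real^'n \<rightharpoonup> complex"
  assumes lam: "lam \<ge> 2"
    and S_rat: "rational_trig_poly S"
    and S_nonzero: "\<exists>\<xi> z. S \<xi> = Some z \<and> z \<noteq> 0"
    and S_nonneg: "\<forall>\<xi> z. S \<xi> = Some z \<longrightarrow> z \<in> \<real>\<^sub>\<ge>\<^sub>0"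
    and tau_rat: "rational_trig_poly \<tau>"
    and sub_QMF: "\<forall>F. is_qmf_fun lam \<tau> S F \<longrightarrow> (\<forall>\<xi> z. F \<xi> = Some z \<longrightarrow> z \<in> \<real>\<^sub>\<ge>\<^sub>0)"
  shows "AE \<xi> in lborel. (\<Sum>\<gamma>\<in>shifts lam. (cmod (total_ext \<tau> (\<xi> + \<gamma>)))\<^sup>2 * Re (1 / total_ext S (\<xi> + \<gamma>)))
      \<le> Re (1 / total_ext S (real lam *\<^sub>R \<xi>))"
proof -
  obtain pS qS xS where S: "trig_poly pS" "trig_poly qS" "qS xS \<noteq> 0"
    "S = (\<lambda>\<xi>. if qS \<xi> = 0 then None else Some (pS \<xi> / qS \<xi>))" "total_ext S = (\<lambda>\<xi>. pS \<xi> / qS \<xi>)"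
    using rational_trig_poly_obtain[OF S_rat] .
  obtain pt qt xt where T: "trig_poly pt" "trig_poly qt" "qt xt \<noteq> 0"
    "\<tau> = (\<lambda>\<xi>. if qt \<xi> = 0 then None else Some (pt \<xi> / qt \<xi>))" "total_ext \<tau> = (\<lambda>\<xi>. pt \<xi> / qt \<xi>)"
    using rational_trig_poly_obtain[OF tau_rat] .
  obtain yS where yS: "pS yS \<noteq> 0" using S_nonzero S(4) by (auto split: if_splits)
  define A where "A = {\<xi>. qmf_terms_defined lam \<tau> S \<xi>}"
  have A_iff: "\<xi> \<in> A \<longleftrightarrow> (qS (real lam *\<^sub>R \<xi>) \<noteq> 0 \<and> pS (real lam *\<^sub>R \<xi>) \<noteq> 0) \<and>
     (\<forall>\<gamma>\<in>shifts lam. qt (\<xi> + \<gamma>) \<noteq> 0 \<and> qS (\<xi> + \<gamma>) \<noteq> 0 \<and> pS (\<xi> + \<gamma>) \<noteq> 0)" for \<xi>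
    by (auto simp: A_def qmf_terms_defined_def S(4) T(4))
  have nz: "AE \<xi> in lborel. pS \<xi> \<noteq> 0" "AE \<xi> in lborel. qS \<xi> \<noteq> 0" "AE \<xi> in lborel. qt \<xi> \<noteq> 0"
    using trig_poly_nonzero_AE[OF S(1) yS] trig_poly_nonzero_AE[OF S(2,3)] trig_poly_nonzero_AE[OF T(2,3)] .
  have fin: "finite (shifts lam :: (real^'n) set)" by (simp add: shifts_eq_grid finite_grid)
  have sh: "AE \<xi> in lborel. \<forall>\<gamma>\<in>shifts lam. f (\<xi> + \<gamma>) \<noteq> 0" if "AE \<xi> in lborel. f \<xi> \<noteq> 0" for f :: "real^'n \<Rightarrow> complex"
  proof (rule AE_finite_allI[OF fin])
    fix \<gamma> :: "real^'n"
    show "AE \<xi> in lborel. f (\<xi> + \<gamma>) \<noteq> 0"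
      using AE_lborel_affine[OF that, of 1 \<gamma>] by (simp add: add.commute)
  qed
  have sc: "AE \<xi> in lborel. f (real lam *\<^sub>R \<xi>) \<noteq> 0" if "AE \<xi> in lborel. f \<xi> \<noteq> 0" for f :: "real^'n \<Rightarrow> complex"
    using AE_lborel_affine[OF that, of "real lam" 0] lam by simp
  have A_AE: "AE \<xi> in lborel. \<xi> \<in> A"
    using sh[OF nz(1)] sh[OF nz(2)] sh[OF nz(3)] sc[OF nz(1)] sc[OF nz(2)]
    by eventually_elim (auto simp: A_iff)
  then have A_ne: "A \<noteq> {}" by (elim AE_lborel_witness) auto
  define f where "f \<xi> = 1 / total_ext S (real lam *\<^sub>R \<xi>)
      - (\<Sum>\<gamma>\<in>shifts lam. of_real ((cmod (total_ext \<tau> (\<xi> + \<gamma>)))\<^sup>2) / total_ext S (\<xi> + \<gamma>))" for \<xi>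
  \<comment> \<open>The squared modulus is split into the mask and its conjugate, so that each
    factor is visibly a fraction.\<close>
  have "tp_frac A (\<lambda>\<xi>. qS (real lam *\<^sub>R \<xi>) / pS (real lam *\<^sub>R \<xi>)
     - (\<Sum>\<gamma>\<in>shifts lam. (pt (\<xi> + \<gamma>) / qt (\<xi> + \<gamma>)) * (cnj (pt (\<xi> + \<gamma>)) / cnj (qt (\<xi> + \<gamma>))) * (qS (\<xi> + \<gamma>) / pS (\<xi> + \<gamma>))))"
    by (intro tp_frac_diff tp_frac_sum tp_frac_mult tp_frac_divide trig_poly_scale trig_poly_shift
        trig_poly_cnj S T) (auto simp: A_iff)
  then have "tp_frac A f"
  proof (rule tp_frac_cong)
    fix \<xi>
    show "qS (real lam *\<^sub>R \<xi>) / pS (real lam *\<^sub>R \<xi>)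
     - (\<Sum>\<gamma>\<in>shifts lam. (pt (\<xi> + \<gamma>) / qt (\<xi> + \<gamma>)) * (cnj (pt (\<xi> + \<gamma>)) / cnj (qt (\<xi> + \<gamma>))) * (qS (\<xi> + \<gamma>) / pS (\<xi> + \<gamma>))) = f \<xi>"
      unfolding f_def S(5) T(5) complex_norm_square by simp
  qed
  then obtain F where F: "rational_trig_poly F" "\<And>\<xi>. \<xi> \<in> dom F \<Longrightarrow> \<xi> \<in> A \<Longrightarrow> F \<xi> = Some (f \<xi>)"
    "AE \<xi> in lborel. \<xi> \<in> dom F"
    using A_ne by (rule rational_extension) blast
  have "is_qmf_fun lam \<tau> S F"
    unfolding is_qmf_fun_def f_def[symmetric] using F(1,2) by (auto simp: A_def)
  then have F_nonneg: "z \<in> \<real>\<^sub>\<ge>\<^sub>0" if "F \<xi> = Some z" for \<xi> z using sub_QMF that by blast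
  \<comment> \<open>The hypothesis yields the inequality for the real part of \<open>f\<close>; as S
    is real-valued, each term is determined by its real part.\<close>
  have S_real: "1 / total_ext S \<xi> = of_real (Re (1 / total_ext S \<xi>))" for \<xi>
  proof -
    have "total_ext S \<xi> \<in> \<real>"
      using S_nonneg by (auto simp: total_ext_def nonneg_Reals_subset_Reals[THEN subsetD] split: option.split)
    then have "1 / total_ext S \<xi> \<in> \<real>" by (intro Reals_divide) auto
    then show ?thesis by (simp add: of_real_Re)
  qed
  show ?thesis
    using A_AE F(3)
  proof eventually_elim
    case (elim \<xi>)
    then have "f \<xi> \<in> \<real>\<^sub>\<ge>\<^sub>0" using F(2) F_nonneg by blast
    then have "0 \<le> Re (f \<xi>)" by (auto simp: complex_nonneg_Reals_iff)
    moreover have "Re (of_real r / total_ext S \<zeta>) = r * Re (1 / total_ext S \<zeta>)" for r \<zeta>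
    proof -
      have "of_real r / total_ext S \<zeta> = of_real r * (1 / total_ext S \<zeta>)" by simp
      also have "\<dots> = of_real (r * Re (1 / total_ext S \<zeta>))" by (subst S_real) simp
      finally show ?thesis by (simp only: Re_complex_of_real)
    qed
    ultimately show ?case by (simp only: f_def minus_complex.simps Re_sum diff_ge_0_iff_ge)
  qed
qed

text \<open>\<open>mask_product\<close> is a total function, so the first conjunct records
  separately that almost everywhere all factors are defined and the product converges.\<close>

theorem proposition4p1:
  fixes lam :: nat
    and S \<tau> :: "real^'n \<rightharpoonup> complex"
  assumes lam: "lam \<ge> 2"
    and S_rat: "rational_trig_poly S"
    and S_nonzero: "\<exists>\<xi> z. S \<xi> = Some z \<and> z \<noteq> 0"
    and S_nonneg: "\<forall>\<xi> z. S \<xi> = Some z \<longrightarrow> z \<in> \<real>\<^sub>\<ge>\<^sub>0"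
    and tau_rat: "rational_trig_poly \<tau>"
    and tau_0: "\<tau> 0 = Some 1"
    and sub_QMF: "\<forall>F. is_qmf_fun lam \<tau> S F \<longrightarrow> (\<forall>\<xi> z. F \<xi> = Some z \<longrightarrow> z \<in> \<real>\<^sub>\<ge>\<^sub>0)"
    and S_0: "S 0 = Some 1"
    and S_cont: "continuous (at 0 within dom S) (total_ext S)"
    and S_bound: "ess_bounded (\<lambda>\<xi>. 1 / total_ext S \<xi>)"
  shows "(AE \<xi> in lborel.
            (\<forall>j. (1 / real lam ^ Suc j) *\<^sub>R \<xi> \<in> dom \<tau>) \<and>
            convergent_prod (\<lambda>j. total_ext \<tau> ((1 / real lam ^ Suc j) *\<^sub>R \<xi>))) \<and>
         (\<exists>\<phi>. fourier_L2 \<phi> (mask_product lam \<tau>) \<and>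
              refinable_with_mask lam (total_ext \<tau>) \<phi>) \<and>
         (AE \<xi> in lborel. mask_product lam \<tau> (real lam *\<^sub>R \<xi>) = total_ext \<tau> \<xi> * mask_product lam \<tau> \<xi>)"
proof -
  obtain pS qS xS where S: "trig_poly pS" "trig_poly qS" "qS xS \<noteq> 0"
    "S = (\<lambda>\<xi>. if qS \<xi> = 0 then None else Some (pS \<xi> / qS \<xi>))" "total_ext S = (\<lambda>\<xi>. pS \<xi> / qS \<xi>)"
    using rational_trig_poly_obtain[OF S_rat] .
  obtain pt qt xt where T: "trig_poly pt" "trig_poly qt" "qt xt \<noteq> 0"
    "\<tau> = (\<lambda>\<xi>. if qt \<xi> = 0 then None else Some (pt \<xi> / qt \<xi>))" "total_ext \<tau> = (\<lambda>\<xi>. pt \<xi> / qt \<xi>)"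
    using rational_trig_poly_obtain[OF tau_rat] .
  have T0: "qt 0 \<noteq> 0" "pt 0 = qt 0" using tau_0 T(4) by (auto split: if_splits)
  have S0: "qS 0 \<noteq> 0" "pS 0 = qS 0" using S_0 S(4) by (auto split: if_splits)
  define t where "t = total_ext \<tau>"
  define \<sigma> where "\<sigma> \<xi> = Re (1 / total_ext S \<xi>)" for \<xi>
  note [measurable] = trig_poly_measurable[OF S(1)] trig_poly_measurable[OF S(2)]
    trig_poly_measurable[OF T(1)] trig_poly_measurable[OF T(2)]
  have t_meas[measurable]: "t \<in> borel_measurable borel" unfolding t_def T(5) by measurable
  have \<sigma>_meas[measurable]: "\<sigma> \<in> borel_measurable borel" unfolding \<sigma>_def S(5) by measurable
  obtain \<delta> C where \<delta>: "0 < \<delta>" "\<And>\<xi>. norm \<xi> < \<delta> \<Longrightarrow> cmod (pt \<xi> / qt \<xi> - 1) \<le> C * norm \<xi>"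
    using quotient_lipschitz_near_0[OF T(1,2) T0(2,1)] by blast
  have conv: "convergent_prod (\<lambda>j. t ((1 / real lam ^ Suc j) *\<^sub>R \<xi>))" for \<xi>
    unfolding t_def T(5) by (rule dilated_product_convergent[OF lam \<delta>])
  define g where "g = mask_product lam \<tau>"
  have g_lim: "(\<lambda>k. \<Prod>j<k. t ((1 / real lam ^ Suc j) *\<^sub>R \<xi>)) \<longlonglongrightarrow> g \<xi>" for \<xi>
    using convergent_prod_LIMSEQ[OF conv[of \<xi>]]
    unfolding LIMSEQ_lessThan_iff_atMost by (simp only: g_def mask_product_def t_def)
  have g_meas: "g \<in> borel_measurable borel"
    by (rule borel_measurable_LIMSEQ_metric[OF _ g_lim]) measurable
  have per: "p (\<xi> + z) = p \<xi>" if "trig_poly p" "z \<in> lattice_2pi" for p :: "real^'n \<Rightarrow> complex" and \<xi> z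
    using that by (intro trig_poly_periodic) (auto simp: lattice_2pi_def)
  have \<sigma>_lim: "(\<lambda>k. \<sigma> ((1 / real lam ^ k) *\<^sub>R \<xi>)) \<longlonglongrightarrow> 1" for \<xi>
  proof -
    have "(\<lambda>k. (1 / real lam) ^ k *\<^sub>R \<xi>) \<longlonglongrightarrow> 0 *\<^sub>R \<xi>"
      using lam by (intro tendsto_scaleR tendsto_const LIMSEQ_realpow_zero) auto
    then have to0: "(\<lambda>k. (1 / real lam ^ k) *\<^sub>R \<xi>) \<longlonglongrightarrow> 0" by (simp add: power_divide)
    have cont: "isCont pS 0" "isCont qS 0"
      using continuous_on_interior[OF trig_poly_continuous[OF S(1)], of 0]
        continuous_on_interior[OF trig_poly_continuous[OF S(2)], of 0] by simp_all
    have "(\<lambda>k. pS ((1 / real lam ^ k) *\<^sub>R \<xi>)) \<longlonglongrightarrow> pS 0" "(\<lambda>k. qS ((1 / real lam ^ k) *\<^sub>R \<xi>)) \<longlonglongrightarrow> qS 0"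
      by (rule isCont_tendsto_compose[OF cont(1) to0], rule isCont_tendsto_compose[OF cont(2) to0])
    then have "(\<lambda>k. Re (1 / (pS ((1 / real lam ^ k) *\<^sub>R \<xi>) / qS ((1 / real lam ^ k) *\<^sub>R \<xi>)))) \<longlonglongrightarrow> Re (1 / (pS 0 / qS 0))"
      using S0 by (intro tendsto_Re tendsto_divide tendsto_const) auto
    then show ?thesis using S0 by (simp add: \<sigma>_def S(5))
  qed
  obtain B where B: "AE \<xi> in lborel. cmod (1 / total_ext S \<xi>) \<le> B"
    using S_bound by (auto simp: ess_bounded_def)
  have "L2_sq g < \<infinity>"
  proof (rule refinement_product_L2[OF lam t_meas \<sigma>_meas])
    show "t (\<xi> + z) = t \<xi>" if "z \<in> lattice_2pi" for \<xi> z
      by (simp only: t_def T(5) per[OF T(1) that] per[OF T(2) that])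
    show "\<sigma> (\<xi> + z) = \<sigma> \<xi>" if "z \<in> lattice_2pi" for \<xi> z
      by (simp only: \<sigma>_def S(5) per[OF S(1) that] per[OF S(2) that])
    show "0 \<le> \<sigma> \<xi>" for \<xi>
    proof -
      \<comment> \<open>At zeros and poles of S the value of \<sigma> is 0, so the sign condition
        holds at every point.\<close>
      have "total_ext S \<xi> \<in> \<real>\<^sub>\<ge>\<^sub>0" using S_nonneg by (auto simp: total_ext_def split: option.split)
      then obtain r where r: "0 \<le> r" "total_ext S \<xi> = of_real r" by (rule nonneg_Reals_cases)
      then have "1 / total_ext S \<xi> = of_real (1 / r)" by simp
      then have "\<sigma> \<xi> = 1 / r" by (simp only: \<sigma>_def Re_complex_of_real)
      then show ?thesis using r(1) by simp
    qed
    show "AE \<xi> in lborel. \<sigma> \<xi> \<le> B"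
      using B
    proof eventually_elim
      case (elim \<xi>)
      then show ?case unfolding \<sigma>_def by (rule order_trans[OF complex_Re_le_cmod])
    qed
    show "AE \<xi> in lborel. (\<Sum>\<gamma>\<in>shifts lam. (cmod (t (\<xi> + \<gamma>)))\<^sup>2 * \<sigma> (\<xi> + \<gamma>)) \<le> \<sigma> (real lam *\<^sub>R \<xi>)"
      unfolding t_def \<sigma>_def by (rule sub_QMF_AE[OF lam S_rat S_nonzero S_nonneg tau_rat sub_QMF])
  qed (rule g_lim \<sigma>_lim)+
  with g_meas have "in_L2 g" by (simp add: in_L2_iff)
  then obtain \<phi> where \<phi>: "fourier_L2 \<phi> g" by (rule fourier_L2_surj)
  have refine: "g (real lam *\<^sub>R \<xi>) = t \<xi> * g \<xi>" for \<xi>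
  proof -
    \<comment> \<open>Dilation by \<lambda> shifts the index by one and leaves
      \<open>t \<xi>\<close> in front; comparing partial products with k + 1 and k factors covers
      points where some factor is 0.\<close>
    have "(\<lambda>k. \<Prod>j<Suc k. t ((1 / real lam ^ Suc j) *\<^sub>R (real lam *\<^sub>R \<xi>))) \<longlonglongrightarrow> g (real lam *\<^sub>R \<xi>)"
      using g_lim by (rule LIMSEQ_Suc)
    moreover have "(\<Prod>j<Suc k. t ((1 / real lam ^ Suc j) *\<^sub>R (real lam *\<^sub>R \<xi>)))
        = t \<xi> * (\<Prod>j<k. t ((1 / real lam ^ Suc j) *\<^sub>R \<xi>))" for k
      using lam by (subst prod.lessThan_Suc_shift) simp
    ultimately have "(\<lambda>k. t \<xi> * (\<Prod>j<k. t ((1 / real lam ^ Suc j) *\<^sub>R \<xi>))) \<longlonglongrightarrow> g (real lam *\<^sub>R \<xi>)"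
      by (simp only:)
    moreover have "(\<lambda>k. t \<xi> * (\<Prod>j<k. t ((1 / real lam ^ Suc j) *\<^sub>R \<xi>))) \<longlonglongrightarrow> t \<xi> * g \<xi>"
      by (intro tendsto_mult tendsto_const g_lim)
    ultimately show ?thesis by (rule LIMSEQ_unique)
  qed
  have "periodic_2pi t"
    unfolding periodic_2pi_def
  proof (intro allI)
    fix \<xi> :: "real^'n" and i :: 'n
    have "axis i (2 * pi) \<in> (lattice_2pi :: (real^'n) set)"
      unfolding lattice_2pi_def
    proof (intro CollectI allI)
      fix j
      show "\<exists>m::int. (axis i (2 * pi) :: real^'n) $ j = 2 * pi * of_int m"
        by (intro exI[of _ "if i = j then 1 else 0"]) (simp add: axis_def)
    qed
    then show "t (\<xi> + axis i (2 * pi)) = t \<xi>"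
      by (simp only: t_def T(5) per[OF T(1)] per[OF T(2)])
  qed
  then have "refinable_with_mask lam t \<phi>"
    using \<phi> refine by (auto simp: refinable_with_mask_def fourier_L2_def[of \<phi>] intro!: exI[of _ g])
  moreover have "AE \<xi> in lborel. \<forall>j. (1 / real lam ^ Suc j) *\<^sub>R \<xi> \<in> dom \<tau>"
    unfolding AE_all_countable
  proof
    fix j
    show "AE \<xi> in lborel. (1 / real lam ^ Suc j) *\<^sub>R \<xi> \<in> dom \<tau>"
      using AE_lborel_affine[OF trig_poly_nonzero_AE[OF T(2,3)], of "1 / real lam ^ Suc j" 0] lam
      by (simp add: T(4) domIff)
  qed
  ultimately show ?thesis
    using \<phi> refine conv unfolding t_def g_def by auto
qed

end
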